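(* Let $\mathbb{H}$ be the space of infinite Hermitian matrices $\mathbf{H}=(\mathbf{H}_{ij})_{i,j\ge1}$, and for $N\ge1$ let $\pi_N^\infty(\mathbf{H})=(\mathbf{H}_{ij})_{i,j=1}^N$ be the $N\times N$ principal submatrix. Let $\mathsf{M}$ be a Borel probability measure on $\mathbb{H}$ that is invariant under conjugation by the infinite-dimensional unitary group $\mathbb{U}(\infty)$, and let $\mathbf{H}$ have law $\mathsf{M}$. Then $\mathsf{M}$-almost surely there is a (random) $\omega\in\Omega$ such that, uniformly on compact subsets of $\mathbb{C}$, $$\det\left(\mathbf{I}-\frac{z}{N}\pi_N^\infty(\mathbf{H})\right)=\prod_{i=1}^N\left(1-z\frac{\lambda_i^{(N)}}{N}\right)\xrightarrow[N\to\infty]{}\mathsf{E}_\omega(z),$$ where $\lambda_1^{(N)}\ge\dots\ge\lambda_N^{(N)}$ are the eigenvalues of $\pi_N^\infty(\mathbf{H})$, and the law of $\omega$ is $\nu_{\mathsf{M}}$. Moreover, for every Borel probability measure $\nu$ on $\Omega$ there exists such an invariant $\mathsf{M}$ with $\nu_{\mathsf{M}}=\nu$, so that every random $\mathcal{LP}$ function $\mathsf{E}_\omega$ (with $\omega$ of law $\nu$) arises as such a limit.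
   Context: Let $\Omega$ be the set of $\omega=(\alpha^+,\alpha^-,\gamma_1,\gamma_2)$ where $\alpha^\pm=(\alpha_1^\pm\ge\alpha_2^\pm\ge\dots\ge0)$ are non-increasing sequences of non-negative reals with $\sum_i(\alpha_i^+)^2+\sum_i(\alpha_i^-)^2<\infty$, $\gamma_1\in\mathbb{R}$, $\gamma_2\ge0$. Set $\delta=\gamma_2+\sum_i(\alpha_i^+)^2+\sum_i(\alpha_i^-)^2$; $\Omega$ is topologised by coordinate-wise convergence of $(\alpha^+,\alpha^-,\gamma_1,\delta)$. For $\omega\in\Omega$ define the entire function $$\mathsf{E}_\omega(z)=e^{-\gamma_1 z-\frac{\gamma_2}{2}z^2}\prod_{i\ge1}e^{z\alpha_i^+}(1-z\alpha_i^+)\prod_{i\ge1}e^{-z\alpha_i^-}(1+z\alpha_i^-).$$ The Laguerre–Pólya class $\mathcal{LP}$ is $\{\mathsf{E}_\omega:\omega\in\Omega\}$. For $\omega\in\Omega$, let $\mathfrak{N}_\omega$ be the law of the random infinite Hermitian matrix $$\mathbf{H}^{(\omega)}_{ij}=\gamma_1\mathbf{1}_{i=j}+\sqrt{\gamma_2}\,\mathbf{G}_{ij}+\sum_{k\ge1}\alpha_k^+\left(\xi_i^{+,(k)}\overline{\xi_j^{+,(k)}}-\mathbf{1}_{i=j}\right)-\sum_{k\ge1}\alpha_k^-\left(\xi_i^{-,(k)}\overline{\xi_j^{-,(k)}}-\mathbf{1}_{i=j}\right),$$ where $\mathbf{G}$ is an infinite Gaussian Unitary Ensemble matrix with $\mathbb{E}[\mathbf{G}_{ii}^2]=1$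 and $\{\xi_i^{\pm,(k)}\}$ are independent standard complex Gaussians independent of $\mathbf{G}$. The $\mathfrak{N}_\omega$ are exactly the ergodic $\mathbb{U}(\infty)$-conjugation-invariant measures on $\mathbb{H}$, and every invariant probability measure $\mathsf{M}$ decomposes uniquely as $\mathsf{M}=\int_\Omega\mathfrak{N}_\omega\,\nu_{\mathsf{M}}(d\omega)$ for a unique Borel probability measure $\nu_{\mathsf{M}}$ on $\Omega$; this map $\mathsf{M}\mapsto\nu_{\mathsf{M}}$ is a bijection onto the Borel probability measures on $\Omega$. *)

theory Defs
  imports "HOL-Probability.Probability" "Jordan_Normal_Form.Determinant"
begin

text \<open>Infinite matrices are indexed from 0 (entry (i,j) here is entry (i+1,j+1) of the paper).\<close>

type_synonym hmat = "nat \<Rightarrow> nat \<Rightarrow> complex"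

definition Herm :: "hmat set" where
  "Herm = {H. \<forall>i j. H i j = cnj (H j i)}"

text \<open>Borel sigma-algebra of the product (entrywise convergence) topology, restricted to Herm.\<close>
definition HM :: "hmat measure" where
  "HM = restrict_space borel Herm"

definition principal :: "nat \<Rightarrow> hmat \<Rightarrow> complex mat" where
  "principal N H = mat N N (\<lambda>(i, j). H i j)"

definition scaled_det :: "hmat \<Rightarrow> nat \<Rightarrow> complex \<Rightarrow> complex" where
  "scaled_det H N z = det (1\<^sub>m N - (z / of_nat N) \<cdot>\<^sub>m principal N H)"

definition unitary_N :: "nat \<Rightarrow> hmat \<Rightarrow> bool" where
  "unitary_N N u \<longleftrightarrow> (\<forall>i<N. \<forall>j<N. (\<Sum>k<N. u i k * cnj (u j k)) = (if i = j then 1 else 0))"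

definition ext_unitary :: "nat \<Rightarrow> hmat \<Rightarrow> hmat" where
  "ext_unitary N u i k = (if i < N \<and> k < N then u i k else if i = k then 1 else 0)"

text \<open>Conjugation H \<mapsto> U H U^*; all nonzero terms have indices below Suc (N + i + j).\<close>
definition conj_by :: "nat \<Rightarrow> hmat \<Rightarrow> hmat \<Rightarrow> hmat" where
  "conj_by N u H i j =
     (\<Sum>k<Suc (N + i + j). \<Sum>l<Suc (N + i + j).
        ext_unitary N u i k * H k l * cnj (ext_unitary N u j l))"

definition U_invariant :: "hmat measure \<Rightarrow> bool" where
  "U_invariant M \<longleftrightarrow> (\<forall>N u. unitary_N N u \<longrightarrow> distr M HM (conj_by N u) = M)"

type_synonym omega = "(nat \<Rightarrow> real) \<times> (nat \<Rightarrow> real) \<times> real \<times> real"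

definition Omega :: "omega set" where
  "Omega = {(ap, am, g1, g2).
     decseq ap \<and> (\<forall>i. ap i \<ge> 0) \<and> decseq am \<and> (\<forall>i. am i \<ge> 0) \<and>
     summable (\<lambda>i. (ap i)\<^sup>2) \<and> summable (\<lambda>i. (am i)\<^sup>2) \<and> g2 \<ge> 0}"

definition omega_delta :: "omega \<Rightarrow> real" where
  "omega_delta w = (case w of (ap, am, g1, g2) \<Rightarrow> g2 + (\<Sum>i. (ap i)\<^sup>2) + (\<Sum>i. (am i)\<^sup>2))"

text \<open>Coordinates (alpha+, alpha-, gamma1, delta); Omega carries the topology of coordinatewise
  convergence of these, so its Borel sigma-algebra is the pullback of the product Borel sets.\<close>
definition omega_coords :: "omega \<Rightarrow> omega" where
  "omega_coords w = (case w of (ap, am, g1, g2) \<Rightarrow> (ap, am, g1, omega_delta w))"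

definition OmegaM :: "omega measure" where
  "OmegaM = vimage_algebra Omega omega_coords borel"

definition E_LP :: "omega \<Rightarrow> complex \<Rightarrow> complex" where
  "E_LP w z = (case w of (ap, am, g1, g2) \<Rightarrow>
     exp (- of_real g1 * z - of_real g2 / 2 * z\<^sup>2)
     * (\<Prod>i. exp (z * of_real (ap i)) * (1 - z * of_real (ap i)))
     * (\<Prod>i. exp (- z * of_real (am i)) * (1 + z * of_real (am i))))"

text \<open>Index set for a countable family of i.i.d. real standard Gaussians.
  GD i: diagonal of G; GO i j b: real (b=True) / imaginary part of G i j, i<j;
  XI s k i b: real/imaginary part of xi_i^{s,(k)} (s=True for +, False for -).\<close>
datatype gidx = GD nat | GO nat nat bool | XI bool nat nat bool

definition Gauss :: "(gidx \<Rightarrow> real) measure" where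
  "Gauss = PiM UNIV (\<lambda>_. density lborel std_normal_density)"

text \<open>GUE with E[G_ii^2] = 1 and E|G_ij|^2 = 1 for i \<noteq> j.\<close>
definition GUE :: "(gidx \<Rightarrow> real) \<Rightarrow> hmat" where
  "GUE x i j =
     (if i = j then complex_of_real (x (GD i))
      else if i < j then Complex (x (GO i j True)) (x (GO i j False)) / complex_of_real (sqrt 2)
      else cnj (Complex (x (GO j i True)) (x (GO j i False)) / complex_of_real (sqrt 2)))"

text \<open>Standard complex Gaussians: E|xi|^2 = 1.\<close>
definition xi :: "(gidx \<Rightarrow> real) \<Rightarrow> bool \<Rightarrow> nat \<Rightarrow> nat \<Rightarrow> complex" where
  "xi x s k i = Complex (x (XI s k i True)) (x (XI s k i False)) / complex_of_real (sqrt 2)"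

text \<open>Sum of a series, taken to be 0 on the (null) event where it diverges.\<close>
definition ssum :: "(nat \<Rightarrow> complex) \<Rightarrow> complex" where
  "ssum f = (if summable f then suminf f else 0)"

definition Hom :: "omega \<Rightarrow> (gidx \<Rightarrow> real) \<Rightarrow> hmat" where
  "Hom w x i j = (case w of (ap, am, g1, g2) \<Rightarrow>
      (if i = j then of_real g1 else 0)
    + of_real (sqrt g2) * GUE x i j
    + ssum (\<lambda>k. of_real (ap k) * (xi x True k i * cnj (xi x True k j) - (if i = j then 1 else 0)))
    - ssum (\<lambda>k. of_real (am k) * (xi x False k i * cnj (xi x False k j) - (if i = j then 1 else 0))))"

definition Nmeas :: "omega \<Rightarrow> hmat measure" where
  "Nmeas w = distr Gauss HM (Hom w)"

text \<open>nu is the (unique) decomposition measure of M: M = \<integral> N_omega nu(d omega).\<close>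
definition decomposes :: "hmat measure \<Rightarrow> omega measure \<Rightarrow> bool" where
  "decomposes M \<nu> \<longleftrightarrow> prob_space \<nu> \<and> sets \<nu> = sets OmegaM \<and>
     (\<forall>A\<in>sets HM. emeasure M A = (\<integral>\<^sup>+ w. emeasure (Nmeas w) A \<partial>\<nu>))"

definition borel_prob_H :: "hmat measure \<Rightarrow> bool" where
  "borel_prob_H M \<longleftrightarrow> prob_space M \<and> sets M = sets HM"

definition borel_prob_Omega :: "omega measure \<Rightarrow> bool" where
  "borel_prob_Omega \<nu> \<longleftrightarrow> prob_space \<nu> \<and> sets \<nu> = sets OmegaM"

end

theory Submission
  imports Defs "Jordan_Normal_Form.Char_Poly" "HOL-Complex_Analysis.Complex_Analysis"
    "HOL-Library.Discrete_Functions"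
begin

text \<open>
  The coefficients of \<open>det (1 - z H\<^sub>N / N)\<close> are, up to sign and the factor \<open>N\<^sup>-\<^sup>k\<close>, sums of all principal
  \<open>k \<times> k\<close> minors of \<open>H\<^sub>N\<close>. For the model with fixed parameters \<open>w\<close> the minors of disjoint index sets are
  independent, so these sums are dissociated U-statistics and obey a strong law of large numbers: the
  coefficients converge almost surely to the expected minors divided by \<open>k!\<close>. The exponential generating
  function of the expected minors is multiplicative under independent sums with a torus-invariant
  summand; rank one summands contribute \<open>1 - a z\<close> and the GUE contributes \<open>exp (- g z\<^sup>2 / 2)\<close>, hence the
  limits are the Taylor coefficients of \<open>E\<^sub>w\<close>. Since the polynomials are real-rooted, their first two
  coefficients bound them by \<open>exp (B |z| + C |z|\<^sup>2)\<close>, which upgrades coefficientwise to locally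
  uniform convergence.

  The parameters are recovered measurably from the limiting coefficients: Newton's identities yield the
  power sums, i.e. the moments of a finite measure with atoms at \<open>\<alpha>\<^sup>+\<^sub>i\<close> and \<open>- \<alpha>\<^sup>-\<^sub>i\<close>, and the atoms are peeled off
  one by one from the growth of the moments. Mixing over \<open>w\<close> gives the statement for a decomposed measure.
  Unitary invariance of the model is rotation invariance of i.i.d. standard Gaussians, obtained from
  joint characteristic functions.
\<close>

unbundle no vec_syntax


section \<open>Principal minors\<close>

text \<open>They are computed for the truncations \<open>Htr\<close>, whose entries have all
  moments, and passed to the limit by L2 bounds uniform in the truncation level. Kolmogorov's
  one-series theorem supplies the almost sure convergence, exponential moments supply the uniform
  bounds.

  In the law of large numbers the variance is only of order 1/N, which is not summable; hence the
  detour through the squares N = m^2.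

  The parameter \<omega> must have a law on \<open>OmegaM\<close>, so it has to be a measurable
  function of the matrix. This is why the inverse map from coefficients to parameters is explicit,
  built from limits and series, instead of an appeal to uniqueness of the Hadamard factorisation.
  Each \<open>Nmeas w\<close> is then concentrated on matrices whose recovered parameter is
  \<open>w\<close>, so that a mixture over \<open>\<nu>\<close> gives the recovered parameter the
  law \<open>\<nu>\<close>.\<close>

definition dets :: "nat set \<Rightarrow> hmat \<Rightarrow> complex" where
  "dets S H = (\<Sum>p | p permutes S. of_int (sign p) * (\<Prod>i\<in>S. H i (p i)))"

lemma permutes_restrict_invariant:
  assumes "p permutes S" "finite T" "p ` T = T"
  shows "(\<lambda>i. if i \<in> T then p i else i) permutes T"
proof (rule bij_imp_permutes)
  have "inj_on p T" using assms(1) by (meson inj_on_subset permutes_inj subset_UNIV)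
  then have "bij_betw p T T" using assms by (simp add: bij_betw_def)
  then show "bij_betw (\<lambda>i. if i \<in> T then p i else i) T T"
    by (rule bij_betw_cong[THEN iffD1, rotated]) auto
qed auto

text \<open>A permutation of \<open>S\<close> that preserves \<open>T\<close> is uniquely a product
  of one of \<open>S - T\<close> and one of \<open>T\<close>, and the sign is multiplicative. Two
  matrices occur because the lemma is applied to the expanded minor of a sum, in which
  \<open>T\<close> is the set of rows taken from \<open>B\<close>.\<close>

lemma dets_mult_dets:
  assumes fS: "finite S" and TS: "T \<subseteq> S"
  shows "(\<Sum>p | p permutes S \<and> p ` T = T. of_int (sign p) *
            ((\<Prod>i\<in>S - T. A i (p i)) * (\<Prod>i\<in>T. B i (p i)))) = dets (S - T) A * dets T B"
proof -
  have fT: "finite T" using fS TS finite_subset by auto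
  have "dets (S - T) A * dets T B =
     (\<Sum>(r, q)\<in>{r. r permutes (S - T)} \<times> {q. q permutes T}.
        (of_int (sign r) * (\<Prod>i\<in>S - T. A i (r i))) * (of_int (sign q) * (\<Prod>i\<in>T. B i (q i))))"
    by (simp add: dets_def sum_product sum.cartesian_product)
  also have "\<dots> = (\<Sum>p | p permutes S \<and> p ` T = T. of_int (sign p) *
            ((\<Prod>i\<in>S - T. A i (p i)) * (\<Prod>i\<in>T. B i (p i))))"
  proof (rule sum.reindex_bij_witness[where j = "\<lambda>(r, q). r \<circ> q" and
        i = "\<lambda>p. (\<lambda>i. if i \<in> S - T then p i else i, \<lambda>i. if i \<in> T then p i else i)"])
    fix a assume "a \<in> {r. r permutes (S - T)} \<times> {q. q permutes T}"
    then obtain r q where a: "a = (r, q)" and r: "r permutes (S - T)" and q: "q permutes T" by auto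
    have qi: "q i \<in> T" if "i \<in> T" for i using q that by (simp add: permutes_in_image)
    have ri: "r i \<in> S - T" if "i \<in> S - T" for i using r that by (metis permutes_in_image)
    have rT: "r i = i" if "i \<in> T" for i using r that by (simp add: permutes_def)
    have qT: "q i = i" if "i \<notin> T" for i using q that by (simp add: permutes_def)
    have rS: "r i = i" if "i \<notin> S" for i using r that by (simp add: permutes_def)
    show "(\<lambda>p. (\<lambda>i. if i \<in> S - T then p i else i, \<lambda>i. if i \<in> T then p i else i))
           ((\<lambda>(r, q). r \<circ> q) a) = a"
      unfolding a using qi ri rT qT rS TS by (auto simp: fun_eq_iff)
    have im: "(r \<circ> q) ` T = T"
      using rT qi permutes_image[OF q] by (auto simp: image_comp[symmetric])
    have "r permutes S" "q permutes S" using r q TS by (auto intro: permutes_subset)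
    then show "(\<lambda>(r, q). r \<circ> q) a \<in> {p. p permutes S \<and> p ` T = T}"
      unfolding a using im by (auto intro: permutes_compose)
    have sg: "sign (r \<circ> q) = sign r * sign q"
      using r q fS fT by (intro sign_compose) (auto intro: permutes_imp_permutation[rotated] finite_Diff)
    have "(\<Prod>i\<in>S - T. A i ((r \<circ> q) i)) = (\<Prod>i\<in>S - T. A i (r i))"
      by (intro prod.cong) (auto simp: qT)
    moreover have "(\<Prod>i\<in>T. B i ((r \<circ> q) i)) = (\<Prod>i\<in>T. B i (q i))"
      by (intro prod.cong) (auto simp: rT qi)
    ultimately show "of_int (sign ((\<lambda>(r, q). r \<circ> q) a)) *
         ((\<Prod>i\<in>S - T. A i ((\<lambda>(r, q). r \<circ> q) a i)) * (\<Prod>i\<in>T. B i ((\<lambda>(r, q). r \<circ> q) a i))) =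
         (case a of (r, q) \<Rightarrow> of_int (sign r) * (\<Prod>i\<in>S - T. A i (r i)) *
            (of_int (sign q) * (\<Prod>i\<in>T. B i (q i))))"
      unfolding a by (simp add: sg)
  next
    fix p assume "p \<in> {p. p permutes S \<and> p ` T = T}"
    then have p: "p permutes S" "p ` T = T" by auto
    have p': "p ` (S - T) = S - T"
      using p by (metis image_set_diff permutes_image permutes_inj)
    have pT: "p i \<in> T \<longleftrightarrow> i \<in> T" for i
      using p by (metis image_eqI inj_image_mem_iff permutes_inj)
    have pS: "p i = i" if "i \<notin> S" for i using p that by (simp add: permutes_def)
    show "(\<lambda>(r, q). r \<circ> q) (\<lambda>i. if i \<in> S - T then p i else i, \<lambda>i. if i \<in> T then p i else i) = p"
      using pT pS TS by (auto simp: fun_eq_iff)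
    show "(\<lambda>i. if i \<in> S - T then p i else i, \<lambda>i. if i \<in> T then p i else i)
        \<in> {r. r permutes S - T} \<times> {q. q permutes T}"
      using permutes_restrict_invariant[OF p(1) _ p(2)] permutes_restrict_invariant[OF p(1) _ p'] fS fT
      by auto
  qed
  finally show ?thesis by simp
qed

text \<open>Multilinearity in the rows; \<open>T\<close> records the rows taken from
  \<open>B\<close>. The inner sum still runs over all permutations: those that do not preserve
  \<open>T\<close> drop out for different reasons in the two applications, zero entries of the
  identity matrix in one and vanishing expectations in the other.\<close>

lemma dets_add:
  assumes "finite S"
  shows "dets S (\<lambda>i j. A i j + B i j) = (\<Sum>T\<in>Pow S. \<Sum>p | p permutes S. of_int (sign p) *
            ((\<Prod>i\<in>S - T. A i (p i)) * (\<Prod>i\<in>T. B i (p i))))"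
proof -
  have "dets S (\<lambda>i j. A i j + B i j) = (\<Sum>p | p permutes S. \<Sum>T\<in>Pow S. of_int (sign p) *
            ((\<Prod>i\<in>S - T. A i (p i)) * (\<Prod>i\<in>T. B i (p i))))"
    unfolding dets_def
  proof (intro sum.cong refl)
    fix p
    have "(\<Prod>i\<in>S. A i (p i) + B i (p i)) = (\<Prod>i\<in>S. B i (p i) + A i (p i))" by (simp add: add.commute)
    also have "\<dots> = (\<Sum>T\<in>Pow S. (\<Prod>i\<in>T. B i (p i)) * (\<Prod>i\<in>S - T. A i (p i)))"
      by (rule prod_add[OF assms])
    finally show "of_int (sign p) * (\<Prod>i\<in>S. A i (p i) + B i (p i)) = (\<Sum>T\<in>Pow S. of_int (sign p) *
            ((\<Prod>i\<in>S - T. A i (p i)) * (\<Prod>i\<in>T. B i (p i))))"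
      by (simp add: sum_distrib_left mult.commute)
  qed
  also have "\<dots> = (\<Sum>T\<in>Pow S. \<Sum>p | p permutes S. of_int (sign p) *
            ((\<Prod>i\<in>S - T. A i (p i)) * (\<Prod>i\<in>T. B i (p i))))" by (rule sum.swap)
  finally show ?thesis .
qed

lemma dets_scale: "dets T (\<lambda>i j. c * H i j) = c ^ card T * dets T H"
  by (simp add: dets_def sum_distrib_left prod.distrib mult.assoc mult.left_commute)

lemma dets_diagonal:
  assumes "finite S"
  shows "dets S (\<lambda>i j. if i = j then c else 0) = c ^ card S"
proof -
  have "dets S (\<lambda>i j. if i = j then c else 0) = (\<Sum>p \<in> {p. p permutes S}. if p = id then c ^ card S else 0)"
    unfolding dets_def
  proof (intro sum.cong refl)
    fix p assume "p \<in> {p. p permutes S}"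
    then have p: "p permutes S" by simp
    show "of_int (sign p) * (\<Prod>i\<in>S. if i = p i then c else 0) = (if p = id then c ^ card S else 0)"
    proof (cases "p = id")
      case False
      then obtain i where "p i \<noteq> i" by (auto simp: fun_eq_iff)
      then have "i \<in> S" "i \<noteq> p i" using p by (auto simp: permutes_def)
      then have "(\<Prod>i\<in>S. if i = p i then c else 0) = 0"
        using assms by (intro prod_zero) (auto intro!: bexI[of _ i])
      then show ?thesis using False by simp
    qed simp
  qed
  also have "\<dots> = c ^ card S" using assms by (simp add: finite_permutations permutes_id)
  finally show ?thesis .
qed

text \<open>A permutation contributes only if it fixes \<open>S - T\<close> pointwise, because the
  off-diagonal entries of the identity vanish; then it preserves \<open>T\<close> and what remains
  is a minor of \<open>B\<close>.\<close>

lemma dets_one_plus: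
  assumes fS: "finite S"
  shows "dets S (\<lambda>i j. (if i = j then 1 else 0) + B i j) = (\<Sum>T\<in>Pow S. dets T B)"
  unfolding dets_add[OF fS]
proof (intro sum.cong refl)
  fix T assume "T \<in> Pow S" then have T: "T \<subseteq> S" by simp
  have fT: "finite T" using fS T finite_subset by auto
  have "(\<Sum>p | p permutes S. of_int (sign p) *
      ((\<Prod>i\<in>S - T. if i = p i then 1 else 0) * (\<Prod>i\<in>T. B i (p i)))) =
     (\<Sum>p | p permutes S \<and> p ` T = T. of_int (sign p) *
      ((\<Prod>i\<in>S - T. if i = p i then 1 else 0) * (\<Prod>i\<in>T. B i (p i))))"
  proof (rule sum.mono_neutral_right)
    show "\<forall>p\<in>{p. p permutes S} - {p. p permutes S \<and> p ` T = T}. of_int (sign p) *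
      ((\<Prod>i\<in>S - T. if i = p i then 1 else 0) * (\<Prod>i\<in>T. B i (p i))) = 0"
    proof
      fix p assume "p\<in>{p. p permutes S} - {p. p permutes S \<and> p ` T = T}"
      then have p: "p permutes S" "p ` T \<noteq> T" by auto
      have "\<exists>i\<in>S - T. p i \<noteq> i"
      proof (rule ccontr)
        assume "\<not> ?thesis"
        then have "p ` (S - T) = S - T" by force
        moreover have "p ` S = S" "inj p" using p by (auto simp: permutes_image permutes_inj)
        ultimately have "p ` (S - (S - T)) = S - (S - T)" by (metis image_set_diff)
        then show False using p T by (simp add: double_diff)
      qed
      then obtain i where "i \<in> S - T" "p i \<noteq> i" by auto
      then have "(\<Prod>i\<in>S - T. if i = p i then 1 else 0) = (0::complex)"
        using fS by (intro prod_zero) (auto intro!: bexI[of _ i])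
      then show "of_int (sign p) *
        ((\<Prod>i\<in>S - T. if i = p i then 1 else 0) * (\<Prod>i\<in>T. B i (p i))) = 0" by simp
    qed
  qed (use fS in \<open>auto simp: finite_permutations\<close>)
  also have "\<dots> = dets (S - T) (\<lambda>i j. if i = j then 1 else 0) * dets T B"
    by (rule dets_mult_dets[OF fS T])
  also have "\<dots> = dets T B" using fS by (simp add: dets_diagonal)
  finally show "(\<Sum>p | p permutes S. of_int (sign p) *
      ((\<Prod>i\<in>S - T. if i = p i then 1 else 0) * (\<Prod>i\<in>T. B i (p i)))) = dets T B" .
qed

lemma det_eq_dets:
  assumes "A \<in> carrier_mat n n"
  shows "det A = dets {..<n} (\<lambda>i j. A $$ (i, j))"
  unfolding det_def'[OF assms] dets_def atLeast0LessThan ..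

text \<open>Up to sign, the elementary symmetric functions of the eigenvalues of the corner, normalised by powers of \<open>N\<close>.\<close>
definition scoef :: "hmat \<Rightarrow> nat \<Rightarrow> nat \<Rightarrow> complex" where
  "scoef H N k = (-1) ^ k / of_nat N ^ k * (\<Sum>T | T \<subseteq> {..<N} \<and> card T = k. dets T H)"

lemma scaled_det_eq_sum: "scaled_det H N z = (\<Sum>k\<le>N. scoef H N k * z ^ k)"
proof -
  let ?A = "1\<^sub>m N - (z / of_nat N) \<cdot>\<^sub>m principal N H"
  have A: "?A \<in> carrier_mat N N" unfolding principal_def by (intro minus_carrier_mat) simp
  have "scaled_det H N z = dets {..<N} (\<lambda>i j. ?A $$ (i, j))"
    unfolding scaled_det_def by (rule det_eq_dets[OF A])
  also have "\<dots> = dets {..<N} (\<lambda>i j. (if i = j then 1 else 0) + (- z / of_nat N) * H i j)"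
  proof -
    have "?A $$ (i, p i) = (if i = p i then 1 else 0) + (- z / of_nat N) * H i (p i)"
      if "p permutes {..<N}" "i < N" for p i
      using that permutes_in_image[OF that(1), of i] by (auto simp: principal_def)
    then show ?thesis unfolding dets_def by (intro sum.cong refl arg_cong2[where f="(*)"] prod.cong) auto
  qed
  also have "\<dots> = (\<Sum>T\<in>Pow {..<N}. (- z / of_nat N) ^ card T * dets T H)"
    by (simp only: dets_one_plus[OF finite_lessThan] dets_scale)
  also have "\<dots> = (\<Sum>k\<in>{..N}. \<Sum>T | T \<in> Pow {..<N} \<and> card T = k. (- z / of_nat N) ^ card T * dets T H)"
    using card_mono[of "{..<N}"] by (intro sum.group[symmetric]) auto
  also have "\<dots> = (\<Sum>k\<le>N. scoef H N k * z ^ k)"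
  proof (intro sum.cong refl)
    fix k
    have "(\<Sum>T | T \<in> Pow {..<N} \<and> card T = k. (- z / of_nat N) ^ card T * dets T H) =
       (\<Sum>T | T \<subseteq> {..<N} \<and> card T = k. (- z / of_nat N) ^ k * dets T H)"
      by (intro sum.cong) auto
    also have "\<dots> = scoef H N k * z ^ k"
      unfolding scoef_def sum_distrib_left[symmetric] power_divide power_minus[of z] by simp
    finally show "(\<Sum>T | T \<in> Pow {..<N} \<and> card T = k. (- z / of_nat N) ^ card T * dets T H) = 
      scoef H N k * z ^ k" .
  qed
  finally show ?thesis .
qed

section \<open>Real-rootedness of Hermitian determinants\<close>

lemma hermitian_eigenvalue_real:
  assumes A: "A \<in> carrier_mat n n" and h: "\<And>i j. i < n \<Longrightarrow> j < n \<Longrightarrow> A $$ (i, j) = cnj (A $$ (j, i))"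
    and ev: "eigenvalue A a"
  shows "a \<in> \<real>"
proof -
  obtain v where v: "v \<in> carrier_vec n" "v \<noteq> 0\<^sub>v n" "A *\<^sub>v v = a \<cdot>\<^sub>v v"
    using ev A unfolding eigenvalue_def eigenvector_def by auto
  have e: "(\<Sum>j<n. A $$ (i, j) * v $ j) = a * v $ i" if "i < n" for i
  proof -
    have "(A *\<^sub>v v) $ i = a * v $ i" using v that by auto
    moreover have "(A *\<^sub>v v) $ i = (\<Sum>j<n. A $$ (i, j) * v $ j)"
      using that A v(1) by (auto simp: scalar_prod_def atLeast0LessThan)
    ultimately show ?thesis by simp
  qed
  \<comment> \<open>The quadratic form of \<open>A\<close> at the eigenvector: it is self-conjugate
    and equals \<open>a\<close> times the positive number \<open>s\<close>.\<close>
  define q where "q = (\<Sum>i<n. \<Sum>j<n. cnj (v $ i) * (A $$ (i, j) * v $ j))"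
  define s where "s = (\<Sum>i<n. (cmod (v $ i))\<^sup>2)"
  have q1: "q = a * of_real s"
  proof -
    have "(\<Sum>j<n. cnj (v $ i) * (A $$ (i, j) * v $ j)) = a * of_real ((cmod (v $ i))\<^sup>2)" if "i < n" for i
      unfolding sum_distrib_left[symmetric] e[OF that] complex_norm_square by (simp only: mult_ac)
    then show ?thesis unfolding q_def s_def by (simp add: sum_distrib_left)
  qed
  have "cnj q = (\<Sum>i<n. \<Sum>j<n. cnj (v $ j) * (A $$ (j, i) * v $ i))"
    unfolding q_def by (simp add: h[symmetric] mult_ac)
  also have "\<dots> = q" unfolding q_def by (rule sum.swap)
  finally have q2: "cnj q = q" .
  obtain i where i: "i < n" "v $ i \<noteq> 0" using v by (metis carrier_vecD eq_vecI index_zero_vec)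
  have "s > 0" unfolding s_def using i by (intro sum_pos2[of _ i]) auto
  then have "cnj a = a" using q1 q2 by auto
  then show ?thesis by (simp add: Reals_cnj_iff)
qed

lemma poly_prod_list_linear: "poly (\<Prod>a\<leftarrow>as. [:- a, 1:]) x = (\<Prod>a\<leftarrow>as. x - (a::'a::comm_ring_1))"
  by (induction as) (auto simp: algebra_simps)

text \<open>For nonzero z, det (1 - z A) is z^n times the characteristic polynomial at 1/z; z = 0 is
  treated apart because of the division. The eigenvalues are real, so passing to their real parts
  loses nothing.\<close>

lemma hermitian_det_factorization:
  assumes A: "A \<in> carrier_mat n n" and h: "\<And>i j. i < n \<Longrightarrow> j < n \<Longrightarrow> A $$ (i, j) = cnj (A $$ (j, i))"
  shows "\<exists>ls :: real list. \<forall>z. det (1\<^sub>m n - z \<cdot>\<^sub>m A) = (\<Prod>l\<leftarrow>ls. 1 - z * of_real l)"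
proof -
  obtain as where as: "char_poly A = (\<Prod> a \<leftarrow> as. [:- a, 1:])" "length as = n"
    using char_poly_factorized[OF A] by auto
  have real: "a \<in> \<real>" if "a \<in> set as" for a
  proof -
    have "poly (char_poly A) a = 0" unfolding as poly_prod_list_linear using that
      by (auto simp: prod_list_zero_iff)
    then show ?thesis using hermitian_eigenvalue_real[OF A h] eigenvalue_root_char_poly[OF A] by blast
  qed
  have "det (1\<^sub>m n - z \<cdot>\<^sub>m A) = (\<Prod>l\<leftarrow>map Re as. 1 - z * of_real l)" for z
  proof (cases "z = 0")
    case True
    have "1\<^sub>m n - 0 \<cdot>\<^sub>m A = 1\<^sub>m n" using A by auto
    moreover have "prod_list (map (\<lambda>l. 1) as) = (1::complex)" by (induction as) auto
    ultimately show ?thesis using True by (simp add: o_def)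
  next
    case False
    have "1\<^sub>m n - z \<cdot>\<^sub>m A = z \<cdot>\<^sub>m (- char_matrix A (1/z))"
      using A False by (intro eq_matI) (auto simp: char_matrix_def algebra_simps)
    then have "det (1\<^sub>m n - z \<cdot>\<^sub>m A) = z ^ n * poly (char_poly A) (1/z)"
      using A by (simp add: char_poly_matrix[OF A] char_matrix_def)
    also have "\<dots> = (\<Prod>a\<leftarrow>as. z * (1/z - a))"
      unfolding as(1) poly_prod_list_linear as(2)[symmetric] by (induction as) auto
    also have "\<dots> = (\<Prod>l\<leftarrow>map Re as. 1 - z * of_real l)"
      using real False
      by (auto intro!: arg_cong[where f=prod_list] simp: algebra_simps of_real_Re)
    finally show ?thesis .
  qed
  then show ?thesis by blast
qed

section \<open>Coefficientwise convergence of entire functions\<close>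

text \<open>Bound for the genus one factor: |1 - w|^2 = 1 - 2 Re w + |w|^2 is at most the
  exponential of -2 Re w + |w|^2, and the factor \<open>exp w\<close> cancels the linear term. It
  holds for every w, so products of such factors are controlled by sums of squares alone.\<close>

lemma norm_one_minus_mult_exp_le: "norm ((1 - w) * exp w) \<le> exp ((norm (w::complex))\<^sup>2 / 2)"
proof -
  have "(norm (1 - w))\<^sup>2 = 1 + (- 2 * Re w + (norm w)\<^sup>2)"
    unfolding cmod_power2 by (simp add: power2_eq_square algebra_simps)
  also have "\<dots> \<le> exp (- 2 * Re w + (norm w)\<^sup>2)" by (rule exp_ge_add_one_self)
  also have "\<dots> = (exp (- Re w + (norm w)\<^sup>2 / 2))\<^sup>2"
    by (simp add: power2_eq_square exp_add[symmetric] algebra_simps)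
  finally have "norm (1 - w) \<le> exp (- Re w + (norm w)\<^sup>2 / 2)"
    by (rule power2_le_imp_le) simp
  then have "norm ((1 - w) * exp w) \<le> exp (- Re w + (norm w)\<^sup>2 / 2) * exp (Re w)"
    by (simp add: norm_mult mult_right_mono)
  also have "\<dots> = exp ((norm w)\<^sup>2 / 2)" by (simp add: exp_add[symmetric])
  finally show ?thesis .
qed

lemma entire_coeff_bound:
  fixes a :: "nat \<Rightarrow> complex"
  assumes f: "\<And>z. (\<lambda>k. a k * z ^ k) sums f z" and R: "R > 0"
    and bd: "\<And>z. norm z = R \<Longrightarrow> norm (f z) \<le> M"
  shows "norm (a k) \<le> M / R ^ k"
proof -
  define F where "F = Abs_fps a"
  have sm: "summable (\<lambda>n. fps_nth F n * z ^ n)" for z using f[of z] by (simp add: F_def sums_iff)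
  have rad: "fps_conv_radius F = \<infinity>"
    unfolding fps_conv_radius_def by (rule conv_radius_inftyI'') (rule sm)
  have fe: "f = eval_fps F" using f by (auto simp: fun_eq_iff eval_fps_def F_def sums_iff)
  have exp: "f has_fps_expansion F" unfolding has_fps_expansion_def fe by (simp add: rad)
  have hol: "f holomorphic_on UNIV"
    unfolding fe by (rule holomorphic_on_eval_fps) (simp add: rad)
  have "norm ((deriv ^^ k) f 0) \<le> fact k * M / R ^ k"
    by (rule Cauchy_inequality)
       (use hol R bd in \<open>auto intro: holomorphic_on_imp_continuous_on holomorphic_on_subset\<close>)
  moreover have "a k = (deriv ^^ k) f 0 / fact k"
    using fps_nth_fps_expansion[OF exp, of k] by (simp add: F_def)
  then have "norm (a k) = norm ((deriv ^^ k) f 0) / fact k" by (simp add: norm_divide)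
  ultimately show ?thesis by (simp add: pos_divide_le_eq mult.commute)
qed

text \<open>Uniform growth bounds give coefficient bounds uniform in the sequence index, so
  coefficientwise convergence upgrades to locally uniform convergence.\<close>
lemma uniform_limit_of_coeff_limit:
  fixes a :: "nat \<Rightarrow> nat \<Rightarrow> complex"
  assumes f: "\<And>N z. (\<lambda>k. a N k * z ^ k) sums f N z"
    and bd: "\<And>N z. norm (f N z) \<le> exp (B * norm z + C * (norm z)\<^sup>2)"
    and lim: "\<And>k. (\<lambda>N. a N k) \<longlonglongrightarrow> b k" and K: "compact K"
  shows "uniform_limit K f (\<lambda>z. \<Sum>k. b k * z ^ k) sequentially"
    and "summable (\<lambda>k. b k * z ^ k)"
proof -
  define M where "M R = exp (B * R + C * R\<^sup>2)" for R
  have Mp: "M R > 0" for R by (simp add: M_def)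
  have ab: "norm (a N k) \<le> M R / R ^ k" if "R > 0" for N k R
    by (rule entire_coeff_bound[OF f that]) (use bd[of N] in \<open>auto simp: M_def\<close>)
  have bb: "norm (b k) \<le> M R / R ^ k" if "R > 0" for k R
    using ab[OF that] by (intro tendsto_upperbound[OF tendsto_norm[OF lim[of k]]]) auto
  \<comment> \<open>Coefficients are estimated on the circle of radius 2 r but weighted with r^k;
    the ratio gives a geometric majorant that does not depend on \<open>N\<close>, as dominated
    convergence of the series requires.\<close>
  have diff: "norm (a N k - b k) * r ^ k \<le> 2 * M (2 * r) * (1/2) ^ k" if "r > 0" for N k r
  proof -
    have "norm (a N k - b k) * r ^ k \<le> (2 * (M (2 * r) / (2 * r) ^ k)) * r ^ k"
      using ab[of "2*r" N k] bb[of "2*r" k] that norm_triangle_ineq4[of "a N k" "b k"]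
      by (intro mult_right_mono) auto
    also have "\<dots> = 2 * M (2 * r) * (1/2) ^ k" using that by (simp add: power_mult_distrib power_one_over field_simps)
    finally show ?thesis .
  qed
  have sb: "summable (\<lambda>k. norm (b k) * r ^ k)" if "r > 0" for r
  proof (rule summable_comparison_test'[where N = 0])
    show "summable (\<lambda>k. M (2 * r) * (1/2) ^ k)" by (intro summable_mult summable_geometric) simp
    fix k
    have "norm (b k) * r ^ k \<le> (M (2 * r) / (2 * r) ^ k) * r ^ k"
      using bb[of "2*r" k] that by (intro mult_right_mono) auto
    also have "\<dots> = M (2 * r) * (1/2) ^ k" using that by (simp add: power_mult_distrib power_one_over field_simps)
    finally show "norm (norm (b k) * r ^ k) \<le> M (2 * r) * (1/2) ^ k" using that by simp
  qed
  have sb': "summable (\<lambda>k. b k * z ^ k)" for z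
  proof (rule summable_comparison_test'[where N = 0])
    show "summable (\<lambda>k. norm (b k) * (norm z + 1) ^ k)" by (rule sb) (simp add: add_nonneg_pos)
    show "norm (b k * z ^ k) \<le> norm (b k) * (norm z + 1) ^ k" for k
      by (auto simp: norm_mult norm_power intro!: mult_left_mono power_mono)
  qed
  then show "summable (\<lambda>k. b k * z ^ k)" .
  obtain r where r: "r > 0" "\<And>z. z \<in> K \<Longrightarrow> norm z \<le> r"
    using compact_imp_bounded[OF K] bounded_pos by metis
  define e where "e N = (\<Sum>k. norm (a N k - b k) * r ^ k)" for N
  have sg: "summable (\<lambda>k. 2 * M (2 * r) * (1/2) ^ k)" by (intro summable_mult summable_geometric) simp
  have "(\<lambda>N. \<Sum>k. norm (a N k - b k) * r ^ k) \<longlonglongrightarrow> (\<Sum>k. 0)"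
  proof (rule tannerys_theorem[THEN conjunct2, THEN conjunct2])
    show "(\<lambda>N. norm (a N k - b k) * r ^ k) \<longlonglongrightarrow> 0" for k
      using tendsto_mult_left_zero[OF tendsto_norm_zero[OF LIM_zero[OF lim[of k]]]] by simp
    show "summable (\<lambda>k. 2 * M (2 * r) * (1/2) ^ k)" by (rule sg)
    show "\<forall>\<^sub>F (k, N) in sequentially \<times>\<^sub>F sequentially.
       norm (norm (a N k - b k) * r ^ k) \<le> 2 * M (2 * r) * (1 / 2) ^ k"
      using diff[OF r(1)] r(1) by (intro always_eventually) auto
  qed simp
  then have e0: "e \<longlonglongrightarrow> 0" by (simp add: e_def[abs_def])
  have se: "summable (\<lambda>k. norm (a N k - b k) * r ^ k)" for N
    using diff[OF r(1)] r(1) by (intro summable_comparison_test'[OF sg, where N = 0]) auto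
  have est: "norm (f N z - (\<Sum>k. b k * z ^ k)) \<le> e N" if z: "z \<in> K" for N z
  proof -
    have s1: "(\<lambda>k. (a N k - b k) * z ^ k) sums (f N z - (\<Sum>k. b k * z ^ k))"
      using sums_diff[OF f[of N z] summable_sums[OF sb'[of z]]] by (simp add: algebra_simps)
    have "norm (\<Sum>k. (a N k - b k) * z ^ k) \<le> e N" unfolding e_def
      using r(2)[OF z]
      by (intro norm_suminf_le se) (auto simp: norm_mult norm_power intro!: mult_left_mono power_mono)
    then show ?thesis using s1 by (simp add: sums_iff)
  qed
  show "uniform_limit K f (\<lambda>z. \<Sum>k. b k * z ^ k) sequentially"
  proof (rule uniform_limitI)
    fix \<epsilon> :: real assume "\<epsilon> > 0"
    then have "\<forall>\<^sub>F N in sequentially. e N < \<epsilon>" using e0 by (rule order_tendstoD(2)[rotated])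
    then show "\<forall>\<^sub>F N in sequentially. \<forall>z\<in>K. dist (f N z) (\<Sum>k. b k * z ^ k) < \<epsilon>"
      by eventually_elim (auto simp: dist_norm intro: le_less_trans[OF est])
  qed
qed

section \<open>Newton's identities\<close>

text \<open>Coefficients of exp (- sum of p_j z^j / j), where the p_j with j >= 1 play the role of
  power sums: if p_j is a finite sum of a_i^j, they are the coefficients of the product of the
  factors 1 - a_i z.\<close>

fun newton :: "(nat \<Rightarrow> 'a::field_char_0) \<Rightarrow> nat \<Rightarrow> 'a" where
  "newton p 0 = 1"
| "newton p (Suc k) = - (\<Sum>j\<le>k. p (Suc j) * newton p (k - j)) / of_nat (Suc k)"

declare newton.simps(2) [simp del]

text \<open>The recursion is the coefficientwise form of the logarithmic derivative; the shift
  \<open>Suc j\<close> appears because differentiation lowers the degree by one.\<close>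

lemma fps_deriv_newton:
  "fps_deriv (Abs_fps (newton p)) = - (Abs_fps (\<lambda>j. p (Suc j)) * Abs_fps (newton p))"
proof (rule fps_ext)
  fix n
  have "of_nat (Suc n) * newton p (Suc n) = - (\<Sum>j\<le>n. p (Suc j) * newton p (n - j))"
    unfolding newton.simps(2) by (simp add: field_simps del: of_nat_Suc)
  then show "fps_deriv (Abs_fps (newton p)) $ n = (- (Abs_fps (\<lambda>j. p (Suc j)) * Abs_fps (newton p))) $ n"
    by (simp add: fps_mult_nth atLeast0AtMost)
qed

text \<open>A linear first order differential equation with prescribed constant term has only one
  formal solution. Additivity, linear factors and the quadratic exponential are all identified by
  checking this equation, with no manipulation of the recursion.\<close>

lemma newton_unique:
  assumes "fps_nth F 0 = 1" "fps_deriv F = - (Abs_fps (\<lambda>j. p (Suc j)) * F)"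
  shows "F = Abs_fps (newton p)"
proof (rule fps_ext)
  fix n show "fps_nth F n = fps_nth (Abs_fps (newton p)) n"
  proof (induction n rule: less_induct)
    case (less n)
    show ?case
    proof (cases n)
      case 0 then show ?thesis using assms by simp
    next
      case (Suc k)
      have "of_nat (Suc k) * fps_nth F (Suc k) = - (\<Sum>j\<le>k. p (Suc j) * fps_nth F (k - j))"
        using arg_cong[OF assms(2), of "\<lambda>G. fps_nth G k"] by (simp add: fps_mult_nth atLeast0AtMost)
      also have "\<dots> = - (\<Sum>j\<le>k. p (Suc j) * newton p (k - j))"
        using less.IH Suc by (intro arg_cong[where f=uminus] sum.cong) auto
      finally show ?thesis unfolding Suc by (simp add: newton.simps(2) field_simps del: of_nat_Suc)
    qed
  qed
qed

lemma newton_add: "Abs_fps (newton (\<lambda>j. p j + q j)) = Abs_fps (newton p) * Abs_fps (newton q)"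
proof (rule newton_unique[symmetric])
  have "Abs_fps (\<lambda>j. p (Suc j) + q (Suc j)) = Abs_fps (\<lambda>j. p (Suc j)) + Abs_fps (\<lambda>j. q (Suc j))"
    by (rule fps_ext) simp
  then show "fps_deriv (Abs_fps (newton p) * Abs_fps (newton q)) =
    - (Abs_fps (\<lambda>j. p (Suc j) + q (Suc j)) * (Abs_fps (newton p) * Abs_fps (newton q)))"
    by (simp add: fps_deriv_newton algebra_simps)
qed simp

lemma newton_zero: "Abs_fps (newton (\<lambda>j. 0)) = 1"
  by (rule newton_unique[symmetric]) (auto simp: fps_eq_iff fps_mult_nth)

lemma newton_sum:
  "finite A \<Longrightarrow> Abs_fps (newton (\<lambda>j. \<Sum>i\<in>A. p i j)) = (\<Prod>i\<in>A. Abs_fps (newton (p i)))"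
  by (induction A rule: finite_induct) (simp_all add: newton_zero newton_add)

lemma newton_power: "Abs_fps (newton (\<lambda>j. a ^ j)) = 1 - fps_const a * fps_X"
proof (rule newton_unique[symmetric])
  show "fps_deriv (1 - fps_const a * fps_X) = - (Abs_fps (\<lambda>j. a ^ Suc j) * (1 - fps_const a * fps_X))"
  proof (rule fps_ext)
    fix n show "fps_nth (fps_deriv (1 - fps_const a * fps_X)) n =
        fps_nth (- (Abs_fps (\<lambda>j. a ^ Suc j) * (1 - fps_const a * fps_X))) n"
      by (cases n) (auto simp: right_diff_distrib mult.assoc[symmetric] mult.commute[of _ "fps_const a"])
  qed
qed simp

lemma newton_cong: "(\<And>j. j \<ge> 1 \<Longrightarrow> p j = q j) \<Longrightarrow> newton p k = newton q k"
proof (induction k rule: less_induct)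
  case (less k)
  show ?case
  proof (cases k)
    case (Suc m)
    show ?thesis unfolding Suc newton.simps(2)
      using less Suc by (intro arg_cong2[where f="(/)"] arg_cong[where f=uminus] sum.cong) auto
  qed simp
qed

lemma of_real_newton:
  "of_real (newton p k) = (newton (\<lambda>j. of_real (p j)) k :: 'a :: {real_normed_field, field_char_0})"
proof (induction k rule: less_induct)
  case (less k)
  then show ?case by (cases k) (simp_all add: newton.simps(2))
qed

lemma tendsto_newton:
  fixes p :: "nat \<Rightarrow> nat \<Rightarrow> real"
  assumes "\<And>j. j \<ge> 1 \<Longrightarrow> (\<lambda>n. p n j) \<longlonglongrightarrow> q j"
  shows "(\<lambda>n. newton (p n) k) \<longlonglongrightarrow> newton q k"
proof (induction k rule: less_induct)
  case (less k)
  show ?case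
  proof (cases k)
    case (Suc m)
    show ?thesis unfolding Suc newton.simps(2)
      using less Suc assms by (intro tendsto_intros) auto
  qed simp
qed

section \<open>Taylor coefficients of Laguerre--Polya functions\<close>

text \<open>Minus the Taylor coefficients of the logarithmic derivative of E_w, with the index
  shifted by one. The factors exp (z a) remove all first powers, so the first power sum is
  \<open>g1\<close> although the sum of the a's may diverge; the term g2 z^2 / 2 joins the squares,
  so that the second power sum is \<delta>.\<close>

definition psum :: "omega \<Rightarrow> nat \<Rightarrow> real" where
  "psum w j = (case w of (ap, am, g1, g2) \<Rightarrow>
     if j = 1 then g1 else if j = 2 then omega_delta w
     else (\<Sum>i. ap i ^ j) + (\<Sum>i. (- am i) ^ j))"

text \<open>For \<open>j = 1\<close> the compensating sums cancel against the power sums and leave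
  \<open>g1\<close>. They are kept separate so that the whole is a sum of power sums of single
  factors, to which additivity of \<open>newton\<close> applies.\<close>

definition psum_trunc :: "omega \<Rightarrow> nat \<Rightarrow> nat \<Rightarrow> real" where
  "psum_trunc w n j = (case w of (ap, am, g1, g2) \<Rightarrow>
     (if j = 1 then g1 - (\<Sum>i<n. ap i) + (\<Sum>i<n. am i) else 0) + (if j = 2 then g2 else 0)
     + (\<Sum>i<n. ap i ^ j) + (\<Sum>i<n. (- am i) ^ j))"

definition lpc :: "omega \<Rightarrow> nat \<Rightarrow> real" where
  "lpc w k = newton (psum w) k"

definition E_trunc :: "omega \<Rightarrow> nat \<Rightarrow> complex \<Rightarrow> complex" where
  "E_trunc w n z = (case w of (ap, am, g1, g2) \<Rightarrow>
     exp (- of_real g1 * z - of_real g2 / 2 * z\<^sup>2)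
     * (\<Prod>i<n. exp (z * of_real (ap i)) * (1 - z * of_real (ap i)))
     * (\<Prod>i<n. exp (- z * of_real (am i)) * (1 + z * of_real (am i))))"

lemma summable_power_ge_2:
  fixes a :: "nat \<Rightarrow> real"
  assumes "summable (\<lambda>i. (a i)\<^sup>2)" "j \<ge> 2"
  shows "summable (\<lambda>i. a i ^ j)"
proof (rule summable_comparison_test_ev[OF _ assms(1)])
  have "(\<lambda>i. sqrt ((a i)\<^sup>2)) \<longlonglongrightarrow> sqrt 0"
    using summable_LIMSEQ_zero[OF assms(1)] by (intro tendsto_real_sqrt)
  then have "\<forall>\<^sub>F i in sequentially. \<bar>a i\<bar> < 1" by (auto dest: order_tendstoD(2)[of _ _ _ 1])
  then show "\<forall>\<^sub>F i in sequentially. norm (a i ^ j) \<le> (a i)\<^sup>2"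
  proof eventually_elim
    case (elim i)
    have "\<bar>a i\<bar> ^ j \<le> \<bar>a i\<bar> ^ 2" using elim assms(2) by (intro power_decreasing) auto
    then show ?case by (simp add: power_abs)
  qed
qed

lemma psum_trunc_tendsto:
  assumes w: "w \<in> Omega" and j: "j \<ge> 1"
  shows "(\<lambda>n. psum_trunc w n j) \<longlonglongrightarrow> psum w j"
proof -
  obtain ap am g1 g2 where w4: "w = (ap, am, g1, g2)" by (cases w) auto
  have s: "summable (\<lambda>i. (ap i)\<^sup>2)" "summable (\<lambda>i. (- am i)\<^sup>2)" using w unfolding w4 Omega_def by auto
  consider "j = 1" | "j = 2" | "j > 2" using j by linarith
  then show ?thesis
  proof cases
    case 1 then show ?thesis by (simp add: psum_trunc_def psum_def w4 sum_negf)
  next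
    case 2
    have "(\<lambda>n. g2 + (\<Sum>i<n. (ap i)\<^sup>2) + (\<Sum>i<n. (am i)\<^sup>2)) \<longlonglongrightarrow> g2 + (\<Sum>i. (ap i)\<^sup>2) + (\<Sum>i. (am i)\<^sup>2)"
      using s by (intro tendsto_intros summable_LIMSEQ) auto
    then show ?thesis using 2 by (simp add: psum_trunc_def psum_def w4 omega_delta_def)
  next
    case 3
    then have "summable (\<lambda>i. ap i ^ j)" "summable (\<lambda>i. (- am i) ^ j)"
      using summable_power_ge_2[OF s(1), of j] summable_power_ge_2[OF s(2), of j] by auto
    then have "(\<lambda>n. (\<Sum>i<n. ap i ^ j) + (\<Sum>i<n. (- am i) ^ j)) \<longlonglongrightarrow> (\<Sum>i. ap i ^ j) + (\<Sum>i. (- am i) ^ j)"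
      by (intro tendsto_intros summable_LIMSEQ)
    then show ?thesis using 3 by (simp add: psum_trunc_def psum_def w4)
  qed
qed

section \<open>Power series of the finite products\<close>

lemma fps_newton_exp_quadratic:
  "(\<lambda>z::complex. exp (- c * z - g / 2 * z\<^sup>2)) has_fps_expansion
     Abs_fps (newton (\<lambda>j. (if j = 1 then c else 0) + (if j = 2 then g else 0)))"
proof -
  let ?f = "\<lambda>z::complex. exp (- c * z - g / 2 * z\<^sup>2)"
  let ?p = "\<lambda>j::nat. (if j = 1 then c else 0) + (if j = 2 then g else 0)"
  have "?f holomorphic_on UNIV" by (intro holomorphic_intros)
  then have F: "?f has_fps_expansion fps_expansion ?f 0"
    by (intro has_fps_expansion_fps_expansion) auto
  have d: "deriv ?f z = (- c - g * z) * ?f z" for z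
    by (rule DERIV_imp_deriv) (auto intro!: derivative_eq_intros)
  have "deriv ?f has_fps_expansion fps_deriv (fps_expansion ?f 0)"
    by (rule has_fps_expansion_deriv[OF F])
  moreover have "deriv ?f has_fps_expansion (- fps_const c - fps_const g * fps_X) * fps_expansion ?f 0"
    unfolding d[abs_def] by (intro fps_expansion_intros F)
  ultimately have e: "fps_deriv (fps_expansion ?f 0) = (- fps_const c - fps_const g * fps_X) * fps_expansion ?f 0"
    by (rule fps_expansion_unique_complex)
  have P: "Abs_fps (\<lambda>j. ?p (Suc j)) = fps_const c + fps_const g * fps_X"
    by (rule fps_ext) (auto simp: fps_X_nth)
  have "fps_expansion ?f 0 = Abs_fps (newton ?p)"
  proof (rule newton_unique)
    show "fps_nth (fps_expansion ?f 0) 0 = 1" by (simp add: fps_expansion_def)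
    show "fps_deriv (fps_expansion ?f 0) = - (Abs_fps (\<lambda>j. ?p (Suc j)) * fps_expansion ?f 0)"
      unfolding P e by (simp only: minus_add_distrib mult_minus_left distrib_right left_diff_distrib
          diff_conv_add_uminus)
  qed
  then show ?thesis using F by simp
qed

lemma E_trunc_sums: "(\<lambda>k. of_real (newton (psum_trunc w n) k) * z ^ k) sums E_trunc w n z"
proof -
  obtain ap am g1 g2 where w4: "w = (ap, am, g1, g2)" by (cases w) auto
  define c where "c = g1 - (\<Sum>i<n. ap i) + (\<Sum>i<n. am i)"
  let ?q = "\<lambda>j::nat. (if j = 1 then complex_of_real c else 0) + (if j = 2 then complex_of_real g2 else 0)"
  define f where "f z = exp (- of_real c * z - of_real g2 / 2 * z\<^sup>2) *
    (\<Prod>i<n. (1 - of_real (ap i) * z)) * (\<Prod>i<n. (1 - of_real (- am i) * z))" for z :: complex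
  have fe: "f = E_trunc w n"
  proof
    fix z :: complex
    have "exp (- of_real g1 * z - of_real g2 / 2 * z\<^sup>2) * (\<Prod>i<n. exp (z * of_real (ap i))) * (\<Prod>i<n. exp (- z * of_real (am i))) =
      exp (- of_real c * z - of_real g2 / 2 * z\<^sup>2)"
      unfolding exp_sum[symmetric, OF finite_lessThan] exp_add[symmetric]
      by (rule arg_cong[where f=exp]) (simp add: c_def algebra_simps sum_distrib_left sum_negf)
    then show "f z = E_trunc w n z"
      unfolding f_def E_trunc_def w4 by (simp add: prod.distrib mult_ac)
  qed
  have "f has_fps_expansion Abs_fps (newton ?q) * (\<Prod>i<n. 1 - fps_const (of_real (ap i)) * fps_X)
     * (\<Prod>i<n. 1 - fps_const (of_real (- am i)) * fps_X)"
    unfolding f_def[abs_def] by (intro fps_expansion_intros fps_newton_exp_quadratic)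
  also have "\<dots> = Abs_fps (newton (\<lambda>j. ?q j + (\<Sum>i<n. of_real (ap i) ^ j) + (\<Sum>i<n. of_real (- am i) ^ j)))"
    unfolding newton_add newton_sum[OF finite_lessThan] newton_power ..
  also have "newton (\<lambda>j. ?q j + (\<Sum>i<n. of_real (ap i) ^ j) + (\<Sum>i<n. of_real (- am i) ^ j)) =
     (\<lambda>k. of_real (newton (psum_trunc w n) k))"
    unfolding of_real_newton fun_eq_iff
    by (intro allI newton_cong) (simp add: psum_trunc_def w4 c_def)
  finally have e: "f has_fps_expansion Abs_fps (\<lambda>k. of_real (newton (psum_trunc w n) k))" .
  have "f holomorphic_on eball 0 \<infinity>" unfolding f_def[abs_def] by (intro holomorphic_intros)
  from has_fps_expansion_imp_sums_complex[OF e this, of z] show ?thesis unfolding fe by simp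
qed

text \<open>Each genus one factor costs half of a square, and only the full sum of squares enters,
  so the growth bound is uniform in \<open>n\<close>.\<close>

lemma E_trunc_bound:
  assumes w: "w \<in> Omega"
  shows "norm (E_trunc w n z) \<le> exp (\<bar>fst (snd (snd w))\<bar> * norm z + omega_delta w / 2 * (norm z)\<^sup>2)"
proof -
  obtain ap am g1 g2 where w4: "w = (ap, am, g1, g2)" by (cases w) auto
  have s: "summable (\<lambda>i. (ap i)\<^sup>2)" "summable (\<lambda>i. (am i)\<^sup>2)" and g2: "g2 \<ge> 0" using w unfolding w4 Omega_def by auto
  have P: "norm (\<Prod>i<n. exp (z * of_real (a i)) * (1 - z * of_real (a i))) \<le> exp ((norm z)\<^sup>2 / 2 * (\<Sum>i. (a i)\<^sup>2))"
    if "summable (\<lambda>i. (a i)\<^sup>2)" for a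
  proof -
    have "norm (\<Prod>i<n. exp (z * of_real (a i)) * (1 - z * of_real (a i))) \<le> (\<Prod>i<n. exp ((norm (z * of_real (a i)))\<^sup>2 / 2))"
      unfolding prod_norm[symmetric]
      by (intro prod_mono conjI norm_ge_zero) (subst mult.commute, rule norm_one_minus_mult_exp_le)
    also have "\<dots> = exp ((norm z)\<^sup>2 / 2 * (\<Sum>i<n. (a i)\<^sup>2))"
      by (simp add: exp_sum[symmetric] sum_distrib_left norm_mult power_mult_distrib)
    also have "\<dots> \<le> exp ((norm z)\<^sup>2 / 2 * (\<Sum>i. (a i)\<^sup>2))"
      by (intro iffD2[OF exp_le_cancel_iff] mult_left_mono sum_le_suminf that) auto
    finally show ?thesis .
  qed
  have "norm (exp (- of_real g1 * z - of_real g2 / 2 * z\<^sup>2)) \<le> exp (norm (- of_real g1 * z - of_real g2 / 2 * z\<^sup>2))"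
    by (rule norm_exp)
  also have "\<dots> \<le> exp (\<bar>g1\<bar> * norm z + g2 / 2 * (norm z)\<^sup>2)"
    using norm_triangle_ineq4[of "- of_real g1 * z" "of_real g2 / 2 * z\<^sup>2"] g2
    by (simp add: norm_mult norm_power norm_divide)
  finally have E0: "norm (exp (- of_real g1 * z - of_real g2 / 2 * z\<^sup>2)) \<le> exp (\<bar>g1\<bar> * norm z + g2 / 2 * (norm z)\<^sup>2)" .
  have "norm (E_trunc w n z) \<le> exp (\<bar>g1\<bar> * norm z + g2 / 2 * (norm z)\<^sup>2) *
     exp ((norm z)\<^sup>2 / 2 * (\<Sum>i. (ap i)\<^sup>2)) * exp ((norm z)\<^sup>2 / 2 * (\<Sum>i. (am i)\<^sup>2))"
    unfolding E_trunc_def w4 prod.case norm_mult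
    using E0 P[OF s(1)] P[of "\<lambda>i. - am i"] s(2) by (intro mult_mono) (auto simp: norm_mult)
  also have "\<dots> = exp (\<bar>g1\<bar> * norm z + omega_delta w / 2 * (norm z)\<^sup>2)"
    unfolding exp_add[symmetric] by (simp add: omega_delta_def w4 field_simps)
  finally show ?thesis by (simp add: w4)
qed

lemma convergent_prod_genus_1:
  fixes a :: "nat \<Rightarrow> complex"
  assumes "summable (\<lambda>i. (norm (a i))\<^sup>2)"
  shows "convergent_prod (\<lambda>i. exp (a i) * (1 - a i))"
proof -
  have bd: "norm (exp w * (1 - w) - 1) \<le> 2 * exp (norm w) * (norm w)\<^sup>2" for w :: complex
  proof -
    \<comment> \<open>Both summands are of second order at 0: the linear terms of the genus one
      factor cancel.\<close>
    have e: "exp w * (1 - w) - 1 = (exp w - 1 - w) - w * (exp w - 1)" by (simp add: algebra_simps)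
    have "norm (exp w - 1 - w) \<le> exp (norm w) * (norm w)\<^sup>2"
      using Taylor_exp_field[of w 1] by (simp add: algebra_simps power2_eq_square)
    moreover have "norm (exp w - 1) \<le> exp (norm w) * norm w"
      using Taylor_exp_field[of w 0] by simp
    then have "norm (w * (exp w - 1)) \<le> exp (norm w) * (norm w)\<^sup>2"
      using mult_left_mono[of "norm (exp w - 1)" "exp (norm w) * norm w" "norm w"]
      by (simp add: norm_mult power2_eq_square mult_ac)
    ultimately show ?thesis unfolding e using norm_triangle_ineq4[of "exp w - 1 - w" "w * (exp w - 1)"] by linarith
  qed
  have "(\<lambda>i. sqrt ((norm (a i))\<^sup>2)) \<longlonglongrightarrow> sqrt 0"
    using summable_LIMSEQ_zero[OF assms] by (intro tendsto_real_sqrt)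
  then have ev: "\<forall>\<^sub>F i in sequentially. norm (a i) < 1" by (auto dest: order_tendstoD(2)[of _ _ _ 1])
  have "abs_convergent_prod (\<lambda>i. exp (a i) * (1 - a i))"
    unfolding abs_convergent_prod_conv_summable
  proof (rule summable_comparison_test_ev)
    show "summable (\<lambda>i. 2 * exp 1 * (norm (a i))\<^sup>2)" by (intro summable_mult assms)
    show "\<forall>\<^sub>F i in sequentially. norm (norm (exp (a i) * (1 - a i) - 1)) \<le> 2 * exp 1 * (norm (a i))\<^sup>2"
      using ev
    proof eventually_elim
      case (elim i)
      have "2 * exp (norm (a i)) * (norm (a i))\<^sup>2 \<le> 2 * exp 1 * (norm (a i))\<^sup>2"
        using elim by (intro mult_right_mono) auto
      then show ?case using bd[of "a i"] by simp
    qed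
  qed
  then show ?thesis by (rule abs_convergent_prod_imp_convergent_prod)
qed

lemma E_trunc_tendsto:
  assumes w: "w \<in> Omega"
  shows "(\<lambda>n. E_trunc w n z) \<longlonglongrightarrow> E_LP w z"
proof -
  obtain ap am g1 g2 where w4: "w = (ap, am, g1, g2)" by (cases w) auto
  have s: "summable (\<lambda>i. (ap i)\<^sup>2)" "summable (\<lambda>i. (am i)\<^sup>2)" using w unfolding w4 Omega_def by auto
  have L: "(\<lambda>n. \<Prod>i<n. exp (a i) * (1 - a i)) \<longlonglongrightarrow> (\<Prod>i. exp (a i) * (1 - a i))"
    if "summable (\<lambda>i. (norm (a i))\<^sup>2)" for a :: "nat \<Rightarrow> complex"
    using convergent_prod_LIMSEQ[OF convergent_prod_genus_1[OF that]]
    by (subst filterlim_sequentially_Suc[symmetric]) (simp add: lessThan_Suc_atMost)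
  have "(\<lambda>n. \<Prod>i<n. exp (z * of_real (ap i)) * (1 - z * of_real (ap i))) \<longlonglongrightarrow>
      (\<Prod>i. exp (z * of_real (ap i)) * (1 - z * of_real (ap i)))"
    by (rule L) (use s in \<open>simp add: norm_mult power_mult_distrib summable_mult\<close>)
  moreover have "(\<lambda>n. \<Prod>i<n. exp (- z * of_real (am i)) * (1 - (- z * of_real (am i)))) \<longlonglongrightarrow>
      (\<Prod>i. exp (- z * of_real (am i)) * (1 - (- z * of_real (am i))))"
    by (rule L) (use s in \<open>simp add: norm_mult power_mult_distrib summable_mult\<close>)
  ultimately show ?thesis unfolding E_trunc_def E_LP_def w4 prod.case
    by (intro tendsto_mult tendsto_const) (simp_all)
qed

lemma newton_psum_trunc_tendsto:
  "w \<in> Omega \<Longrightarrow> (\<lambda>n. newton (psum_trunc w n) k) \<longlonglongrightarrow> lpc w k"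
  unfolding lpc_def by (intro tendsto_newton psum_trunc_tendsto)

text \<open>The truncations converge to \<open>E_LP\<close> as products, and to the power series by
  convergence of their coefficients under a uniform growth bound; the two limits agree.\<close>

lemma E_LP_eq_suminf:
  assumes w: "w \<in> Omega"
  shows "E_LP w z = (\<Sum>k. of_real (lpc w k) * z ^ k)"
proof -
  have "uniform_limit {z} (E_trunc w) (\<lambda>z. \<Sum>k. of_real (lpc w k) * z ^ k) sequentially"
  proof (rule uniform_limit_of_coeff_limit(1))
    show "(\<lambda>k. of_real (newton (psum_trunc w n) k) * z ^ k) sums E_trunc w n z" for n z by (rule E_trunc_sums)
    show "norm (E_trunc w n z) \<le> exp (\<bar>fst (snd (snd w))\<bar> * norm z + omega_delta w / 2 * (norm z)\<^sup>2)" for n z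
      by (rule E_trunc_bound[OF w])
    show "(\<lambda>n. complex_of_real (newton (psum_trunc w n) k)) \<longlonglongrightarrow> of_real (lpc w k)" for k
      by (intro tendsto_of_real newton_psum_trunc_tendsto w)
  qed simp
  then have "(\<lambda>n. E_trunc w n z) \<longlonglongrightarrow> (\<Sum>k. of_real (lpc w k) * z ^ k)"
    by (rule tendsto_uniform_limitI) simp
  then show ?thesis using E_trunc_tendsto[OF w] LIMSEQ_unique by blast
qed

section \<open>Real-rooted polynomials\<close>

lemma coeff_prod_list_real_roots:
  fixes ls :: "real list"
  defines "p \<equiv> \<Prod>l\<leftarrow>ls. [:1, - complex_of_real l:]"
  shows "coeff p 0 = 1" "coeff p 1 = - of_real (\<Sum>l\<leftarrow>ls. l)"
    "coeff p 2 = of_real (((\<Sum>l\<leftarrow>ls. l)\<^sup>2 - (\<Sum>l\<leftarrow>ls. l\<^sup>2)) / 2)"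
proof -
  have "coeff p 0 = 1 \<and> coeff p 1 = - of_real (\<Sum>l\<leftarrow>ls. l) \<and>
    coeff p 2 = of_real (((\<Sum>l\<leftarrow>ls. l)\<^sup>2 - (\<Sum>l\<leftarrow>ls. l\<^sup>2)) / 2)"
    unfolding p_def
  proof (induction ls)
    case (Cons l ls)
    let ?q = "\<Prod>l\<leftarrow>ls. [:1, - complex_of_real l:]"
    have "coeff ([:1, - of_real l:] * ?q) (Suc n) = coeff ?q (Suc n) - of_real l * coeff ?q n" for n by simp
    from this[of 0] this[of 1] show ?case using Cons
      by (simp add: numeral_2_eq_2[symmetric] power2_eq_square field_simps)
  qed simp_all
  then show "coeff p 0 = 1" "coeff p 1 = - of_real (\<Sum>l\<leftarrow>ls. l)"
    "coeff p 2 = of_real (((\<Sum>l\<leftarrow>ls. l)\<^sup>2 - (\<Sum>l\<leftarrow>ls. l\<^sup>2)) / 2)" by auto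
qed

text \<open>After multiplication by exp (z sum l) the product splits into genus one factors, each
  bounded by exp (|z l|^2 / 2); removing the exponential again costs at most |z| |sum l| in the
  exponent.\<close>

lemma norm_prod_list_real_roots_le:
  fixes ls :: "real list"
  shows "norm (\<Prod>l\<leftarrow>ls. 1 - z * complex_of_real l) \<le>
    exp (\<bar>\<Sum>l\<leftarrow>ls. l\<bar> * norm z + (\<Sum>l\<leftarrow>ls. l\<^sup>2) / 2 * (norm z)\<^sup>2)"
proof -
  have "norm ((\<Prod>l\<leftarrow>ls. 1 - z * complex_of_real l) * exp (z * of_real (\<Sum>l\<leftarrow>ls. l)))
     \<le> exp ((\<Sum>l\<leftarrow>ls. l\<^sup>2) / 2 * (norm z)\<^sup>2)"
  proof (induction ls)
    case (Cons l ls)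
    let ?P = "\<Prod>l\<leftarrow>ls. 1 - z * complex_of_real l"
    have "(\<Prod>l\<leftarrow>l # ls. 1 - z * complex_of_real l) * exp (z * of_real (\<Sum>l\<leftarrow>l # ls. l)) =
      ((1 - z * of_real l) * exp (z * of_real l)) * (?P * exp (z * of_real (\<Sum>l\<leftarrow>ls. l)))"
      by (simp add: exp_add algebra_simps)
    also have "norm \<dots> \<le> exp ((norm (z * of_real l))\<^sup>2 / 2) * exp ((\<Sum>l\<leftarrow>ls. l\<^sup>2) / 2 * (norm z)\<^sup>2)"
      unfolding norm_mult[of "_ * _" "_ * _"] by (intro mult_mono norm_one_minus_mult_exp_le Cons) auto
    also have "\<dots> = exp ((\<Sum>l\<leftarrow>l # ls. l\<^sup>2) / 2 * (norm z)\<^sup>2)"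
      by (simp add: exp_add[symmetric] norm_mult power_mult_distrib field_simps)
    finally show ?case .
  qed simp
  then have "norm (\<Prod>l\<leftarrow>ls. 1 - z * complex_of_real l) * norm (exp (z * of_real (\<Sum>l\<leftarrow>ls. l))) \<le>
      exp ((\<Sum>l\<leftarrow>ls. l\<^sup>2) / 2 * (norm z)\<^sup>2)" by (simp add: norm_mult)
  then have "norm (\<Prod>l\<leftarrow>ls. 1 - z * complex_of_real l) \<le>
      exp ((\<Sum>l\<leftarrow>ls. l\<^sup>2) / 2 * (norm z)\<^sup>2) * exp (- (Re z * (\<Sum>l\<leftarrow>ls. l)))"
    by (simp add: exp_minus field_simps)
  also have "\<dots> \<le> exp ((\<Sum>l\<leftarrow>ls. l\<^sup>2) / 2 * (norm z)\<^sup>2) * exp (\<bar>\<Sum>l\<leftarrow>ls. l\<bar> * norm z)"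
  proof -
    have "- (Re z * (\<Sum>l\<leftarrow>ls. l)) \<le> \<bar>Re z\<bar> * \<bar>\<Sum>l\<leftarrow>ls. l\<bar>" by (metis abs_ge_minus_self abs_mult)
    also have "\<dots> \<le> norm z * \<bar>\<Sum>l\<leftarrow>ls. l\<bar>" by (intro mult_right_mono abs_Re_le_cmod) auto
    finally show ?thesis by (simp add: mult.commute)
  qed
  finally show ?thesis by (simp add: exp_add mult.commute)
qed

text \<open>The numbers l satisfy sum l^2 = a_1^2 - 2 a_2; as they are real, this is also the sum of
  their squared moduli. Convergent coefficient sequences are bounded, so one growth bound serves all
  \<open>N\<close>.\<close>

lemma uniform_limit_E_LP_of_real_rooted:
  fixes a :: "nat \<Rightarrow> nat \<Rightarrow> complex"
  assumes fac: "\<And>N. \<exists>ls::real list. \<forall>z. f N z = (\<Prod>l\<leftarrow>ls. 1 - z * of_real l)"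
    and pol: "\<And>N z. f N z = (\<Sum>k\<le>N. a N k * z ^ k)"
    and zero: "\<And>N k. k > N \<Longrightarrow> a N k = 0"
    and w: "w \<in> Omega" and lim: "\<And>k. (\<lambda>N. a N k) \<longlonglongrightarrow> of_real (lpc w k)"
    and K: "compact K"
  shows "uniform_limit K f (E_LP w) sequentially"
proof -
  have bd1: "\<exists>B. \<forall>N. norm (a N k) \<le> B" for k
    using convergent_imp_bounded[OF lim[of k]] by (auto simp: bounded_iff)
  obtain B1 where B1: "\<And>N. norm (a N 1) \<le> B1" using bd1 by metis
  obtain B2 where B2: "\<And>N. norm (a N 2) \<le> B2" using bd1 by metis
  have main: "norm (f N z) \<le> exp (B1 * norm z + (B1\<^sup>2 + 2 * B2) / 2 * (norm z)\<^sup>2)" for N z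
  proof -
    obtain ls :: "real list" where ls: "\<And>z. f N z = (\<Prod>l\<leftarrow>ls. 1 - z * of_real l)" using fac by metis
    let ?p = "\<Prod>l\<leftarrow>ls. [:1, - complex_of_real l:]"
    have "poly ?p z = f N z" for z unfolding ls by (induction ls) (auto simp: algebra_simps)
    moreover have "poly (\<Sum>k\<le>N. monom (a N k) k) z = f N z" for z
      unfolding pol by (simp add: poly_sum poly_monom)
    ultimately have "?p = (\<Sum>k\<le>N. monom (a N k) k)" by (simp add: poly_eq_poly_eq_iff[symmetric] fun_eq_iff)
    then have c: "coeff ?p k = a N k" for k using zero[of N k] by (simp add: coeff_sum)
    define s where "s = (\<Sum>l\<leftarrow>ls. l)"
    define t where "t = (\<Sum>l\<leftarrow>ls. l\<^sup>2)"
    have c1: "a N 1 = - of_real s" and c2: "a N 2 = of_real ((s\<^sup>2 - t) / 2)"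
      using coeff_prod_list_real_roots[of ls] unfolding c s_def t_def by auto
    have s1: "\<bar>s\<bar> \<le> B1" using B1[of N] unfolding c1 by simp
    have "\<bar>(s\<^sup>2 - t) / 2\<bar> \<le> B2" using B2[of N] unfolding c2 norm_of_real .
    then have "- ((s\<^sup>2 - t) / 2) \<le> B2" by (simp only: abs_le_iff)
    then have "t \<le> s\<^sup>2 + 2 * B2" by (simp add: field_simps)
    moreover have "s\<^sup>2 \<le> B1\<^sup>2" using s1 by (simp add: abs_le_square_iff[symmetric])
    ultimately have t1: "t \<le> B1\<^sup>2 + 2 * B2" by linarith
    have "norm (f N z) \<le> exp (\<bar>s\<bar> * norm z + t / 2 * (norm z)\<^sup>2)"
      unfolding ls s_def t_def by (rule norm_prod_list_real_roots_le)
    also have "\<dots> \<le> exp (B1 * norm z + (B1\<^sup>2 + 2 * B2) / 2 * (norm z)\<^sup>2)"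
      using s1 t1 by (intro iffD2[OF exp_le_cancel_iff] add_mono mult_right_mono) auto
    finally show ?thesis .
  qed
  have "uniform_limit K f (\<lambda>z. \<Sum>k. of_real (lpc w k) * z ^ k) sequentially"
  proof (rule uniform_limit_of_coeff_limit(1)[OF _ main lim K])
    show "(\<lambda>k. a N k * z ^ k) sums f N z" for N z unfolding pol
      by (rule sums_finite) (auto simp: zero)
  qed
  moreover have "E_LP w = (\<lambda>z. \<Sum>k. of_real (lpc w k) * z ^ k)"
    using E_LP_eq_suminf[OF w] by (simp add: fun_eq_iff)
  ultimately show ?thesis by simp
qed

section \<open>Almost sure convergence\<close>

context prob_space
begin

text \<open>The sum of the \<open>f n\<close> has finite expectation by monotone convergence, so it
  is finite almost surely and its terms tend to 0. This takes the place of Chebyshev's inequality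
  with the Borel-Cantelli lemma.\<close>

lemma AE_tendsto_zero_of_summable_expectation:
  fixes f :: "nat \<Rightarrow> 'a \<Rightarrow> real"
  assumes int: "\<And>n. integrable M (f n)" and nn: "\<And>n x. f n x \<ge> 0"
    and le: "\<And>n. expectation (f n) \<le> b n" and sb: "summable b"
  shows "AE x in M. (\<lambda>n. f n x) \<longlonglongrightarrow> 0"
proof -
  have [measurable]: "f n \<in> borel_measurable M" for n using int by auto
  have b0: "b n \<ge> 0" for n
    by (rule order_trans[OF Bochner_Integration.integral_nonneg le[of n]]) (rule nn)
  have "(\<integral>\<^sup>+x. (\<Sum>n. ennreal (f n x)) \<partial>M) = (\<Sum>n. \<integral>\<^sup>+x. ennreal (f n x) \<partial>M)"
    by (rule nn_integral_suminf) measurable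
  also have "\<dots> = (\<Sum>n. ennreal (expectation (f n)))"
    using int nn by (intro suminf_cong nn_integral_eq_integral) auto
  also have "\<dots> \<le> (\<Sum>n. ennreal (b n))"
    by (intro suminf_le ennreal_leI le summableI)
  also have "\<dots> < \<infinity>" using suminf_ennreal_eq[OF b0 summable_sums[OF sb]] by simp
  finally have "AE x in M. (\<Sum>n. ennreal (f n x)) \<noteq> \<infinity>"
    by (intro nn_integral_PInf_AE) auto
  then show ?thesis
    by eventually_elim (auto intro!: summable_LIMSEQ_zero summable_suminf_not_top nn)
qed

lemma integrable_of_square_integrable:
  fixes X :: "'a \<Rightarrow> 'b :: {banach, second_countable_topology}"
  assumes "X \<in> borel_measurable M" "integrable M (\<lambda>x. (norm (X x))\<^sup>2)"
  shows "integrable M X"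
proof (rule Bochner_Integration.integrable_bound)
  show "integrable M (\<lambda>x. 1 + (norm (X x))\<^sup>2)" using assms by auto
  have "t \<le> 1 + t\<^sup>2" for t :: real
    using zero_le_power2[of "t - 1/2"] by (simp add: power2_eq_square algebra_simps)
  then show "AE x in M. norm (X x) \<le> norm (1 + (norm (X x))\<^sup>2)" by auto
qed (use assms in auto)

lemma integrable_mult_of_square_integrable:
  fixes X Y :: "'a \<Rightarrow> real"
  assumes [measurable]: "X \<in> borel_measurable M" "Y \<in> borel_measurable M"
    and sq: "integrable M (\<lambda>x. (X x)\<^sup>2)" "integrable M (\<lambda>x. (Y x)\<^sup>2)"
  shows "integrable M (\<lambda>x. X x * Y x)"
    and "expectation (\<lambda>x. X x * Y x) \<le> (expectation (\<lambda>x. (X x)\<^sup>2) + expectation (\<lambda>x. (Y x)\<^sup>2)) / 2"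
proof -
  have b: "\<bar>s * t\<bar> \<le> (s\<^sup>2 + t\<^sup>2) / 2" for s t :: real
  proof -
    have "s * t \<le> (s\<^sup>2 + t\<^sup>2) / 2" "- (s * t) \<le> (s\<^sup>2 + t\<^sup>2) / 2"
      using zero_le_power2[of "s - t"] zero_le_power2[of "s + t"]
      by (simp_all add: power2_eq_square algebra_simps)
    then show ?thesis by (simp add: abs_le_iff)
  qed
  show i: "integrable M (\<lambda>x. X x * Y x)"
    by (rule Bochner_Integration.integrable_bound[of _ "\<lambda>x. ((X x)\<^sup>2 + (Y x)\<^sup>2) / 2"])
       (use sq b in \<open>auto simp: abs_le_iff\<close>)
  have "expectation (\<lambda>x. X x * Y x) \<le> expectation (\<lambda>x. ((X x)\<^sup>2 + (Y x)\<^sup>2) / 2)"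
    using i sq by (intro integral_mono order_trans[OF abs_ge_self b]) auto
  then show "expectation (\<lambda>x. X x * Y x) \<le> (expectation (\<lambda>x. (X x)\<^sup>2) + expectation (\<lambda>x. (Y x)\<^sup>2)) / 2"
    using sq by simp
qed

text \<open>Fatou's lemma carries the second moment bound to the limit. Boundedness in L2 gives
  uniform integrability, which upgrades almost sure convergence to convergence of
  expectations.\<close>

lemma expectation_tendsto_of_square_bounded:
  fixes X :: "nat \<Rightarrow> 'a \<Rightarrow> complex"
  assumes [measurable]: "\<And>n. X n \<in> borel_measurable M" "Y \<in> borel_measurable M"
    and sq: "\<And>n. integrable M (\<lambda>x. (norm (X n x))\<^sup>2)"
    and V: "\<And>n. expectation (\<lambda>x. (norm (X n x))\<^sup>2) \<le> V"
    and lim: "AE x in M. (\<lambda>n. X n x) \<longlonglongrightarrow> Y x"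
  shows "integrable M (\<lambda>x. (norm (Y x))\<^sup>2)" "expectation (\<lambda>x. (norm (Y x))\<^sup>2) \<le> V"
    and "(\<lambda>n. expectation (X n)) \<longlonglongrightarrow> expectation Y"
proof -
  have V0: "V \<ge> 0" by (rule order_trans[OF Bochner_Integration.integral_nonneg V[of 0]]) auto
  have "(\<integral>\<^sup>+x. ennreal ((norm (Y x))\<^sup>2) \<partial>M) = (\<integral>\<^sup>+x. liminf (\<lambda>n. ennreal ((norm (X n x))\<^sup>2)) \<partial>M)"
  proof (rule nn_integral_cong_AE)
    show "AE x in M. ennreal ((norm (Y x))\<^sup>2) = liminf (\<lambda>n. ennreal ((norm (X n x))\<^sup>2))"
      using lim
    proof eventually_elim
      case (elim x)
      have "(\<lambda>n. ennreal ((norm (X n x))\<^sup>2)) \<longlonglongrightarrow> ennreal ((norm (Y x))\<^sup>2)"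
        by (intro tendsto_ennrealI tendsto_intros elim)
      then show ?case using lim_imp_Liminf by force
    qed
  qed
  also have "\<dots> \<le> liminf (\<lambda>n. \<integral>\<^sup>+x. ennreal ((norm (X n x))\<^sup>2) \<partial>M)"
    by (rule nn_integral_liminf) measurable
  also have "\<dots> \<le> liminf (\<lambda>n. ennreal V)"
    by (intro Liminf_mono always_eventually allI)
       (simp add: nn_integral_eq_integral[OF sq] ennreal_leI V)
  also have "\<dots> = ennreal V" by (simp add: Liminf_const)
  finally have nnY: "(\<integral>\<^sup>+x. ennreal ((norm (Y x))\<^sup>2) \<partial>M) \<le> ennreal V" .
  show sqY: "integrable M (\<lambda>x. (norm (Y x))\<^sup>2)"
    by (rule integrableI_nonneg) (use nnY in \<open>auto simp: order_le_less_trans\<close>)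
  show VY: "expectation (\<lambda>x. (norm (Y x))\<^sup>2) \<le> V"
    using nnY V0 by (simp add: nn_integral_eq_integral[OF sqY])
  have iX: "integrable M (X n)" and iY: "integrable M Y" for n
    by (auto intro!: integrable_of_square_integrable sq sqY)
  define d where "d n x = norm (X n x - Y x)" for n x
  have [measurable]: "d n \<in> borel_measurable M" for n unfolding d_def by measurable
  have dlim: "AE x in M. (\<lambda>n. d n x) \<longlonglongrightarrow> 0"
    using lim by eventually_elim (auto simp: d_def intro: tendsto_norm_zero LIM_zero)
  have d2: "(d n x)\<^sup>2 \<le> 2 * (norm (X n x))\<^sup>2 + 2 * (norm (Y x))\<^sup>2" for n x
  proof -
    have "(d n x)\<^sup>2 \<le> (norm (X n x) + norm (Y x))\<^sup>2"
      unfolding d_def by (intro power_mono norm_triangle_ineq4) auto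
    also have "\<dots> \<le> 2 * (norm (X n x))\<^sup>2 + 2 * (norm (Y x))\<^sup>2"
      using zero_le_power2[of "norm (X n x) - norm (Y x)"] by (simp add: power2_eq_square algebra_simps)
    finally show ?thesis .
  qed
  have id: "integrable M (d n)" for n unfolding d_def using iX iY by auto
  have id2: "integrable M (\<lambda>x. (d n x)\<^sup>2)" for n
    by (rule Bochner_Integration.integrable_bound[of _ "\<lambda>x. 2 * (norm (X n x))\<^sup>2 + 2 * (norm (Y x))\<^sup>2"])
       (use sq sqY d2 in auto)
  have Ed2: "expectation (\<lambda>x. (d n x)\<^sup>2) \<le> 4 * V" for n
  proof -
    have "expectation (\<lambda>x. (d n x)\<^sup>2) \<le> expectation (\<lambda>x. 2 * (norm (X n x))\<^sup>2 + 2 * (norm (Y x))\<^sup>2)"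
      using id2 sq sqY d2 by (intro integral_mono) auto
    also have "\<dots> \<le> 4 * V" using sq sqY V[of n] VY by simp
    finally show ?thesis .
  qed
  have "(\<lambda>n. expectation (d n)) \<longlonglongrightarrow> 0"
  proof (rule LIMSEQ_I)
    fix e :: real assume e: "e > 0"
    \<comment> \<open>Truncation level: the part of \<open>d n\<close> above \<open>K\<close> has
      mean at most 4 V / K, and this choice makes it less than e / 2. The summand 1 makes the
      inequality strict and keeps \<open>K\<close> positive for V = 0.\<close>
    define K where "K = 8 * V / e + 1"
    have K: "K > 0" using V0 e by (simp add: K_def add_nonneg_pos)
    have VK: "4 * V / K < e / 2"
    proof -
      have "8 * V < e * K" using e by (simp add: K_def distrib_left)
      then show ?thesis using K by (simp add: field_simps)
    qed
    have "(\<lambda>n. expectation (\<lambda>x. min (d n x) K)) \<longlonglongrightarrow> expectation (\<lambda>x. 0)"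
    proof (rule integral_dominated_convergence[where w = "\<lambda>_. K"])
      show "AE x in M. (\<lambda>n. min (d n x) K) \<longlonglongrightarrow> 0"
        using dlim
      proof eventually_elim
        case (elim x)
        then have "(\<lambda>n. min (d n x) K) \<longlonglongrightarrow> min 0 K" by (intro tendsto_intros)
        then show ?case using K by simp
      qed
      show "AE x in M. norm (min (d n x) K) \<le> K" for n using K by (auto simp: d_def)
    qed auto
    then have "\<forall>\<^sub>F n in sequentially. expectation (\<lambda>x. min (d n x) K) < e / 2"
      using e by (auto dest: order_tendstoD(2)[of _ _ _ "e/2"])
    then obtain n0 where n0: "\<And>n. n \<ge> n0 \<Longrightarrow> expectation (\<lambda>x. min (d n x) K) < e / 2"
      by (auto simp: eventually_sequentially)
    show "\<exists>n0. \<forall>n\<ge>n0. norm (expectation (d n) - 0) < e"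
    proof (intro exI allI impI)
      fix n assume "n \<ge> n0"
      have im: "integrable M (\<lambda>x. min (d n x) K)" by (intro integrable_min id) simp
      have "d n x \<le> min (d n x) K + (d n x)\<^sup>2 / K" for x
      proof (cases "d n x \<le> K")
        case False
        then have "d n x * K \<le> d n x * d n x" by (intro mult_left_mono) (auto simp: d_def)
        then have "d n x \<le> (d n x)\<^sup>2 / K" using K by (simp only: pos_le_divide_eq power2_eq_square)
        then show ?thesis using K False by simp
      qed (use K in \<open>simp add: min_def\<close>)
      then have "expectation (d n) \<le> expectation (\<lambda>x. min (d n x) K + (d n x)\<^sup>2 / K)"
        using id id2 im by (intro integral_mono) auto
      also have "\<dots> = expectation (\<lambda>x. min (d n x) K) + expectation (\<lambda>x. (d n x)\<^sup>2) / K"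
        using id2 im by simp
      also have "\<dots> < e / 2 + e / 2"
        using n0[OF \<open>n \<ge> n0\<close>] VK divide_right_mono[OF Ed2[of n], of K] K by linarith
      finally show "norm (expectation (d n) - 0) < e"
        using Bochner_Integration.integral_nonneg[of M "d n"] by (simp add: d_def)
    qed
  qed
  then show "(\<lambda>n. expectation (X n)) \<longlonglongrightarrow> expectation Y"
  proof (rule Lim_null_comparison[THEN LIM_zero_cancel, rotated])
    have "norm (expectation (X n) - expectation Y) \<le> expectation (d n)" for n
    proof -
      have "expectation (X n) - expectation Y = expectation (\<lambda>x. X n x - Y x)"
        using iX iY by simp
      then show ?thesis unfolding d_def by (simp add: integral_norm_bound)
    qed
    then show "\<forall>\<^sub>F n in sequentially. norm (expectation (X n) - expectation Y) \<le> expectation (d n)" by simp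
  qed
qed

section \<open>Kolmogorov's one-series theorem\<close>

lemma indep_var_expectation_mult_zero:
  fixes X Y :: "'a \<Rightarrow> real"
  assumes "indep_var borel X borel Y" "integrable M X" "integrable M Y" "expectation Y = 0"
  shows "integrable M (\<lambda>x. X x * Y x)" "expectation (\<lambda>x. X x * Y x) = 0"
  using indep_var_integrable[OF assms(1-3)] indep_var_lebesgue_integral[OF assms(1-3)] assms(4) by auto

context
  fixes X :: "nat \<Rightarrow> 'a \<Rightarrow> real"
  assumes ind: "indep_vars (\<lambda>_. borel) X UNIV"
    and sq: "\<And>k. integrable M (\<lambda>x. (X k x)\<^sup>2)"
    and mean: "\<And>k. expectation (X k) = 0"
begin

private lemma X_meas [measurable]: "X k \<in> borel_measurable M"
  using ind by (auto simp: indep_vars_def)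

private lemma X_int: "integrable M (X k)"
  by (rule integrable_of_square_integrable) (use sq in \<open>auto simp: power2_eq_square abs_mult_self_eq\<close>)

private lemma indep_blocks:
  fixes g h :: "(nat \<Rightarrow> real) \<Rightarrow> real"
  assumes g: "g \<in> borel_measurable (PiM A (\<lambda>_. borel))" and h: "h \<in> borel_measurable (PiM B (\<lambda>_. borel))"
    and AB: "A \<inter> B = {}"
  shows "indep_var borel (\<lambda>x. g (\<lambda>i\<in>A. X i x)) borel (\<lambda>x. h (\<lambda>i\<in>B. X i x))"
  using indep_var_compose[OF indep_var_restrict[OF ind AB] g h] by (simp add: o_def)

private lemma sum_sq:
  "integrable M (\<lambda>x. (\<Sum>i\<in>{m..<m + n}. X i x)\<^sup>2)"
  "expectation (\<lambda>x. (\<Sum>i\<in>{m..<m + n}. X i x)\<^sup>2) = (\<Sum>i\<in>{m..<m + n}. expectation (\<lambda>x. (X i x)\<^sup>2))"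
proof (induction n)
  case (Suc n)
  let ?S = "\<lambda>x. \<Sum>i\<in>{m..<m + n}. X i x"
  have "indep_var borel (\<lambda>x. (\<lambda>y. \<Sum>i\<in>{m..<m + n}. y i) (\<lambda>i\<in>{m..<m + n}. X i x))
           borel (\<lambda>x. (\<lambda>y. y (m + n)) (\<lambda>i\<in>{m + n}. X i x))"
    by (rule indep_blocks) auto
  then have iv: "indep_var borel ?S borel (X (m + n))" by simp
  have i: "integrable M ?S" using X_int by auto
  note z = indep_var_expectation_mult_zero[OF iv i X_int mean]
  have e: "(\<Sum>i\<in>{m..<m + Suc n}. X i x)\<^sup>2 = (?S x)\<^sup>2 + 2 * (?S x * X (m + n) x) + (X (m + n) x)\<^sup>2" for x
    by (simp add: power2_eq_square algebra_simps)
  show "integrable M (\<lambda>x. (\<Sum>i\<in>{m..<m + Suc n}. X i x)\<^sup>2)"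
    unfolding e using Suc z sq by auto
  show "expectation (\<lambda>x. (\<Sum>i\<in>{m..<m + Suc n}. X i x)\<^sup>2) = (\<Sum>i\<in>{m..<m + Suc n}. expectation (\<lambda>x. (X i x)\<^sup>2))"
    unfolding e using Suc z sq by simp
qed auto

text \<open>Decompose by the first index \<open>k\<close> at which the partial sum reaches
  \<open>e\<close>. The later increments are centred and independent of the past, so the cross term
  on that event vanishes and the second moment at time \<open>n\<close> is at least the one at time
  \<open>k\<close>.\<close>

lemma Kolmogorov_maximal_inequality:
  assumes e: "e > 0"
  shows "prob {x \<in> space M. \<exists>k\<le>n. \<bar>\<Sum>i\<in>{m..<m + k}. X i x\<bar> \<ge> e} \<le>
           (\<Sum>i\<in>{m..<m + n}. expectation (\<lambda>x. (X i x)\<^sup>2)) / e\<^sup>2"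
proof -
  define S where "S k x = (\<Sum>i\<in>{m..<m + k}. X i x)" for k x
  have [measurable]: "S k \<in> borel_measurable M" for k unfolding S_def by measurable
  define A where "A k = {x \<in> space M. \<bar>S k x\<bar> \<ge> e \<and> (\<forall>j<k. \<bar>S j x\<bar> < e)}" for k
  have [measurable]: "A k \<in> events" for k unfolding A_def by measurable
  have un: "{x \<in> space M. \<exists>k\<le>n. \<bar>S k x\<bar> \<ge> e} = (\<Union>k\<in>{..n}. A k)"
  proof (intro equalityI subsetI)
    fix x assume x: "x \<in> {x \<in> space M. \<exists>k\<le>n. \<bar>S k x\<bar> \<ge> e}"
    define k where "k = (LEAST k. \<bar>S k x\<bar> \<ge> e)"
    obtain k' where k': "k' \<le> n" "\<bar>S k' x\<bar> \<ge> e" using x by auto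
    have "\<bar>S k x\<bar> \<ge> e" unfolding k_def by (rule LeastI[of "\<lambda>k. \<bar>S k x\<bar> \<ge> e", OF k'(2)])
    moreover have "k \<le> k'" unfolding k_def by (rule Least_le) fact
    moreover have "\<bar>S j x\<bar> < e" if "j < k" for j using not_less_Least[OF that[unfolded k_def]] by simp
    ultimately show "x \<in> (\<Union>k\<in>{..n}. A k)" using x k' by (auto simp: A_def intro!: bexI[of _ k])
  qed (auto simp: A_def)
  have disj: "disjoint_family_on A {..n}"
    unfolding disjoint_family_on_def A_def
    by (auto, metis linorder_neqE_nat not_less)
  have iS2: "integrable M (\<lambda>x. (S k x)\<^sup>2)" for k unfolding S_def by (rule sum_sq)
  have iS: "integrable M (S k)" for k unfolding S_def using X_int by auto
  have key: "e\<^sup>2 * prob (A k) \<le> expectation (\<lambda>x. indicator (A k) x * (S n x)\<^sup>2)" if k: "k \<le> n" for k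
  proof -
    define R where "R x = (\<Sum>i\<in>{m + k..<m + n}. X i x)" for x
    have SR: "S n x = S k x + R x" for x
      unfolding S_def R_def using k by (simp add: sum.atLeastLessThan_concat)
    \<comment> \<open>The partial sum restricted to the first passage event, as a function of the
      first block of variables only; this form exhibits its independence of the remainder
      \<open>R\<close>.\<close>
    define g where "g y = (if \<bar>\<Sum>i\<in>{m..<m + k}. y i\<bar> \<ge> e \<and> (\<forall>j<k. \<bar>\<Sum>i\<in>{m..<m + j}. y i\<bar> < e)
        then (\<Sum>i\<in>{m..<m + k}. y i) else 0)" for y :: "nat \<Rightarrow> real"
    have gm: "g \<in> borel_measurable (PiM {m..<m + k} (\<lambda>_. borel))"
    proof -
      have [measurable]: "(\<lambda>y::nat \<Rightarrow> real. \<Sum>i\<in>{m..<m + j}. y i) \<in> borel_measurable (PiM {m..<m + k} (\<lambda>_. borel))"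
        if "j \<le> k" for j :: nat
        by (rule borel_measurable_sum[where f = "\<lambda>i y. y i"])
           (use that in \<open>auto intro!: measurable_component_singleton\<close>)
      have "Measurable.pred (PiM {m..<m + k} (\<lambda>_. borel)) (\<lambda>y. \<forall>j\<in>{..<k}. \<bar>\<Sum>i\<in>{m..<m + j}. y i\<bar> < (e::real))"
        by (intro pred_intros_countable_bounded) (auto intro!: borel_measurable_pred_less borel_measurable_abs)
      then have [measurable]: "Measurable.pred (PiM {m..<m + k} (\<lambda>_. borel)) (\<lambda>y. \<forall>j<k. \<bar>\<Sum>i\<in>{m..<m + j}. y i\<bar> < (e::real))"
        by (simp add: Ball_def)
      show ?thesis unfolding g_def by measurable
    qed
    have "indep_var borel (\<lambda>x. g (\<lambda>i\<in>{m..<m + k}. X i x))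
           borel (\<lambda>x. (\<lambda>y. \<Sum>i\<in>{m + k..<m + n}. y i) (\<lambda>i\<in>{m + k..<m + n}. X i x))"
      by (rule indep_blocks[OF gm]) auto
    also have "(\<lambda>x. (\<lambda>y. \<Sum>i\<in>{m + k..<m + n}. y i) (\<lambda>i\<in>{m + k..<m + n}. X i x)) = R"
      by (simp add: R_def fun_eq_iff)
    also have "(\<lambda>x. g (\<lambda>i\<in>{m..<m + k}. X i x)) = (\<lambda>x. g (\<lambda>i. X i x))"
    proof
      fix x
      have h: "(\<Sum>i\<in>{m..<m + j}. (\<lambda>i\<in>{m..<m + k}. X i x) i) = (\<Sum>i\<in>{m..<m + j}. X i x)" if "j \<le> k" for j
        using that by (intro sum.cong) auto
      show "g (\<lambda>i\<in>{m..<m + k}. X i x) = g (\<lambda>i. X i x)"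
        unfolding g_def h[OF order_refl] using h[OF less_imp_le] by (simp only: cong: imp_cong)
    qed
    finally have iv: "indep_var borel (\<lambda>x. g (\<lambda>i. X i x)) borel R" .
    have gA: "g (\<lambda>i. X i x) = indicator (A k) x * S k x" if "x \<in> space M" for x
      using that by (auto simp: g_def A_def S_def indicator_def)
    have iR: "integrable M R" unfolding R_def using X_int by auto
    have ER: "expectation R = 0" unfolding R_def using X_int mean by (simp add: Bochner_Integration.integral_sum)
    have ig: "integrable M (\<lambda>x. g (\<lambda>i. X i x))"
      using integrable_real_mult_indicator[OF _ iS, of "A k" k]
      by (subst Bochner_Integration.integrable_cong[OF refl gA]) (auto simp: mult.commute)
    note z = indep_var_expectation_mult_zero[OF iv ig iR ER]
    have i1: "integrable M (\<lambda>x. indicator (A k) x * (S j x)\<^sup>2)" for j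
      using integrable_real_mult_indicator[OF _ iS2, of "A k" j] by (auto simp: mult.commute)
    have "e\<^sup>2 * prob (A k) = expectation (\<lambda>x. indicator (A k) x * e\<^sup>2)" by simp
    also have "\<dots> \<le> expectation (\<lambda>x. indicator (A k) x * (S k x)\<^sup>2)"
    proof (rule integral_mono[OF _ i1])
      show "indicator (A k) x * e\<^sup>2 \<le> indicator (A k) x * (S k x)\<^sup>2" for x
        using e by (auto simp: A_def indicator_def abs_le_square_iff[symmetric])
    qed (auto intro!: integrable_real_indicator simp: less_top[symmetric])
    also have "\<dots> = expectation (\<lambda>x. indicator (A k) x * (S k x)\<^sup>2 + 2 * (g (\<lambda>i. X i x) * R x))"
      using i1 z by simp
    also have "\<dots> \<le> expectation (\<lambda>x. indicator (A k) x * (S n x)\<^sup>2)"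
    proof (rule integral_mono)
      show "integrable M (\<lambda>x. indicator (A k) x * (S k x)\<^sup>2 + 2 * (g (\<lambda>i. X i x) * R x))" using i1 z by auto
      fix x assume x: "x \<in> space M"
      show "indicator (A k) x * (S k x)\<^sup>2 + 2 * (g (\<lambda>i. X i x) * R x) \<le> indicator (A k) x * (S n x)\<^sup>2"
        unfolding gA[OF x] SR using zero_le_power2[of "R x"]
        by (auto simp: indicator_def power2_eq_square algebra_simps)
    qed (rule i1)
    finally show ?thesis .
  qed
  have iA: "integrable M (\<lambda>x. indicator (A k) x * (S n x)\<^sup>2)" for k
    using integrable_real_mult_indicator[OF _ iS2, of "A k" n] by (auto simp: mult.commute)
  have "e\<^sup>2 * prob {x \<in> space M. \<exists>k\<le>n. \<bar>S k x\<bar> \<ge> e} = (\<Sum>k\<le>n. e\<^sup>2 * prob (A k))"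
    unfolding un by (subst finite_measure_finite_Union[OF _ _ disj]) (auto simp: sum_distrib_left)
  also have "\<dots> \<le> (\<Sum>k\<le>n. expectation (\<lambda>x. indicator (A k) x * (S n x)\<^sup>2))"
    by (intro sum_mono key) simp
  also have "\<dots> = expectation (\<lambda>x. \<Sum>k\<le>n. indicator (A k) x * (S n x)\<^sup>2)"
    by (rule Bochner_Integration.integral_sum[symmetric]) (rule iA)
  also have "\<dots> \<le> expectation (\<lambda>x. (S n x)\<^sup>2)"
  proof (rule integral_mono[OF _ iS2])
    show "integrable M (\<lambda>x. \<Sum>k\<le>n. indicator (A k) x * (S n x)\<^sup>2)"
      by (rule Bochner_Integration.integrable_sum) (rule iA)
    fix x
    have "(\<Sum>k\<le>n. indicator (A k) x) = (indicator (\<Union>k\<in>{..n}. A k) x :: real)"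
      by (rule indicator_UN_disjoint[OF _ disj, symmetric]) simp
    then have eq: "(\<Sum>k\<le>n. indicator (A k) x * (S n x)\<^sup>2) = indicator (\<Union>k\<in>{..n}. A k) x * (S n x)\<^sup>2"
      by (simp only: sum_distrib_right[symmetric])
    show "(\<Sum>k\<le>n. indicator (A k) x * (S n x)\<^sup>2) \<le> (S n x)\<^sup>2" unfolding eq by (simp add: indicator_def)
  qed
  also have "\<dots> = (\<Sum>i\<in>{m..<m + n}. expectation (\<lambda>x. (X i x)\<^sup>2))" unfolding S_def by (rule sum_sq)
  finally show ?thesis using e unfolding S_def by (simp add: field_simps)
qed

text \<open>Since the tails of the variance series tend to 0, the maximal inequality makes it a null
  event that oscillations of size 1 / Suc q persist beyond every \<open>m\<close>; outside countably
  many such events the partial sums are Cauchy.\<close>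

theorem Kolmogorov_one_series:
  assumes sm: "summable (\<lambda>k. expectation (\<lambda>x. (X k x)\<^sup>2))"
  shows "AE x in M. summable (\<lambda>k. X k x)"
proof -
  define v where "v k = expectation (\<lambda>x. (X k x)\<^sup>2)" for k
  have v0: "v k \<ge> 0" for k unfolding v_def by (rule Bochner_Integration.integral_nonneg) auto
  have vs: "summable v" using sm by (simp add: v_def[abs_def])
  define B where "B q m = {x \<in> space M. \<exists>k. \<bar>\<Sum>i\<in>{m..<m + k}. X i x\<bar> \<ge> inverse (real (Suc q))}" for q m
  have [measurable]: "B q m \<in> events" for q m unfolding B_def by measurable
  have PB: "prob (B q m) \<le> (\<Sum>i. v (i + m)) / (inverse (real (Suc q)))\<^sup>2" for q m
  proof -
    let ?e = "inverse (real (Suc q))"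
    define C where "C n = {x \<in> space M. \<exists>k\<le>n. \<bar>\<Sum>i\<in>{m..<m + k}. X i x\<bar> \<ge> ?e}" for n
    have "(\<lambda>n. prob (C n)) \<longlonglongrightarrow> prob (\<Union>n. C n)"
    proof (rule finite_Lim_measure_incseq)
      show "range C \<subseteq> events" unfolding C_def by (auto intro!: sets.sets_Collect_countable_Ex) measurable
      show "incseq C" by (rule incseq_SucI) (auto simp: C_def le_Suc_eq)
    qed
    moreover have "(\<Union>n. C n) = B q m" by (auto simp: C_def B_def)
    moreover have "prob (C n) \<le> (\<Sum>i. v (i + m)) / ?e\<^sup>2" for n
    proof -
      have "prob (C n) \<le> (\<Sum>i\<in>{m..<m + n}. v i) / ?e\<^sup>2"
        unfolding C_def v_def by (rule Kolmogorov_maximal_inequality) simp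
      also have "(\<Sum>i\<in>{m..<m + n}. v i) = (\<Sum>i<n. v (i + m))"
        using sum.shift_bounds_nat_ivl[of v 0 m n] by (simp add: atLeast0LessThan add.commute)
      also have "(\<Sum>i<n. v (i + m)) / ?e\<^sup>2 \<le> (\<Sum>i. v (i + m)) / ?e\<^sup>2"
        using v0 vs by (intro divide_right_mono sum_le_suminf) (auto intro: summable_ignore_initial_segment)
      finally show ?thesis .
    qed
    ultimately show ?thesis by (intro LIMSEQ_le_const2) auto
  qed
  have "prob (\<Inter>m. B q m) = 0" for q
  proof -
    let ?e = "inverse (real (Suc q))"
    have L: "(\<lambda>m. (\<Sum>i. v (i + m)) / ?e\<^sup>2) \<longlonglongrightarrow> 0 / ?e\<^sup>2"
      by (intro tendsto_divide suminf_exist_split2[OF vs] tendsto_const) auto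
    have U: "prob (\<Inter>m. B q m) \<le> (\<Sum>i. v (i + m)) / ?e\<^sup>2" for m
      by (rule order_trans[OF finite_measure_mono PB]) auto
    have "prob (\<Inter>m. B q m) \<le> 0 / ?e\<^sup>2" by (rule LIMSEQ_le_const[OF L]) (use U in blast)
    then show ?thesis by (simp add: measure_le_0_iff)
  qed
  then have "AE x in M. x \<notin> (\<Inter>m. B q m)" for q
    by (intro AE_not_in) (auto simp: null_sets_def emeasure_eq_measure)
  then have "AE x in M. \<forall>q. x \<notin> (\<Inter>m. B q m)" by (simp add: AE_all_countable)
  then show ?thesis using AE_space
  proof eventually_elim
    case (elim x)
    show "summable (\<lambda>k. X k x)"
    proof (rule summable_Cauchy[THEN iffD2], intro allI impI)
      fix e :: real assume "e > 0"
      then obtain q where q: "inverse (real (Suc q)) < e / 2" using reals_Archimedean[of "e/2"] by auto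
      obtain N where N: "\<And>k. \<bar>\<Sum>i\<in>{N..<N + k}. X i x\<bar> < inverse (real (Suc q))"
        using elim by (auto simp: B_def not_le)
      show "\<exists>N. \<forall>m\<ge>N. \<forall>n. norm (\<Sum>i\<in>{m..<n}. X i x) < e"
      proof (intro exI allI impI)
        fix m n assume m: "m \<ge> N"
        show "norm (\<Sum>i\<in>{m..<n}. X i x) < e"
        proof (cases "m \<le> n")
          case True
          then have "(\<Sum>i\<in>{m..<n}. X i x) = (\<Sum>i\<in>{N..<N + (n - N)}. X i x) - (\<Sum>i\<in>{N..<N + (m - N)}. X i x)"
            using m sum.atLeastLessThan_concat[of N m n "\<lambda>i. X i x"] by simp
          then show ?thesis using N[of "n - N"] N[of "m - N"] q by (simp add: abs_less_iff)
        qed (use \<open>e > 0\<close> in simp)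
      qed
    qed
  qed
qed

end

end

section \<open>A law of large numbers for dissociated U-statistics\<close>

definition ksub :: "nat \<Rightarrow> nat \<Rightarrow> nat set set" where
  "ksub k N = {S. S \<subseteq> {..<N} \<and> card S = k}"

lemma finite_ksub [simp]: "finite (ksub k N)"
  by (rule finite_subset[of _ "Pow {..<N}"]) (auto simp: ksub_def)

lemma ksub_mono: "N \<le> N' \<Longrightarrow> ksub k N \<subseteq> ksub k N'"
  by (auto simp: ksub_def)

lemma ksubD: "S \<in> ksub k N \<Longrightarrow> finite S" "S \<in> ksub k N \<Longrightarrow> card S = k"
  by (auto simp: ksub_def intro: finite_subset)

lemma card_ksub_containing:
  assumes "k \<ge> 1"
  shows "card {S \<in> ksub k N. i \<in> S} \<le> N ^ (k - 1)"
proof -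
  have "card {S \<in> ksub k N. i \<in> S} \<le> card {S. S \<subseteq> {..<N} \<and> card S = k - 1}"
  proof (rule card_inj_on_le[of "\<lambda>S. S - {i}"])
    show "inj_on (\<lambda>S. S - {i}) {S \<in> ksub k N. i \<in> S}"
      by (auto simp: inj_on_def)
    show "(\<lambda>S. S - {i}) ` {S \<in> ksub k N. i \<in> S} \<subseteq> {S. S \<subseteq> {..<N} \<and> card S = k - 1}"
      by (auto simp: ksub_def)
  qed (rule finite_subset[of _ "Pow {..<N}"], auto)
  also have "\<dots> = N choose (k - 1)" by (simp add: n_subsets)
  also have "\<dots> \<le> N ^ (k - 1)" by (cases "k - 1 \<le> N") (simp_all add: binomial_le_pow binomial_eq_0)
  finally show ?thesis .
qed

text \<open>Only intersecting pairs contribute to the second moment; choosing a common point and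
  then both sets shows that there are at most N^(2k-1) of them, so the normalised sum has second
  moment O(1/N). Along N = m^2 this is summable. Up to the next square the sum changes by at most
  \<open>D m\<close>, and each set in \<open>D m\<close> contains one of 2m + 1 new points.\<close>

lemma (in prob_space) ustatistic_tendsto_zero:
  fixes X :: "nat set \<Rightarrow> 'a \<Rightarrow> real"
  assumes k: "k \<ge> 1"
    and meas [measurable]: "\<And>S. X S \<in> borel_measurable M"
    and sq: "\<And>S. finite S \<Longrightarrow> card S = k \<Longrightarrow> integrable M (\<lambda>x. (X S x)\<^sup>2)"
    and V: "\<And>S. finite S \<Longrightarrow> card S = k \<Longrightarrow> expectation (\<lambda>x. (X S x)\<^sup>2) \<le> V"
    and orth: "\<And>S T. finite S \<Longrightarrow> finite T \<Longrightarrow> card S = k \<Longrightarrow> card T = k \<Longrightarrow> S \<inter> T = {} \<Longrightarrow>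
        expectation (\<lambda>x. X S x * X T x) = 0"
  shows "AE x in M. (\<lambda>N. (\<Sum>S\<in>ksub k N. X S x) / real N ^ k) \<longlonglongrightarrow> 0"
proof -
  define Y where "Y N x = (\<Sum>S\<in>ksub k N. X S x)" for N x
  define D where "D m x = (\<Sum>S\<in>ksub k ((Suc m)\<^sup>2) - ksub k (m\<^sup>2). \<bar>X S x\<bar>)" for m x
  have V0: "V \<ge> 0"
    by (rule order_trans[OF Bochner_Integration.integral_nonneg V[of "{..<k}"]]) auto
  have [measurable]: "Y N \<in> borel_measurable M" "D m \<in> borel_measurable M" for N m
    unfolding Y_def D_def by measurable
  have im: "integrable M (\<lambda>x. X S x * X T x)" and em: "expectation (\<lambda>x. X S x * X T x) \<le> V"
    if "finite S" "card S = k" "finite T" "card T = k" for S T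
  proof -
    note * = integrable_mult_of_square_integrable[OF meas meas sq[OF that(1,2)] sq[OF that(3,4)]]
    show "integrable M (\<lambda>x. X S x * X T x)" by (rule *)
    have "(expectation (\<lambda>x. (X S x)\<^sup>2) + expectation (\<lambda>x. (X T x)\<^sup>2)) / 2 \<le> (V + V) / 2"
      by (intro divide_right_mono add_mono V that) simp
    then show "expectation (\<lambda>x. X S x * X T x) \<le> V" using *(2) by simp
  qed
  have Ysq: "(Y N x)\<^sup>2 = (\<Sum>S\<in>ksub k N. \<Sum>T\<in>ksub k N. X S x * X T x)" for N x
    unfolding Y_def power2_eq_square by (rule sum_product)
  have Yint: "integrable M (\<lambda>x. (Y N x)\<^sup>2)" for N
    unfolding Ysq by (intro Bochner_Integration.integrable_sum im) (auto dest: ksubD)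
  have EY: "expectation (\<lambda>x. (Y N x)\<^sup>2) \<le> V * real N ^ (2 * k - 1)" for N
  proof -
    let ?P = "{(S, T) \<in> ksub k N \<times> ksub k N. S \<inter> T \<noteq> {}}"
    have "expectation (\<lambda>x. (Y N x)\<^sup>2) = (\<Sum>(S, T)\<in>ksub k N \<times> ksub k N. expectation (\<lambda>x. X S x * X T x))"
    proof -
      have "expectation (\<lambda>x. (Y N x)\<^sup>2) = (\<Sum>S\<in>ksub k N. \<Sum>T\<in>ksub k N. expectation (\<lambda>x. X S x * X T x))"
        unfolding Ysq
        by (subst Bochner_Integration.integral_sum, (auto intro!: Bochner_Integration.integrable_sum im dest: ksubD)[],
            intro sum.cong refl, subst Bochner_Integration.integral_sum) (auto intro!: im dest: ksubD)
      then show ?thesis by (simp add: sum.cartesian_product)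
    qed
    also have "\<dots> = (\<Sum>(S, T)\<in>?P. expectation (\<lambda>x. X S x * X T x))"
      by (rule sum.mono_neutral_right) (auto dest: ksubD intro!: orth)
    also have "\<dots> \<le> (\<Sum>(S, T)\<in>?P. V)"
      by (intro sum_mono) (auto dest: ksubD intro!: em)
    also have "\<dots> = V * real (card ?P)" by (simp add: split_beta mult.commute)
    also have "\<dots> \<le> V * real (N ^ (2 * k - 1))"
    proof (intro mult_left_mono of_nat_mono V0)
      let ?G = "\<lambda>i. {S \<in> ksub k N. i \<in> S}"
      have "card ?P \<le> card (\<Union>i\<in>{..<N}. ?G i \<times> ?G i)"
        by (rule card_mono) (auto simp: ksub_def intro: finite_subset[of _ "Pow {..<N}"])
      also have "\<dots> \<le> (\<Sum>i<N. card (?G i \<times> ?G i))" by (rule card_UN_le) simp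
      also have "\<dots> \<le> (\<Sum>i<N. N ^ (k - 1) * N ^ (k - 1))"
        unfolding card_cartesian_product by (intro sum_mono mult_mono card_ksub_containing k) auto
      also have "\<dots> = N ^ (2 * k - 1)"
      proof -
        obtain k' where "k = Suc k'" using k by (cases k) auto
        then show ?thesis by (simp add: power_add[symmetric] mult_2)
      qed
      finally show "card ?P \<le> N ^ (2 * k - 1)" .
    qed
    finally show ?thesis by simp
  qed
  have DI: "integrable M (\<lambda>x. (D m x)\<^sup>2)" and
    ED: "expectation (\<lambda>x. (D m x)\<^sup>2) \<le> V * (real ((2 * m + 1) * ((Suc m)\<^sup>2) ^ (k - 1)))\<^sup>2" for m
  proof -
    let ?F = "ksub k ((Suc m)\<^sup>2) - ksub k (m\<^sup>2)"
    have Dle: "(D m x)\<^sup>2 \<le> real (card ?F) * (\<Sum>S\<in>?F. (X S x)\<^sup>2)" for x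
      using sum_squared_le_sum_of_squares[of "\<lambda>S. \<bar>X S x\<bar>" ?F] unfolding D_def by (simp add: mult.commute)
    have i: "integrable M (\<lambda>x. real (card ?F) * (\<Sum>S\<in>?F. (X S x)\<^sup>2))"
      by (intro integrable_mult_right Bochner_Integration.integrable_sum sq) (auto dest: ksubD)
    show DI: "integrable M (\<lambda>x. (D m x)\<^sup>2)"
      by (rule Bochner_Integration.integrable_bound[OF i]) (auto intro!: AE_I2 order_trans[OF Dle])
    have cF: "card ?F \<le> (2 * m + 1) * ((Suc m)\<^sup>2) ^ (k - 1)"
    proof -
      have "?F \<subseteq> (\<Union>i\<in>{m\<^sup>2..<(Suc m)\<^sup>2}. {S \<in> ksub k ((Suc m)\<^sup>2). i \<in> S})"
        by (fastforce simp: ksub_def not_less)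
      then have "card ?F \<le> card (\<Union>i\<in>{m\<^sup>2..<(Suc m)\<^sup>2}. {S \<in> ksub k ((Suc m)\<^sup>2). i \<in> S})"
        by (intro card_mono) auto
      also have "\<dots> \<le> (\<Sum>i\<in>{m\<^sup>2..<(Suc m)\<^sup>2}. card {S \<in> ksub k ((Suc m)\<^sup>2). i \<in> S})"
        by (rule card_UN_le) simp
      also have "\<dots> \<le> (\<Sum>i\<in>{m\<^sup>2..<(Suc m)\<^sup>2}. ((Suc m)\<^sup>2) ^ (k - 1))"
        by (intro sum_mono card_ksub_containing k)
      also have "\<dots> = ((Suc m)\<^sup>2 - m\<^sup>2) * ((Suc m)\<^sup>2) ^ (k - 1)" by simp
      also have "(Suc m)\<^sup>2 - m\<^sup>2 = 2 * m + 1" by (simp add: power2_eq_square)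
      finally show ?thesis .
    qed
    have "expectation (\<lambda>x. (D m x)\<^sup>2) \<le> expectation (\<lambda>x. real (card ?F) * (\<Sum>S\<in>?F. (X S x)\<^sup>2))"
      by (rule integral_mono[OF DI i Dle])
    also have "\<dots> = real (card ?F) * (\<Sum>S\<in>?F. expectation (\<lambda>x. (X S x)\<^sup>2))"
      by (subst integral_mult_right_zero, subst Bochner_Integration.integral_sum) (auto intro!: sq dest: ksubD)
    also have "\<dots> \<le> real (card ?F) * (\<Sum>S\<in>?F. V)"
      by (intro mult_left_mono sum_mono V) (auto dest: ksubD)
    also have "\<dots> = V * (real (card ?F))\<^sup>2" by (simp add: power2_eq_square)
    also have "\<dots> \<le> V * (real ((2 * m + 1) * ((Suc m)\<^sup>2) ^ (k - 1)))\<^sup>2"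
      using cF by (intro mult_left_mono power_mono V0) (auto simp only: of_nat_le_iff of_nat_0_le_iff)
    finally show "expectation (\<lambda>x. (D m x)\<^sup>2) \<le> V * (real ((2 * m + 1) * ((Suc m)\<^sup>2) ^ (k - 1)))\<^sup>2" .
  qed
  have sm: "summable (\<lambda>m. C * (1 / (real m)\<^sup>2))" for C
    by (intro summable_mult) (use inverse_power_summable[of 2, where ?'a = real] in \<open>simp add: divide_inverse\<close>)
  have AY: "AE x in M. (\<lambda>m. (Y (m\<^sup>2) x / real m ^ (2 * k))\<^sup>2) \<longlonglongrightarrow> 0"
  proof (rule AE_tendsto_zero_of_summable_expectation[OF _ _ _ sm[of V]])
    fix m
    show "integrable M (\<lambda>x. (Y (m\<^sup>2) x / real m ^ (2 * k))\<^sup>2)"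
      unfolding power_divide using Yint by auto
    have "expectation (\<lambda>x. (Y (m\<^sup>2) x / real m ^ (2 * k))\<^sup>2) = expectation (\<lambda>x. (Y (m\<^sup>2) x)\<^sup>2) / (real m ^ (2 * k))\<^sup>2"
      unfolding power_divide by simp
    also have "\<dots> \<le> V * real (m\<^sup>2) ^ (2 * k - 1) / (real m ^ (2 * k))\<^sup>2"
      by (intro divide_right_mono EY) auto
    also have "\<dots> = V * (1 / (real m)\<^sup>2)"
    \<comment> \<open>For m = 0 both sides are 0 by the convention on division by zero.\<close>
    proof (cases "m = 0")
      case False
      have "real (m\<^sup>2) ^ (2 * k - 1) * (real m)\<^sup>2 = (real m ^ (2 * k))\<^sup>2"
      proof -
        have "2 * (2 * k - 1) + 2 = 2 * k * 2" using k by simp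
        then show ?thesis by (simp add: power_mult[symmetric] power_add[symmetric])
      qed
      then show ?thesis using False by (simp add: field_simps)
    qed (use k in simp)
    finally show "expectation (\<lambda>x. (Y (m\<^sup>2) x / real m ^ (2 * k))\<^sup>2) \<le> V * (1 / (real m)\<^sup>2)" .
  qed auto
  have AD: "AE x in M. (\<lambda>m. (D m x / real m ^ (2 * k))\<^sup>2) \<longlonglongrightarrow> 0"
  proof (rule AE_tendsto_zero_of_summable_expectation[OF _ _ _ sm[of "V * (3 * 4 ^ (k - 1))\<^sup>2"]])
    fix m
    show "integrable M (\<lambda>x. (D m x / real m ^ (2 * k))\<^sup>2)"
      unfolding power_divide using DI by auto
    have "expectation (\<lambda>x. (D m x / real m ^ (2 * k))\<^sup>2) = expectation (\<lambda>x. (D m x)\<^sup>2) / (real m ^ (2 * k))\<^sup>2"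
      unfolding power_divide by simp
    also have "\<dots> \<le> V * (real ((2 * m + 1) * ((Suc m)\<^sup>2) ^ (k - 1)))\<^sup>2 / (real m ^ (2 * k))\<^sup>2"
      by (intro divide_right_mono ED) auto
    also have "\<dots> \<le> V * (3 * 4 ^ (k - 1))\<^sup>2 * (1 / (real m)\<^sup>2)"
    proof (cases "m = 0")
      case False
      \<comment> \<open>For m >= 1 one has 2m + 1 <= 3m and Suc m <= 2m; the constants 3 and 4 come
        from here.\<close>
      have "(2 * m + 1) * ((Suc m)\<^sup>2) ^ (k - 1) \<le> (3 * m) * ((2 * m)\<^sup>2) ^ (k - 1)"
        using False by (intro mult_mono power_mono) auto
      also have "\<dots> = 3 * 4 ^ (k - 1) * (m * m ^ (2 * (k - 1)))"
        by (simp add: power_mult_distrib power_mult)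
      also have "m * m ^ (2 * (k - 1)) = m ^ (2 * k - 1)"
      proof -
        obtain k' where "k = Suc k'" using k by (cases k) auto
        then show ?thesis by simp
      qed
      finally have "real ((2 * m + 1) * ((Suc m)\<^sup>2) ^ (k - 1)) \<le> real (3 * 4 ^ (k - 1) * m ^ (2 * k - 1))"
        by (rule of_nat_mono)
      then have "(real ((2 * m + 1) * ((Suc m)\<^sup>2) ^ (k - 1)))\<^sup>2 \<le> (3 * 4 ^ (k - 1) * real m ^ (2 * k - 1))\<^sup>2"
        by (intro power_mono) auto
      then have "V * (real ((2 * m + 1) * ((Suc m)\<^sup>2) ^ (k - 1)))\<^sup>2 / (real m ^ (2 * k))\<^sup>2
         \<le> V * (3 * 4 ^ (k - 1) * real m ^ (2 * k - 1))\<^sup>2 / (real m ^ (2 * k))\<^sup>2"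
        using V0 by (intro divide_right_mono mult_left_mono) auto
      also have "\<dots> = V * (3 * 4 ^ (k - 1))\<^sup>2 * (1 / (real m)\<^sup>2)"
      proof -
        have "real m ^ (2 * k) = real m ^ (2 * k - 1) * real m"
          using k by (metis One_nat_def Suc_pred mult.commute nat_0_less_mult_iff power_Suc zero_less_numeral less_eq_Suc_le)
        then show ?thesis using False by (simp add: power_mult_distrib field_simps)
      qed
      finally show ?thesis .
    qed (use k in \<open>simp add: power_0_left\<close>)
    finally show "expectation (\<lambda>x. (D m x / real m ^ (2 * k))\<^sup>2) \<le> V * (3 * 4 ^ (k - 1))\<^sup>2 * (1 / (real m)\<^sup>2)" .
  qed auto
  \<comment> \<open>The largest square below \<open>N\<close> is that of
    \<open>floor_sqrt N\<close>, so the limits along squares are composed with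
    \<open>floor_sqrt\<close>.\<close>
  have fl: "filterlim floor_sqrt at_top sequentially"
    unfolding filterlim_at_top
  proof
    fix Z
    show "\<forall>\<^sub>F n in sequentially. Z \<le> floor_sqrt n"
      using eventually_ge_at_top[of "Z\<^sup>2"]
      by eventually_elim (metis floor_sqrt_inverse_power2 monoD mono_floor_sqrt)
  qed
  show ?thesis using AY AD
  proof eventually_elim
    case (elim x)
    have sq0: "f \<longlonglongrightarrow> 0" if "(\<lambda>m. (f m)\<^sup>2) \<longlonglongrightarrow> 0" for f :: "nat \<Rightarrow> real"
    proof -
      have "(\<lambda>m. sqrt ((f m)\<^sup>2)) \<longlonglongrightarrow> sqrt 0" by (intro tendsto_real_sqrt that)
      then show ?thesis by (simp add: tendsto_rabs_zero_iff)
    qed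
    have "(\<lambda>m. \<bar>Y (m\<^sup>2) x / real m ^ (2 * k)\<bar> + D m x / real m ^ (2 * k)) \<longlonglongrightarrow> 0 + 0"
      by (rule tendsto_add[OF tendsto_rabs_zero[OF sq0[OF elim(1)]] sq0[OF elim(2)]])
    then have lim: "(\<lambda>N. \<bar>Y ((floor_sqrt N)\<^sup>2) x / real (floor_sqrt N) ^ (2 * k)\<bar> + D (floor_sqrt N) x / real (floor_sqrt N) ^ (2 * k)) \<longlonglongrightarrow> 0"
      using filterlim_compose[OF _ fl] by force
    have "norm (Y N x / real N ^ k) \<le> \<bar>Y ((floor_sqrt N)\<^sup>2) x / real (floor_sqrt N) ^ (2 * k)\<bar> + D (floor_sqrt N) x / real (floor_sqrt N) ^ (2 * k)"
      if "N \<ge> 1" for N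
    proof -
      define m where "m = floor_sqrt N"
      have m1: "m\<^sup>2 \<le> N" unfolding m_def by (rule floor_sqrt_power2_le)
      have m2: "N \<le> (Suc m)\<^sup>2" unfolding m_def using Suc_floor_sqrt_power2_gt[of N] by simp
      have m0: "m > 0" unfolding m_def using that by simp
      have "Y N x - Y (m\<^sup>2) x = (\<Sum>S\<in>ksub k N - ksub k (m\<^sup>2). X S x)"
        unfolding Y_def using ksub_mono[OF m1, of k] by (simp add: sum_diff)
      then have "\<bar>Y N x - Y (m\<^sup>2) x\<bar> \<le> (\<Sum>S\<in>ksub k N - ksub k (m\<^sup>2). \<bar>X S x\<bar>)" by (simp add: sum_abs)
      also have "\<dots> \<le> D m x" unfolding D_def using ksub_mono[OF m2, of k] by (intro sum_mono2) auto
      finally have a: "\<bar>Y N x\<bar> \<le> \<bar>Y (m\<^sup>2) x\<bar> + D m x" by linarith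
      have b: "real m ^ (2 * k) \<le> real N ^ k"
        unfolding power_mult using m1 by (intro power_mono) (auto simp: of_nat_power[symmetric] simp del: of_nat_power)
      have "norm (Y N x / real N ^ k) = \<bar>Y N x\<bar> / real N ^ k" by simp
      also have "\<dots> \<le> (\<bar>Y (m\<^sup>2) x\<bar> + D m x) / real m ^ (2 * k)"
        using a b m0 by (intro frac_le) auto
      also have "\<dots> = \<bar>Y (m\<^sup>2) x / real m ^ (2 * k)\<bar> + D m x / real m ^ (2 * k)"
        by (simp add: add_divide_distrib)
      finally show ?thesis unfolding m_def .
    qed
    then have "(\<lambda>N. Y N x / real N ^ k) \<longlonglongrightarrow> 0"
      by (intro Lim_null_comparison[OF _ lim]) (auto simp: eventually_sequentially)
    then show "(\<lambda>N. (\<Sum>S\<in>ksub k N. X S x) / real N ^ k) \<longlonglongrightarrow> 0" by (simp add: Y_def)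
  qed
qed

section \<open>The Gaussian product space\<close>

abbreviation stdn :: "real measure" where
  "stdn \<equiv> density lborel std_normal_density"

lemma prob_space_stdn: "prob_space stdn"
  by (rule prob_space_normal_density) simp

lemma prob_space_Gauss: "prob_space Gauss"
  unfolding Gauss_def by (intro prob_space_PiM prob_space_stdn)

interpretation Gauss: prob_space Gauss by (rule prob_space_Gauss)

lemma space_Gauss [simp]: "space Gauss = UNIV"
  by (simp add: Gauss_def space_PiM)

lemma measure_Gauss_UNIV [simp]: "measure Gauss UNIV = 1"
  using Gauss.prob_space by simp

lemma Gauss_coord_measurable_stdn: "(\<lambda>x. x i) \<in> measurable Gauss stdn"
  unfolding Gauss_def by (rule measurable_component_singleton) simp

lemma Gauss_coord_measurable [measurable]: "(\<lambda>x. x i) \<in> borel_measurable Gauss"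
  using Gauss_coord_measurable_stdn[of i] by (simp cong: measurable_cong_sets)

lemma distr_Gauss_coord: "distr Gauss stdn (\<lambda>x. x i) = stdn"
  unfolding Gauss_def by (rule distr_PiM_component) (auto intro: prob_space_stdn)

lemma Gauss_coord_integral:
  fixes h :: "real \<Rightarrow> 'b :: {banach, second_countable_topology}"
  assumes "integrable lborel (\<lambda>t. std_normal_density t *\<^sub>R h t)" "h \<in> borel_measurable borel"
  shows "integrable Gauss (\<lambda>x. h (x i))"
    "(\<integral>x. h (x i) \<partial>Gauss) = (\<integral>t. std_normal_density t *\<^sub>R h t \<partial>lborel)"
proof -
  have h: "integrable stdn h" using assms by (subst integrable_density) auto
  show "integrable Gauss (\<lambda>x. h (x i))"
    by (rule integrable_distr[OF Gauss_coord_measurable_stdn]) (simp add: distr_Gauss_coord h)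
  have "(\<integral>x. h (x i) \<partial>Gauss) = (\<integral>t. h t \<partial>distr Gauss stdn (\<lambda>x. x i))"
    by (rule integral_distr[symmetric]) (use assms in \<open>auto intro: Gauss_coord_measurable_stdn\<close>)
  also have "\<dots> = (\<integral>t. std_normal_density t *\<^sub>R h t \<partial>lborel)"
    unfolding distr_Gauss_coord using assms by (subst integral_density) auto
  finally show "(\<integral>x. h (x i) \<partial>Gauss) = (\<integral>t. std_normal_density t *\<^sub>R h t \<partial>lborel)" .
qed

lemma Gauss_coord_abs_power: "integrable Gauss (\<lambda>x. \<bar>x i\<bar> ^ p)"
  by (rule Gauss_coord_integral(1)) (use integrable_std_normal_moment_abs[of p] in auto)

lemma Gauss_coord_abs_power_eq: "Gauss.expectation (\<lambda>x. \<bar>x i\<bar> ^ p) = Gauss.expectation (\<lambda>x. \<bar>x j\<bar> ^ p)"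
proof -
  have "Gauss.expectation (\<lambda>x. \<bar>x i\<bar> ^ p) = (\<integral>t. std_normal_density t *\<^sub>R \<bar>t\<bar> ^ p \<partial>lborel)" for i
    by (rule Gauss_coord_integral(2)) (use integrable_std_normal_moment_abs[of p] in auto)
  then show ?thesis by simp
qed

lemma Gauss_coord_mean: "Gauss.expectation (\<lambda>x. x i) = 0"
  using Gauss_coord_integral(2)[of "\<lambda>t. t" i] integrable_std_normal_moment[of 1]
    integral_std_normal_moment_odd[of 0] by simp

lemma Gauss_coord_square: "Gauss.expectation (\<lambda>x. (x i)\<^sup>2) = 1"
  using Gauss_coord_integral(2)[of "\<lambda>t. t\<^sup>2" i] integrable_std_normal_moment[of 2]
    integral_std_normal_moment_even[of 1] by simp

text \<open>exp (t^2 / 4) times the standard normal density is sqrt 2 times the centred normal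
  density of variance 2; hence the value sqrt 2, rounded up to 2.\<close>

lemma Gauss_coord_exp_square:
  "integrable Gauss (\<lambda>x. exp ((x i)\<^sup>2 / 4))" "Gauss.expectation (\<lambda>x. exp ((x i)\<^sup>2 / 4)) \<le> 2"
proof -
  have e: "std_normal_density t * exp (t\<^sup>2 / 4) = sqrt 2 * normal_density 0 (sqrt 2) t" for t
    by (simp add: normal_density_def exp_add[symmetric] real_sqrt_mult field_simps)
  have i: "integrable lborel (\<lambda>t. std_normal_density t *\<^sub>R exp (t\<^sup>2 / 4))"
    unfolding real_scaleR_def e by (intro integrable_mult_right integrable_normal_density) simp
  show "integrable Gauss (\<lambda>x. exp ((x i)\<^sup>2 / 4))"
    by (rule Gauss_coord_integral(1)[OF i]) simp
  have "Gauss.expectation (\<lambda>x. exp ((x i)\<^sup>2 / 4)) = sqrt 2"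
    by (subst Gauss_coord_integral(2)[OF i]) (simp_all add: e)
  also have "\<dots> \<le> 2" by (rule real_le_lsqrt) auto
  finally show "Gauss.expectation (\<lambda>x. exp ((x i)\<^sup>2 / 4)) \<le> 2" .
qed

section \<open>Functions of disjoint sets of coordinates\<close>

text \<open>Independence is handled through the coordinates that a function reads: measurable
  functions reading disjoint sets are independent. This spares all reasoning about generated
  sigma-algebras.\<close>

definition depends_on :: "((gidx \<Rightarrow> real) \<Rightarrow> 'b) \<Rightarrow> gidx set \<Rightarrow> bool" where
  "depends_on f J \<longleftrightarrow> (\<forall>x y. (\<forall>i\<in>J. x i = y i) \<longrightarrow> f x = f y)"

lemma depends_onI: "(\<And>x y. (\<And>i. i \<in> J \<Longrightarrow> x i = y i) \<Longrightarrow> f x = f y) \<Longrightarrow> depends_on f J"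
  unfolding depends_on_def by blast

lemma depends_onD: "depends_on f J \<Longrightarrow> (\<And>i. i \<in> J \<Longrightarrow> x i = y i) \<Longrightarrow> f x = f y"
  unfolding depends_on_def by blast

lemma indep_vars_Gauss_coord: "Gauss.indep_vars (\<lambda>_. stdn) (\<lambda>i x. x i) UNIV"
proof (subst Gauss.indep_vars_iff_distr_eq_PiM)
  have "distr Gauss (PiM UNIV (\<lambda>_. stdn)) (\<lambda>x. \<lambda>i\<in>UNIV. x i) = distr Gauss Gauss (\<lambda>x. x)"
    by (simp add: Gauss_def restrict_def)
  also have "\<dots> = PiM UNIV (\<lambda>i. distr Gauss stdn (\<lambda>x. x i))"
    unfolding distr_Gauss_coord by (simp add: Gauss_def)
  finally show "distr Gauss (PiM UNIV (\<lambda>_. stdn)) (\<lambda>x. \<lambda>i\<in>UNIV. x i) = PiM UNIV (\<lambda>i. distr Gauss stdn (\<lambda>x. x i))" .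
qed (auto simp: Gauss_coord_measurable_stdn)

lemma indep_vars_depends_on:
  fixes Y :: "'k \<Rightarrow> (gidx \<Rightarrow> real) \<Rightarrow> 'b :: topological_space"
  assumes m: "\<And>k. k \<in> K \<Longrightarrow> Y k \<in> borel_measurable Gauss"
    and d: "\<And>k. k \<in> K \<Longrightarrow> depends_on (Y k) (L k)" and disj: "disjoint_family_on L K"
  shows "Gauss.indep_vars (\<lambda>_. borel) Y K"
proof -
  \<comment> \<open>\<open>Y k\<close> with every coordinate outside \<open>L k\<close> set to 0: a
    measurable function on the smaller product that reproduces \<open>Y k\<close>, so the grouping
    of independent coordinates applies.\<close>
  define Z where "Z k y = Y k (\<lambda>i. if i \<in> L k then y i else 0)" for k y
  have *: "Gauss.indep_vars (\<lambda>k. PiM (L k) (\<lambda>_. stdn)) (\<lambda>k x. restrict (\<lambda>i. x i) (L k)) K"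
    by (rule Gauss.indep_vars_restrict[OF indep_vars_Gauss_coord]) (use disj in auto)
  have Zm: "Z k \<in> borel_measurable (PiM (L k) (\<lambda>_. stdn))" if "k \<in> K" for k
  proof -
    have "(\<lambda>y i. if i \<in> L k then y i else 0) \<in> measurable (PiM (L k) (\<lambda>_. stdn)) Gauss"
      unfolding Gauss_def
    proof (rule measurable_PiM_single')
      fix i
      show "(\<lambda>y. if i \<in> L k then y i else 0) \<in> measurable (PiM (L k) (\<lambda>_. stdn)) stdn"
        using measurable_component_singleton[of i "L k" "\<lambda>_. stdn"] by (cases "i \<in> L k") simp_all
    qed auto
    from measurable_compose[OF this m[OF that]] show ?thesis by (simp add: Z_def[abs_def])
  qed
  have "Gauss.indep_vars (\<lambda>_. borel) (\<lambda>k x. Z k (restrict (\<lambda>i. x i) (L k))) K"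
    by (rule Gauss.indep_vars_compose2[OF *]) (rule Zm)
  also have "?this \<longleftrightarrow> ?thesis"
    by (intro Gauss.indep_vars_cong refl) (auto simp: Z_def intro!: depends_onD[OF d])
  finally show ?thesis .
qed

lemma indep_var_depends_on:
  fixes f g :: "(gidx \<Rightarrow> real) \<Rightarrow> 'b :: topological_space"
  assumes "f \<in> borel_measurable Gauss" "g \<in> borel_measurable Gauss" "depends_on f J" "depends_on g L" "J \<inter> L = {}"
  shows "Gauss.indep_var borel f borel g"
proof -
  have "Gauss.indep_vars (\<lambda>_. borel) (case_bool f g) UNIV"
    by (rule indep_vars_depends_on[where L = "case_bool J L"])
       (use assms in \<open>auto simp: disjoint_family_on_def split: bool.splits\<close>)
  moreover have "(\<lambda>_. borel) = case_bool borel borel" by (auto split: bool.split)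
  ultimately show ?thesis unfolding Gauss.indep_var_def by metis
qed

lemma expectation_mult_depends_on:
  fixes f g :: "(gidx \<Rightarrow> real) \<Rightarrow> 'b :: {real_normed_field, banach, second_countable_topology}"
  assumes "integrable Gauss f" "integrable Gauss g" "depends_on f J" "depends_on g L" "J \<inter> L = {}"
  shows "Gauss.expectation (\<lambda>x. f x * g x) = Gauss.expectation f * Gauss.expectation g"
  by (rule Gauss.indep_var_lebesgue_integral[OF indep_var_depends_on[OF _ _ assms(3-5)]])
     (use assms in auto)

section \<open>Random variables with all moments\<close>

text \<open>An algebra of functions containing all entries of the truncated matrices, so that
  integrability of every polynomial in them follows from closure rules.\<close>

definition allmom :: "((gidx \<Rightarrow> real) \<Rightarrow> complex) \<Rightarrow> bool" where
  "allmom f \<longleftrightarrow> f \<in> borel_measurable Gauss \<and> (\<forall>p. integrable Gauss (\<lambda>x. norm (f x) ^ p))"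

lemma allmom_measurable: "allmom f \<Longrightarrow> f \<in> borel_measurable Gauss"
  by (simp add: allmom_def)

lemma allmom_power: "allmom f \<Longrightarrow> integrable Gauss (\<lambda>x. norm (f x) ^ p)"
  by (simp add: allmom_def)

lemma allmom_integrable: "allmom f \<Longrightarrow> integrable Gauss f"
  using allmom_power[of f 1] allmom_measurable[of f] by (simp add: integrable_norm_iff)

lemma allmom_const [simp, intro]: "allmom (\<lambda>_. c)"
  by (simp add: allmom_def)

lemma allmom_cnj: "allmom f \<Longrightarrow> allmom (\<lambda>x. cnj (f x))"
proof -
  have "cnj \<in> borel_measurable borel" by (intro borel_measurable_continuous_onI continuous_intros)
  then show "allmom f \<Longrightarrow> allmom (\<lambda>x. cnj (f x))"
    unfolding allmom_def using measurable_compose by auto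
qed

lemma power_add_le_power:
  fixes a b :: real
  assumes "a \<ge> 0" "b \<ge> 0"
  shows "(a + b) ^ p \<le> 2 ^ p * (a ^ p + b ^ p)"
proof -
  have "(a + b) ^ p \<le> (2 * max a b) ^ p" using assms by (intro power_mono) auto
  also have "\<dots> = 2 ^ p * max a b ^ p" by (simp add: power_mult_distrib)
  also have "max a b ^ p \<le> a ^ p + b ^ p" using assms by (auto simp: max_def)
  finally show ?thesis by simp
qed

lemma allmom_add: assumes "allmom f" "allmom g" shows "allmom (\<lambda>x. f x + g x)"
proof -
  have [measurable]: "f \<in> borel_measurable Gauss" "g \<in> borel_measurable Gauss"
    using assms by (auto simp: allmom_def)
  have "integrable Gauss (\<lambda>x. norm (f x + g x) ^ p)" for p
  proof (rule Bochner_Integration.integrable_bound)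
    show "integrable Gauss (\<lambda>x. 2 ^ p * (norm (f x) ^ p + norm (g x) ^ p))"
      using assms by (auto simp: allmom_def)
    have "norm (f x + g x) ^ p \<le> 2 ^ p * (norm (f x) ^ p + norm (g x) ^ p)" for x
      by (rule order_trans[OF power_mono[OF norm_triangle_ineq] power_add_le_power]) auto
    then show "AE x in Gauss. norm (norm (f x + g x) ^ p) \<le> norm (2 ^ p * (norm (f x) ^ p + norm (g x) ^ p))"
      by (auto simp: abs_mult)
  qed measurable
  then show ?thesis by (simp add: allmom_def)
qed

lemma allmom_mult: assumes "allmom f" "allmom g" shows "allmom (\<lambda>x. f x * g x)"
proof -
  have [measurable]: "f \<in> borel_measurable Gauss" "g \<in> borel_measurable Gauss"
    using assms by (auto simp: allmom_def)
  have "integrable Gauss (\<lambda>x. norm (f x * g x) ^ p)" for p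
  proof (rule Bochner_Integration.integrable_bound)
    show "integrable Gauss (\<lambda>x. norm (f x) ^ (2 * p) + norm (g x) ^ (2 * p))"
      using assms by (auto simp: allmom_def)
    have ab: "a * b \<le> a\<^sup>2 + b\<^sup>2" for a b :: real
    proof -
      have "2 * (a * b) \<le> a\<^sup>2 + b\<^sup>2" using zero_le_power2[of "a - b"] by (simp add: power2_eq_square algebra_simps)
      moreover have "0 \<le> a\<^sup>2 + b\<^sup>2" by simp
      ultimately show ?thesis by linarith
    qed
    have "norm (f x * g x) ^ p \<le> norm (f x) ^ (2 * p) + norm (g x) ^ (2 * p)" for x
      using ab[of "norm (f x) ^ p" "norm (g x) ^ p"]
      by (simp add: norm_mult power_mult_distrib power_mult[symmetric] mult.commute)
    then show "AE x in Gauss. norm (norm (f x * g x) ^ p) \<le> norm (norm (f x) ^ (2 * p) + norm (g x) ^ (2 * p))"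
      by auto
  qed measurable
  then show ?thesis by (simp add: allmom_def)
qed

lemma allmom_sum: "(\<And>i. i \<in> I \<Longrightarrow> allmom (f i)) \<Longrightarrow> allmom (\<lambda>x. \<Sum>i\<in>I. f i x)"
  by (induction I rule: infinite_finite_induct) (auto intro: allmom_add)

lemma allmom_prod: "(\<And>i. i \<in> I \<Longrightarrow> allmom (f i)) \<Longrightarrow> allmom (\<lambda>x. \<Prod>i\<in>I. f i x)"
  by (induction I rule: infinite_finite_induct) (auto intro: allmom_mult)

lemma allmom_coord: "allmom (\<lambda>x. complex_of_real (x i))"
  unfolding allmom_def using Gauss_coord_abs_power by auto

lemma allmom_diff: "allmom f \<Longrightarrow> allmom g \<Longrightarrow> allmom (\<lambda>x. f x - g x)"
  using allmom_add[of f "\<lambda>x. (-1) * g x"] allmom_mult[of "\<lambda>_. -1" g] by simp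

lemma allmom_Complex: "allmom (\<lambda>x. Complex (x i) (x j) / complex_of_real (sqrt 2))"
  unfolding Complex_eq divide_inverse
  by (intro allmom_mult allmom_add allmom_coord allmom_const)

lemma allmom_xi: "allmom (\<lambda>x. xi x s k i)"
  unfolding xi_def by (rule allmom_Complex)

lemma allmom_GUE: "allmom (\<lambda>x. GUE x i j)"
proof -
  consider "i = j" | "i \<noteq> j" "i < j" | "i \<noteq> j" "\<not> i < j" by blast
  then show ?thesis
    by cases (simp_all only: GUE_def if_True if_False refl allmom_coord allmom_Complex allmom_cnj[OF allmom_Complex] simp_thms)
qed

lemma measurable_xi [measurable]: "(\<lambda>x. xi x s k i) \<in> borel_measurable Gauss"
  by (rule allmom_measurable[OF allmom_xi])

lemma measurable_GUE [measurable]: "(\<lambda>x. GUE x i j) \<in> borel_measurable Gauss"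
  by (rule allmom_measurable[OF allmom_GUE])

section \<open>Low moments of the Gaussian entries\<close>

lemma expectation_Complex:
  "Gauss.expectation (\<lambda>x. Complex (x i) (x j) / complex_of_real (sqrt 2)) = 0"
proof -
  have "Gauss.expectation (\<lambda>x. complex_of_real (x l)) = 0" for l
    by (simp add: Gauss_coord_mean)
  moreover have "integrable Gauss (\<lambda>x. complex_of_real (x l))" for l by (rule allmom_integrable[OF allmom_coord])
  ultimately show ?thesis unfolding Complex_eq by simp
qed

lemma norm_Complex_square: "(norm (Complex a b / complex_of_real (sqrt 2)))\<^sup>2 = (a\<^sup>2 + b\<^sup>2) / 2"
  by (simp add: norm_divide power_divide cmod_power2)

lemma expectation_norm_square_Complex:
  "Gauss.expectation (\<lambda>x. (norm (Complex (x i) (x j) / complex_of_real (sqrt 2)))\<^sup>2) = 1"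
proof -
  have "integrable Gauss (\<lambda>x. (x l)\<^sup>2)" for l using Gauss_coord_abs_power[of l 2] by simp
  then show ?thesis unfolding norm_Complex_square by (simp add: Gauss_coord_square)
qed

lemma expectation_xi: "Gauss.expectation (\<lambda>x. xi x s k i) = 0"
  unfolding xi_def by (rule expectation_Complex)

lemma expectation_xi_cnj: "Gauss.expectation (\<lambda>x. xi x s k i * cnj (xi x s k i)) = 1"
proof -
  have "Gauss.expectation (\<lambda>x. xi x s k i * cnj (xi x s k i)) =
     Gauss.expectation (\<lambda>x. complex_of_real ((norm (xi x s k i))\<^sup>2))"
    by (simp only: complex_norm_square)
  also have "\<dots> = 1" unfolding integral_complex_of_real xi_def expectation_norm_square_Complex by simp
  finally show ?thesis .
qed

lemma depends_on_xi: "depends_on (\<lambda>x. xi x s k i) (range (XI s k i))"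
  by (rule depends_onI) (auto simp: xi_def)

text \<open>Symmetric in its arguments, since an entry and its transpose read the same coordinates:
  the entries are independent only up to transposition.\<close>

definition gue_idx :: "nat \<Rightarrow> nat \<Rightarrow> gidx set" where
  "gue_idx i j = (if i = j then {GD i} else {GO (min i j) (max i j) True, GO (min i j) (max i j) False})"

lemma depends_on_GUE: "depends_on (\<lambda>x. GUE x i j) (gue_idx i j)"
  by (rule depends_onI) (auto simp: GUE_def gue_idx_def min_def max_def)

lemma expectation_GUE: "Gauss.expectation (\<lambda>x. GUE x i j) = 0"
proof (cases "i = j")
  case True then show ?thesis by (simp add: GUE_def Gauss_coord_mean)
next
  case False
  show ?thesis
  proof (cases "i < j")
    case True then show ?thesis unfolding GUE_def using False by (simp only: if_False if_True expectation_Complex)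
  next
    case F: False
    have "Gauss.expectation (\<lambda>x. GUE x i j) = Gauss.expectation (\<lambda>x. cnj (Complex (x (GO j i True)) (x (GO j i False)) / complex_of_real (sqrt 2)))"
      unfolding GUE_def using False F by (simp only: if_False)
    also have "\<dots> = cnj (Gauss.expectation (\<lambda>x. Complex (x (GO j i True)) (x (GO j i False)) / complex_of_real (sqrt 2)))"
      using integral_bounded_linear'[OF bounded_linear_cnj bounded_linear_cnj, of Gauss
          "\<lambda>x. Complex (x (GO j i True)) (x (GO j i False)) / complex_of_real (sqrt 2)"] by simp
    finally show ?thesis unfolding expectation_Complex by simp
  qed
qed

lemma GUE_hermitian: "GUE x j i = cnj (GUE x i j)"
  by (auto simp: GUE_def)

lemma expectation_GUE_GUE: "i \<noteq> j \<Longrightarrow> Gauss.expectation (\<lambda>x. GUE x i j * GUE x j i) = 1"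
proof -
  assume ij: "i \<noteq> j"
  define a b where "a = min i j" and "b = max i j"
  have ab: "a < b" using ij by (auto simp: a_def b_def)
  have e: "GUE x i j * GUE x j i = complex_of_real ((norm (Complex (x (GO a b True)) (x (GO a b False)) / complex_of_real (sqrt 2)))\<^sup>2)" for x
  proof -
    have "GUE x i j * GUE x j i = GUE x a b * GUE x b a"
      by (auto simp: a_def b_def min_def max_def mult.commute)
    also have "\<dots> = complex_of_real ((norm (GUE x a b))\<^sup>2)"
      by (simp only: GUE_hermitian[of x b a] complex_norm_square)
    also have "GUE x a b = Complex (x (GO a b True)) (x (GO a b False)) / complex_of_real (sqrt 2)"
      using ab by (simp add: GUE_def)
    finally show ?thesis .
  qed
  show ?thesis unfolding e integral_complex_of_real expectation_norm_square_Complex by simp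
qed

section \<open>Exponential moments\<close>

lemma power_le_fact_exp: "0 \<le> x \<Longrightarrow> x ^ n \<le> fact n * exp (x::real)"
proof -
  assume x: "0 \<le> x"
  have "(\<Sum>k\<in>{n}. x ^ k /\<^sub>R fact k) \<le> (\<Sum>k. x ^ k /\<^sub>R fact k)"
    by (rule sum_le_suminf[OF summable_exp_generic]) (use x in auto)
  then show ?thesis by (simp add: exp_def field_simps)
qed

lemma exp_mean_le: "exp ((a + b) / 2) \<le> (exp a + exp b) / (2::real)"
proof -
  have "exp ((a + b) / 2) = exp (a / 2) * exp (b / 2)" by (simp add: exp_add[symmetric] add_divide_distrib)
  moreover have "exp a = (exp (a / 2))\<^sup>2" "exp b = (exp (b / 2))\<^sup>2" by (simp_all add: power2_eq_square exp_add[symmetric])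
  ultimately show ?thesis
    using zero_le_power2[of "exp (a / 2) - exp (b / 2)"] by (simp add: power2_eq_square algebra_simps)
qed

context prob_space
begin

lemma square_integrable_of_exp_moment:
  fixes Y :: "'a \<Rightarrow> real"
  assumes [measurable]: "Y \<in> borel_measurable M" and i: "integrable M (\<lambda>x. exp (\<bar>Y x\<bar> / 4))"
  shows "integrable M (\<lambda>x. (Y x)\<^sup>2)"
    and "expectation (\<lambda>x. (Y x)\<^sup>2) \<le> 32 * expectation (\<lambda>x. exp (\<bar>Y x\<bar> / 4))"
proof -
  \<comment> \<open>Here 32 = 2! 4^2, from the estimate y^2 <= 2! e^y at y = |Y x| / 4.\<close>
  have b: "(Y x)\<^sup>2 \<le> 32 * exp (\<bar>Y x\<bar> / 4)" for x
    using power_le_fact_exp[of "\<bar>Y x\<bar> / 4" 2] by (simp add: power2_eq_square field_simps)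
  show s: "integrable M (\<lambda>x. (Y x)\<^sup>2)"
    by (rule Bochner_Integration.integrable_bound[OF integrable_mult_right[OF i, of 32]]) (use b in auto)
  have "expectation (\<lambda>x. (Y x)\<^sup>2) \<le> expectation (\<lambda>x. 32 * exp (\<bar>Y x\<bar> / 4))"
    by (rule integral_mono[OF s integrable_mult_right[OF i]]) (rule b)
  then show "expectation (\<lambda>x. (Y x)\<^sup>2) \<le> 32 * expectation (\<lambda>x. exp (\<bar>Y x\<bar> / 4))" by simp
qed

text \<open>Taylor expansion to second order: the linear term has mean 0. In the remainder both the
  exponential factor and the square are bounded through exp (|Y| / 8), whose square has a mean by
  assumption. The constants are 128 = 2! 8^2 and 768 = 128 times the moment bound 6.\<close>

lemma mgf_le_of_exp_moment:
  fixes Y :: "'a \<Rightarrow> real"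
  assumes [measurable]: "Y \<in> borel_measurable M" and i: "integrable M (\<lambda>x. exp (\<bar>Y x\<bar> / 4))"
    and c: "expectation (\<lambda>x. exp (\<bar>Y x\<bar> / 4)) \<le> 6" and mean: "expectation Y = 0" and s: "\<bar>s\<bar> \<le> 1 / 8"
  shows "integrable M (\<lambda>x. exp (s * Y x))" "expectation (\<lambda>x. exp (s * Y x)) \<le> exp (768 * s\<^sup>2)"
proof -
  have sY: "\<bar>s * Y x\<bar> \<le> \<bar>Y x\<bar> / 8" for x
    using mult_right_mono[OF s, of "\<bar>Y x\<bar>"] by (simp add: abs_mult)
  have "exp (s * Y x) \<le> exp (\<bar>Y x\<bar> / 4)" for x using sY[of x] by (simp add: abs_le_iff)
  then show i1: "integrable M (\<lambda>x. exp (s * Y x))"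
    by (intro Bochner_Integration.integrable_bound[OF i]) auto
  have iY: "integrable M Y"
    by (rule integrable_of_square_integrable) (use square_integrable_of_exp_moment[OF _ i] in auto)
  have b: "exp (s * Y x) \<le> 1 + s * Y x + 128 * s\<^sup>2 * exp (\<bar>Y x\<bar> / 4)" for x
  proof -
    have "\<bar>exp (s * Y x) - (1 + s * Y x)\<bar> \<le> exp \<bar>s * Y x\<bar> * \<bar>s * Y x\<bar>\<^sup>2"
      using Taylor_exp_field[of "s * Y x" 1] by (simp add: power2_eq_square)
    also have "\<dots> \<le> exp (\<bar>Y x\<bar> / 8) * (s\<^sup>2 * (128 * exp (\<bar>Y x\<bar> / 8)))"
    proof (rule mult_mono)
      show "\<bar>s * Y x\<bar>\<^sup>2 \<le> s\<^sup>2 * (128 * exp (\<bar>Y x\<bar> / 8))"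
        using power_le_fact_exp[of "\<bar>Y x\<bar> / 8" 2]
        by (simp add: power_mult_distrib power_divide mult_left_mono)
    qed (use sY in auto)
    also have "\<dots> = 128 * s\<^sup>2 * exp (\<bar>Y x\<bar> / 4)" by (simp add: exp_add[symmetric])
    finally show ?thesis by linarith
  qed
  have "expectation (\<lambda>x. exp (s * Y x)) \<le> expectation (\<lambda>x. 1 + s * Y x + 128 * s\<^sup>2 * exp (\<bar>Y x\<bar> / 4))"
    by (rule integral_mono[OF i1]) (use i iY b in auto)
  also have "\<dots> = 1 + 128 * s\<^sup>2 * expectation (\<lambda>x. exp (\<bar>Y x\<bar> / 4))" using i iY mean by (simp add: prob_space)
  also have "\<dots> \<le> 1 + 768 * s\<^sup>2" using mult_left_mono[OF c, of "128 * s\<^sup>2"] by simp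
  also have "\<dots> \<le> exp (768 * s\<^sup>2)" by (rule exp_ge_add_one_self)
  finally show "expectation (\<lambda>x. exp (s * Y x)) \<le> exp (768 * s\<^sup>2)" .
qed

text \<open>Moments are read off from the generating function at t and -t through y^(2p) <= (2p)!
  e^|y|. Independence multiplies the bounds of the summands to exp (768 t^2 A), so the estimate does
  not depend on \<open>n\<close>, which is what the passage to infinite series needs.\<close>

lemma even_moment_sum_le:
  fixes Y :: "nat \<Rightarrow> 'a \<Rightarrow> real"
  assumes ind: "indep_vars (\<lambda>_. borel) Y UNIV" and i: "\<And>k. integrable M (\<lambda>x. exp (\<bar>Y k x\<bar> / 4))"
    and c: "\<And>k. expectation (\<lambda>x. exp (\<bar>Y k x\<bar> / 4)) \<le> 6" and mean: "\<And>k. expectation (Y k) = 0"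
    and t: "t > 0" "\<And>k. \<bar>t * a k\<bar> \<le> 1 / 8" and A: "(\<Sum>k<n. (a k)\<^sup>2) \<le> A"
  shows "integrable M (\<lambda>x. (\<Sum>k<n. a k * Y k x) ^ (2 * p))"
    and "expectation (\<lambda>x. (\<Sum>k<n. a k * Y k x) ^ (2 * p)) \<le> fact (2 * p) / t ^ (2 * p) * (2 * exp (768 * t\<^sup>2 * A))"
proof -
  have Ym [measurable]: "Y k \<in> borel_measurable M" for k
    using ind unfolding indep_vars_def by blast
  define S where "S x = (\<Sum>k<n. a k * Y k x)" for x
  have [measurable]: "S \<in> borel_measurable M" unfolding S_def by measurable
  have mgf: "integrable M (\<lambda>x. exp (r * S x)) \<and> expectation (\<lambda>x. exp (r * S x)) \<le> exp (768 * t\<^sup>2 * A)"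
    if r: "r = t \<or> r = - t" for r
  proof -
    have r8: "\<bar>r * a k\<bar> \<le> 1 / 8" for k using r t(2)[of k] by auto
    have iv: "indep_vars (\<lambda>_. borel) (\<lambda>k x. exp (r * a k * Y k x)) {..<n}"
      by (rule indep_vars_compose2[OF indep_vars_subset[OF ind]]) auto
    note mg = mgf_le_of_exp_moment[OF Ym i c mean r8]
    have e: "exp (r * S x) = (\<Prod>k<n. exp (r * a k * Y k x))" for x
      unfolding S_def by (simp add: exp_sum[symmetric] sum_distrib_left mult.assoc)
    have "expectation (\<lambda>x. exp (r * S x)) = (\<Prod>k<n. expectation (\<lambda>x. exp (r * a k * Y k x)))"
      unfolding e by (rule indep_vars_lebesgue_integral[OF _ iv]) (use mg in auto)
    also have "\<dots> \<le> (\<Prod>k<n. exp (768 * (r * a k)\<^sup>2))"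
      by (intro prod_mono conjI mg Bochner_Integration.integral_nonneg) auto
    also have "\<dots> = exp (768 * t\<^sup>2 * (\<Sum>k<n. (a k)\<^sup>2))"
      using r by (auto simp: exp_sum[symmetric] sum_distrib_left power_mult_distrib mult.assoc)
    also have "\<dots> \<le> exp (768 * t\<^sup>2 * A)" using A by (simp add: mult_left_mono)
    finally show ?thesis unfolding e using indep_vars_integrable[OF _ iv] mg by auto
  qed
  have b: "(S x) ^ (2 * p) \<le> fact (2 * p) / t ^ (2 * p) * (exp (t * S x) + exp (- t * S x))" for x
  proof -
    have "(t * S x) ^ (2 * p) = \<bar>t * S x\<bar> ^ (2 * p)" by (simp add: power_mult)
    also have "\<dots> \<le> fact (2 * p) * exp \<bar>t * S x\<bar>" by (rule power_le_fact_exp) simp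
    also have "\<dots> \<le> fact (2 * p) * (exp (t * S x) + exp (- t * S x))"
      by (intro mult_left_mono) (auto simp: abs_if)
    finally show ?thesis using t(1) by (simp add: power_mult_distrib field_simps)
  qed
  have ib: "integrable M (\<lambda>x. fact (2 * p) / t ^ (2 * p) * (exp (t * S x) + exp (- t * S x)))"
    using mgf[of t] mgf[of "-t"] by auto
  have i2: "integrable M (\<lambda>x. (S x) ^ (2 * p))"
    by (rule Bochner_Integration.integrable_bound[OF ib]) (use b in \<open>auto simp: power_mult intro!: order_trans[OF b[unfolded power_mult]]\<close>)
  then show "integrable M (\<lambda>x. (\<Sum>k<n. a k * Y k x) ^ (2 * p))" by (simp add: S_def)
  have "expectation (\<lambda>x. (S x) ^ (2 * p)) \<le> expectation (\<lambda>x. fact (2 * p) / t ^ (2 * p) * (exp (t * S x) + exp (- t * S x)))"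
    by (rule integral_mono[OF i2 ib]) (rule b)
  also have "\<dots> = fact (2 * p) / t ^ (2 * p) * (expectation (\<lambda>x. exp (t * S x)) + expectation (\<lambda>x. exp (- t * S x)))"
    using mgf[of t] mgf[of "-t"] by simp
  also have "\<dots> \<le> fact (2 * p) / t ^ (2 * p) * (2 * exp (768 * t\<^sup>2 * A))"
    using mgf[of t] mgf[of "-t"] t(1) by (intro mult_left_mono) auto
  finally show "expectation (\<lambda>x. (\<Sum>k<n. a k * Y k x) ^ (2 * p)) \<le> fact (2 * p) / t ^ (2 * p) * (2 * exp (768 * t\<^sup>2 * A))"
    by (simp add: S_def)
qed

end

section \<open>The random series\<close>

definition eta :: "bool \<Rightarrow> nat \<Rightarrow> nat \<Rightarrow> nat \<Rightarrow> (gidx \<Rightarrow> real) \<Rightarrow> complex" where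
  "eta s i j k x = xi x s k i * cnj (xi x s k j) - (if i = j then 1 else 0)"

lemma allmom_eta: "allmom (eta s i j k)"
  unfolding eta_def[abs_def] by (intro allmom_diff allmom_mult allmom_xi allmom_cnj allmom_const)

lemma measurable_eta [measurable]: "eta s i j k \<in> borel_measurable Gauss"
  by (rule allmom_measurable[OF allmom_eta])

lemma depends_on_eta: "depends_on (eta s i j k) {XI s k l b | l b. l \<in> {i, j}}"
proof (rule depends_onI)
  fix x y assume h: "\<And>l. l \<in> {XI s k l b | l b. l \<in> {i, j}} \<Longrightarrow> x l = (y l :: real)"
  have "x (XI s k i b) = y (XI s k i b)" "x (XI s k j b) = y (XI s k j b)" for b
    using h by blast+
  then show "eta s i j k x = eta s i j k y" by (simp add: eta_def xi_def)
qed

lemma expectation_eta: "Gauss.expectation (eta s i j k) = 0"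
proof -
  have i: "integrable Gauss (\<lambda>x. xi x s k i * cnj (xi x s k j))"
    by (intro allmom_integrable allmom_mult allmom_xi allmom_cnj)
  have "Gauss.expectation (\<lambda>x. xi x s k i * cnj (xi x s k j)) = (if i = j then 1 else 0)"
  proof (cases "i = j")
    case True then show ?thesis using expectation_xi_cnj[of s k i] by simp
  next
    case False
    have "depends_on (\<lambda>x. cnj (xi x s k j)) (range (XI s k j))"
      by (rule depends_onI, rule arg_cong[where f = cnj], rule depends_onD[OF depends_on_xi]) blast
    then have "Gauss.expectation (\<lambda>x. xi x s k i * cnj (xi x s k j)) =
       Gauss.expectation (\<lambda>x. xi x s k i) * Gauss.expectation (\<lambda>x. cnj (xi x s k j))"
      using False by (intro expectation_mult_depends_on[OF _ _ depends_on_xi]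
          allmom_integrable allmom_xi allmom_cnj) auto
    then show ?thesis using False by (simp add: expectation_xi)
  qed
  then show ?thesis unfolding eta_def[abs_def] using i by (simp add: Gauss.prob_space)
qed

lemma norm_eta_le:
  "norm (eta s i j k x) \<le> 1 + ((x (XI s k i True))\<^sup>2 + (x (XI s k i False))\<^sup>2 + (x (XI s k j True))\<^sup>2 + (x (XI s k j False))\<^sup>2) / 4"
proof -
  have "norm (xi x s k i * cnj (xi x s k j)) \<le> ((norm (xi x s k i))\<^sup>2 + (norm (xi x s k j))\<^sup>2) / 2"
    using zero_le_power2[of "norm (xi x s k i) - norm (xi x s k j)"]
    by (simp add: norm_mult power2_eq_square algebra_simps)
  also have "\<dots> = ((x (XI s k i True))\<^sup>2 + (x (XI s k i False))\<^sup>2 + (x (XI s k j True))\<^sup>2 + (x (XI s k j False))\<^sup>2) / 4"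
    unfolding xi_def norm_Complex_square by (simp add: add_divide_distrib)
  finally have a: "norm (xi x s k i * cnj (xi x s k j)) \<le> \<dots>" .
  have "norm (eta s i j k x) \<le> norm (xi x s k i * cnj (xi x s k j)) + 1"
    unfolding eta_def by (rule order_trans[OF norm_triangle_ineq4]) auto
  then show ?thesis using a by linarith
qed

text \<open>A quarter of the norm is at most 1 plus the mean of four terms x^2 / 4. Convexity of exp
  and the bound 2 for each of the four exponential moments give 6 = 3 times 2, with 3 bounding
  e.\<close>

lemma eta_exp_moment:
  "integrable Gauss (\<lambda>x. exp (norm (eta s i j k x) / 4))"
  "Gauss.expectation (\<lambda>x. exp (norm (eta s i j k x) / 4)) \<le> 6"
proof -
  let ?c = "\<lambda>l b x. exp ((x (XI s k l b))\<^sup>2 / 4) :: real"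
  let ?B = "\<lambda>x. 3 * ((?c i True x + ?c i False x) / 2 + (?c j True x + ?c j False x) / 2) / 2"
  have b: "exp (norm (eta s i j k x) / 4) \<le> ?B x" for x
  proof -
    define A B C D where "A = (x (XI s k i True))\<^sup>2 / 4" and "B = (x (XI s k i False))\<^sup>2 / 4"
      and "C = (x (XI s k j True))\<^sup>2 / 4" and "D = (x (XI s k j False))\<^sup>2 / 4"
    have "norm (eta s i j k x) / 4 \<le> 1 + ((A + B) / 2 + (C + D) / 2) / 2"
      using norm_eta_le[of s i j k x] unfolding A_def B_def C_def D_def by (simp add: field_simps)
    then have "exp (norm (eta s i j k x) / 4) \<le> exp 1 * exp (((A + B) / 2 + (C + D) / 2) / 2)"
      by (simp add: exp_add[symmetric])
    also have "\<dots> \<le> 3 * (((exp A + exp B) / 2 + (exp C + exp D) / 2) / 2)"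
    proof (rule mult_mono[OF exp_le])
      have "exp (((A + B) / 2 + (C + D) / 2) / 2) \<le> (exp ((A + B) / 2) + exp ((C + D) / 2)) / 2"
        by (rule exp_mean_le)
      also have "\<dots> \<le> ((exp A + exp B) / 2 + (exp C + exp D) / 2) / 2"
        by (intro divide_right_mono add_mono exp_mean_le) simp
      finally show "exp (((A + B) / 2 + (C + D) / 2) / 2) \<le> ((exp A + exp B) / 2 + (exp C + exp D) / 2) / 2" .
    qed auto
    finally show ?thesis unfolding A_def B_def C_def D_def by simp
  qed
  have iB: "integrable Gauss ?B"
    by (intro integrable_divide integrable_mult_right Bochner_Integration.integrable_add
        integrable_divide_zero Gauss_coord_exp_square)
  show i1: "integrable Gauss (\<lambda>x. exp (norm (eta s i j k x) / 4))"
    by (rule Bochner_Integration.integrable_bound[OF iB]) (use b in \<open>auto intro!: AE_I2 order_trans[OF b]\<close>)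
  have E: "Gauss.expectation (?c l d) \<le> 2" for l d by (rule Gauss_coord_exp_square)
  have "Gauss.expectation (\<lambda>x. exp (norm (eta s i j k x) / 4)) \<le> Gauss.expectation ?B"
    by (rule integral_mono[OF i1 iB b])
  also have "\<dots> = 3 * ((Gauss.expectation (?c i True) + Gauss.expectation (?c i False)) / 2 + (Gauss.expectation (?c j True) + Gauss.expectation (?c j False)) / 2) / 2"
    by (simp add: Gauss_coord_exp_square(1))
  also have "\<dots> \<le> 3 * ((2 + 2) / 2 + (2 + 2) / 2) / 2"
    by (intro divide_right_mono mult_left_mono add_mono E) auto
  finally show "Gauss.expectation (\<lambda>x. exp (norm (eta s i j k x) / 4)) \<le> 6" by simp
qed

text \<open>Real and imaginary parts are treated alike through \<open>P\<close>, because the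
  one-series theorem and the moment bounds are for real variables. Independence in \<open>k\<close>
  holds since each level reads its own coordinates.\<close>

lemma part_eta_props:
  assumes P: "P = Re \<or> P = Im"
  shows "Gauss.indep_vars (\<lambda>_. borel) (\<lambda>k x. P (eta s i j k x)) UNIV"
    "integrable Gauss (\<lambda>x. exp (\<bar>P (eta s i j k x)\<bar> / 4))"
    "Gauss.expectation (\<lambda>x. exp (\<bar>P (eta s i j k x)\<bar> / 4)) \<le> 6"
    "Gauss.expectation (\<lambda>x. P (eta s i j k x)) = 0"
proof -
  have [measurable]: "P \<in> borel_measurable borel"
    using P by (auto intro!: borel_measurable_continuous_onI continuous_intros)
  show "Gauss.indep_vars (\<lambda>_. borel) (\<lambda>k x. P (eta s i j k x)) UNIV"
  proof (rule indep_vars_depends_on)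
    show "depends_on (\<lambda>x. P (eta s i j k x)) {XI s k l b | l b. l \<in> {i, j}}" for k
      by (rule depends_onI, rule arg_cong[where f = P], rule depends_onD[OF depends_on_eta]) blast
    show "disjoint_family (\<lambda>k. {XI s k l b |l b. l \<in> {i, j}})" by (auto simp: disjoint_family_on_def)
  qed measurable
  have le: "\<bar>P z\<bar> \<le> norm z" for z using P abs_Re_le_cmod abs_Im_le_cmod by auto
  show i: "integrable Gauss (\<lambda>x. exp (\<bar>P (eta s i j k x)\<bar> / 4))"
    by (rule Bochner_Integration.integrable_bound[OF eta_exp_moment(1)[of s i j k]]) (use le in auto)
  have "Gauss.expectation (\<lambda>x. exp (\<bar>P (eta s i j k x)\<bar> / 4)) \<le> Gauss.expectation (\<lambda>x. exp (norm (eta s i j k x) / 4))"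
    by (rule integral_mono[OF i eta_exp_moment(1)]) (use le in auto)
  then show "Gauss.expectation (\<lambda>x. exp (\<bar>P (eta s i j k x)\<bar> / 4)) \<le> 6" using eta_exp_moment(2)[of s i j k] by linarith
  have "integrable Gauss (eta s i j k)" by (rule allmom_integrable[OF allmom_eta])
  then show "Gauss.expectation (\<lambda>x. P (eta s i j k x)) = 0"
    using P expectation_eta[of s i j k] by (auto simp: integral_Re integral_Im)
qed

text \<open>The centring in \<open>eta\<close> makes square summable coefficients enough: the
  variances are summable and Kolmogorov's theorem applies to both parts.\<close>

lemma AE_summable_eta:
  assumes a: "summable (\<lambda>k. (a k)\<^sup>2)"
  shows "AE x in Gauss. summable (\<lambda>k. of_real (a k) * eta s i j k x)"
proof -
  have "AE x in Gauss. summable (\<lambda>k. a k * P (eta s i j k x))" if P: "P = Re \<or> P = Im" for P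
  proof -
    note pr = part_eta_props[OF P]
    have [measurable]: "P \<in> borel_measurable borel"
      using P by (auto intro!: borel_measurable_continuous_onI continuous_intros)
    note sq = Gauss.square_integrable_of_exp_moment[OF _ pr(2)]
    have iv: "Gauss.indep_vars (\<lambda>_. borel) (\<lambda>k x. a k * P (eta s i j k x)) UNIV"
      by (rule Gauss.indep_vars_compose2[OF pr(1)]) auto
    show ?thesis
    proof (rule Gauss.Kolmogorov_one_series[OF iv])
      show "integrable Gauss (\<lambda>x. (a k * P (eta s i j k x))\<^sup>2)" for k
        unfolding power_mult_distrib using sq by auto
      show "Gauss.expectation (\<lambda>x. a k * P (eta s i j k x)) = 0" for k using pr(4) by simp
      show "summable (\<lambda>k. Gauss.expectation (\<lambda>x. (a k * P (eta s i j k x))\<^sup>2))"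
      \<comment> \<open>The constant 192 is 32 times 6, the second moment bound for a variable whose
        exponential moment is at most 6.\<close>
      proof (rule summable_comparison_test'[where N = 0 and g = "\<lambda>k. (a k)\<^sup>2 * 192"])
        show "summable (\<lambda>k. (a k)\<^sup>2 * 192)" by (rule summable_mult2[OF a])
        fix k
        have "Gauss.expectation (\<lambda>x. (P (eta s i j k x))\<^sup>2) \<le> 192"
          using sq(2)[of s i j k] pr(3)[of s i j k] by simp
        then show "norm (Gauss.expectation (\<lambda>x. (a k * P (eta s i j k x))\<^sup>2)) \<le> (a k)\<^sup>2 * 192"
          unfolding power_mult_distrib by (simp add: abs_mult mult_left_mono)
      qed
    qed
  qed
  from this[of Re] this[of Im] have "AE x in Gauss. summable (\<lambda>k. a k * Re (eta s i j k x)) \<and> summable (\<lambda>k. a k * Im (eta s i j k x))"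
    by auto
  then show ?thesis by eventually_elim (simp add: summable_complex_iff)
qed

lemma eta_sum_moment:
  assumes a: "summable (\<lambda>k. (a k)\<^sup>2)"
  shows "\<exists>C. \<forall>s i j n. Gauss.expectation (\<lambda>x. norm (\<Sum>k<n. of_real (a k) * eta s i j k x) ^ (2 * p)) \<le> C"
proof -
  define A where "A = (\<Sum>k. (a k)\<^sup>2)"
  have An: "(\<Sum>k\<in>F. (a k)\<^sup>2) \<le> A" if "finite F" for F unfolding A_def by (rule sum_le_suminf[OF a that]) auto
  have A0: "A \<ge> 0" using An[of "{}"] by simp
  \<comment> \<open>Each |a k| is at most sqrt A, so this choice gives |t a_k| <= 1/8, the range in
    which the generating function is bounded; the summand 1 covers A = 0.\<close>
  define t where "t = 1 / (8 * (sqrt A + 1))"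
  have t0: "t > 0" unfolding t_def using A0 by (simp add: add_nonneg_pos)
  have ta: "\<bar>t * a k\<bar> \<le> 1 / 8" for k
  proof -
    have "\<bar>a k\<bar> \<le> sqrt A" using An[of "{k}"] by (simp add: real_le_rsqrt)
    then have "\<bar>a k\<bar> / (sqrt A + 1) \<le> 1" using A0 by (simp add: divide_le_eq_1 add_nonneg_pos)
    then have "1 / 8 * (\<bar>a k\<bar> / (sqrt A + 1)) \<le> 1 / 8 * 1" by (intro mult_left_mono) auto
    moreover have "\<bar>t * a k\<bar> = 1 / 8 * (\<bar>a k\<bar> / (sqrt A + 1))"
      unfolding abs_mult using t0 by (simp add: t_def)
    ultimately show ?thesis by simp
  qed
  define C where "C = fact (2 * p) / t ^ (2 * p) * (2 * exp (768 * t\<^sup>2 * A))"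
  have "Gauss.expectation (\<lambda>x. norm (\<Sum>k<n. of_real (a k) * eta s i j k x) ^ (2 * p)) \<le> 2 ^ (2 * p) * (C + C)" for s i j n
  proof -
    let ?S = "\<lambda>P x. \<Sum>k<n. a k * P (eta s i j k x)"
    have m: "integrable Gauss (\<lambda>x. (?S P x) ^ (2 * p))" "Gauss.expectation (\<lambda>x. (?S P x) ^ (2 * p)) \<le> C"
      if P: "P = Re \<or> P = Im" for P
      using Gauss.even_moment_sum_le[OF part_eta_props(1)[OF P, of s i j] part_eta_props(2-4)[OF P] t0 ta
          An[of "{..<n}"], where p = p] unfolding C_def by auto
    have "norm (\<Sum>k<n. of_real (a k) * eta s i j k x) ^ (2 * p) \<le> 2 ^ (2 * p) * (?S Re x ^ (2 * p) + ?S Im x ^ (2 * p))" for x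
    proof -
      have "norm (\<Sum>k<n. of_real (a k) * eta s i j k x) \<le> \<bar>?S Re x\<bar> + \<bar>?S Im x\<bar>"
        using cmod_le[of "\<Sum>k<n. of_real (a k) * eta s i j k x"] by simp
      then have "norm (\<Sum>k<n. of_real (a k) * eta s i j k x) ^ (2 * p) \<le> (\<bar>?S Re x\<bar> + \<bar>?S Im x\<bar>) ^ (2 * p)"
        by (intro power_mono) auto
      also have "\<dots> \<le> 2 ^ (2 * p) * (\<bar>?S Re x\<bar> ^ (2 * p) + \<bar>?S Im x\<bar> ^ (2 * p))" by (rule power_add_le_power) auto
      finally show ?thesis by (simp add: power_mult)
    qed
    then have "Gauss.expectation (\<lambda>x. norm (\<Sum>k<n. of_real (a k) * eta s i j k x) ^ (2 * p)) \<le>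
        Gauss.expectation (\<lambda>x. 2 ^ (2 * p) * (?S Re x ^ (2 * p) + ?S Im x ^ (2 * p)))"
      using m by (intro integral_mono allmom_power allmom_sum allmom_mult allmom_const allmom_eta) auto
    also have "\<dots> = 2 ^ (2 * p) * (Gauss.expectation (\<lambda>x. ?S Re x ^ (2 * p)) + Gauss.expectation (\<lambda>x. ?S Im x ^ (2 * p)))"
      using m by simp
    also have "\<dots> \<le> 2 ^ (2 * p) * (C + C)" using m by (intro mult_left_mono add_mono) auto
    finally show ?thesis .
  qed
  then show ?thesis by blast
qed

section \<open>Finite truncations of the random matrix\<close>

definition Htr :: "omega \<Rightarrow> nat \<Rightarrow> (gidx \<Rightarrow> real) \<Rightarrow> hmat" where
  "Htr w n x i j = (case w of (ap, am, g1, g2) \<Rightarrow>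
      (if i = j then of_real g1 else 0) + of_real (sqrt g2) * GUE x i j
    + (\<Sum>k<n. of_real (ap k) * eta True i j k x) - (\<Sum>k<n. of_real (am k) * eta False i j k x))"

lemma allmom_Htr: "allmom (\<lambda>x. Htr w n x i j)"
  unfolding Htr_def by (cases w) (auto intro!: allmom_add allmom_diff allmom_sum allmom_mult allmom_eta allmom_GUE)

lemma AE_Htr_tendsto:
  assumes w: "w \<in> Omega"
  shows "AE x in Gauss. \<forall>i j. (\<lambda>n. Htr w n x i j) \<longlonglongrightarrow> Hom w x i j"
proof -
  obtain ap am g1 g2 where w4: "w = (ap, am, g1, g2)" by (cases w) auto
  have s: "summable (\<lambda>i. (ap i)\<^sup>2)" "summable (\<lambda>i. (am i)\<^sup>2)" using w unfolding w4 Omega_def by auto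
  have "AE x in Gauss. \<forall>i j. summable (\<lambda>k. of_real (ap k) * eta True i j k x) \<and> summable (\<lambda>k. of_real (am k) * eta False i j k x)"
    unfolding AE_all_countable using AE_summable_eta[OF s(1)] AE_summable_eta[OF s(2)] by auto
  then show ?thesis
  proof eventually_elim
    case (elim x)
    show ?case
    proof (intro allI)
      fix i j
      have "(\<lambda>n. \<Sum>k<n. of_real (ap k) * eta True i j k x) \<longlonglongrightarrow> ssum (\<lambda>k. of_real (ap k) * eta True i j k x)"
        "(\<lambda>n. \<Sum>k<n. of_real (am k) * eta False i j k x) \<longlonglongrightarrow> ssum (\<lambda>k. of_real (am k) * eta False i j k x)"
        using elim by (auto simp: ssum_def summable_LIMSEQ)
      then show "(\<lambda>n. Htr w n x i j) \<longlonglongrightarrow> Hom w x i j"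
        unfolding Htr_def Hom_def w4 prod.case eta_def by (intro tendsto_intros)
    qed
  qed
qed

lemma GUE_moment: "\<exists>C. \<forall>i j. Gauss.expectation (\<lambda>x. norm (GUE x i j) ^ p) \<le> C"
proof -
  define m where "m = Gauss.expectation (\<lambda>x. \<bar>x (GD 0)\<bar> ^ p)"
  have me: "Gauss.expectation (\<lambda>x. \<bar>x l\<bar> ^ p) = m" for l unfolding m_def by (rule Gauss_coord_abs_power_eq)
  have m0: "m \<ge> 0" unfolding m_def by (rule Bochner_Integration.integral_nonneg) auto
  have "Gauss.expectation (\<lambda>x. norm (GUE x i j) ^ p) \<le> 2 ^ p * (m + m)" for i j
  proof -
    obtain l l' where l: "\<And>x. norm (GUE x i j) \<le> \<bar>x l\<bar> + \<bar>x l'\<bar>"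
    proof (cases "i = j")
      case True then show ?thesis using that[of "GD i" "GD i"] by (auto simp: GUE_def)
    next
      case False
      have c: "norm (Complex u v / complex_of_real (sqrt 2)) \<le> \<bar>u\<bar> + \<bar>v\<bar>" for u v
      proof -
        have "norm (Complex u v / complex_of_real (sqrt 2)) = norm (Complex u v) / sqrt 2" by (simp add: norm_divide)
        also have "\<dots> \<le> norm (Complex u v)"
          using mult_right_mono[of 1 "sqrt 2" "norm (Complex u v)"] by (simp add: pos_divide_le_eq mult.commute)
        also have "\<dots> \<le> \<bar>u\<bar> + \<bar>v\<bar>" using cmod_le[of "Complex u v"] by simp
        finally show ?thesis .
      qed
      show ?thesis
        by (rule that[of "GO (min i j) (max i j) True" "GO (min i j) (max i j) False"])
           (use False c in \<open>auto simp: GUE_def min_def max_def simp del: complex_cnj_divide simp add: complex_mod_cnj\<close>)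
    qed
    have "norm (GUE x i j) ^ p \<le> 2 ^ p * (\<bar>x l\<bar> ^ p + \<bar>x l'\<bar> ^ p)" for x
      by (rule order_trans[OF power_mono[OF l] power_add_le_power]) auto
    then have "Gauss.expectation (\<lambda>x. norm (GUE x i j) ^ p) \<le> Gauss.expectation (\<lambda>x. 2 ^ p * (\<bar>x l\<bar> ^ p + \<bar>x l'\<bar> ^ p))"
      by (intro integral_mono allmom_power allmom_GUE) (auto simp: Gauss_coord_abs_power)
    also have "\<dots> = 2 ^ p * (m + m)" by (simp add: Gauss_coord_abs_power me)
    finally show ?thesis .
  qed
  then show ?thesis by blast
qed

text \<open>A crude splitting into four summands; what matters is that one constant serves all
  positions and all truncation levels.\<close>

lemma Htr_moment:
  assumes w: "w \<in> Omega"
  shows "\<exists>C. \<forall>i j n. Gauss.expectation (\<lambda>x. norm (Htr w n x i j) ^ (2 * p)) \<le> C"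
proof -
  obtain ap am g1 g2 where w4: "w = (ap, am, g1, g2)" by (cases w) auto
  have s: "summable (\<lambda>i. (ap i)\<^sup>2)" "summable (\<lambda>i. (am i)\<^sup>2)" using w unfolding w4 Omega_def by auto
  let ?q = "2 * p"
  obtain C1 where C1: "\<And>s i j n. Gauss.expectation (\<lambda>x. norm (\<Sum>k<n. of_real (ap k) * eta s i j k x) ^ ?q) \<le> C1"
    using eta_sum_moment[OF s(1), of p] by blast
  obtain C2 where C2: "\<And>s i j n. Gauss.expectation (\<lambda>x. norm (\<Sum>k<n. of_real (am k) * eta s i j k x) ^ ?q) \<le> C2"
    using eta_sum_moment[OF s(2), of p] by blast
  obtain C3 where C3: "\<And>i j. Gauss.expectation (\<lambda>x. norm (GUE x i j) ^ ?q) \<le> C3"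
    using GUE_moment[of "2 * p"] by blast
  have "Gauss.expectation (\<lambda>x. norm (Htr w n x i j) ^ ?q) \<le>
      2 ^ ?q * (2 ^ ?q * (\<bar>g1\<bar> ^ ?q + \<bar>sqrt g2\<bar> ^ ?q * C3) + 2 ^ ?q * (C1 + C2))" for i j n
  proof -
    define a b c d where "a = (\<lambda>x::gidx \<Rightarrow> real. (if i = j then of_real g1 else 0) :: complex)"
      and "b = (\<lambda>x. of_real (sqrt g2) * GUE x i j)"
      and "c = (\<lambda>x. \<Sum>k<n. of_real (ap k) * eta True i j k x)"
      and "d = (\<lambda>x. \<Sum>k<n. of_real (am k) * eta False i j k x)"
    have am: "allmom a" "allmom b" "allmom c" "allmom d"
      unfolding a_def b_def c_def d_def by (auto intro!: allmom_sum allmom_mult allmom_eta allmom_GUE)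
    note ip = am[THEN allmom_power, of ?q]
    have "norm (Htr w n x i j) ^ ?q \<le> 2 ^ ?q * (2 ^ ?q * (norm (a x) ^ ?q + norm (b x) ^ ?q) + 2 ^ ?q * (norm (c x) ^ ?q + norm (d x) ^ ?q))" for x
    proof -
      have "Htr w n x i j = a x + b x + (c x - d x)" by (simp add: Htr_def w4 a_def b_def c_def d_def)
      moreover have "norm (a x + b x + (c x - d x)) \<le> (norm (a x) + norm (b x)) + (norm (c x) + norm (d x))"
        using norm_triangle_ineq[of "a x + b x" "c x - d x"] norm_triangle_ineq[of "a x" "b x"]
          norm_triangle_ineq4[of "c x" "d x"] by linarith
      ultimately have "norm (Htr w n x i j) \<le> (norm (a x) + norm (b x)) + (norm (c x) + norm (d x))" by simp
      then have "norm (Htr w n x i j) ^ ?q \<le> ((norm (a x) + norm (b x)) + (norm (c x) + norm (d x))) ^ ?q"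
        by (intro power_mono) auto
      also have "\<dots> \<le> 2 ^ ?q * ((norm (a x) + norm (b x)) ^ ?q + (norm (c x) + norm (d x)) ^ ?q)"
        by (rule power_add_le_power) auto
      also have "\<dots> \<le> 2 ^ ?q * (2 ^ ?q * (norm (a x) ^ ?q + norm (b x) ^ ?q) + 2 ^ ?q * (norm (c x) ^ ?q + norm (d x) ^ ?q))"
        by (intro mult_left_mono add_mono power_add_le_power) auto
      finally show ?thesis .
    qed
    then have "Gauss.expectation (\<lambda>x. norm (Htr w n x i j) ^ ?q) \<le>
      Gauss.expectation (\<lambda>x. 2 ^ ?q * (2 ^ ?q * (norm (a x) ^ ?q + norm (b x) ^ ?q) + 2 ^ ?q * (norm (c x) ^ ?q + norm (d x) ^ ?q)))"
      by (intro integral_mono allmom_power[OF allmom_Htr]) (use ip in auto)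
    also have "\<dots> = 2 ^ ?q * (2 ^ ?q * (Gauss.expectation (\<lambda>x. norm (a x) ^ ?q) + Gauss.expectation (\<lambda>x. norm (b x) ^ ?q))
        + 2 ^ ?q * (Gauss.expectation (\<lambda>x. norm (c x) ^ ?q) + Gauss.expectation (\<lambda>x. norm (d x) ^ ?q)))"
      using ip by simp
    also have "\<dots> \<le> 2 ^ ?q * (2 ^ ?q * (\<bar>g1\<bar> ^ ?q + \<bar>sqrt g2\<bar> ^ ?q * C3) + 2 ^ ?q * (C1 + C2))"
    proof (intro mult_left_mono add_mono)
      show "Gauss.expectation (\<lambda>x. norm (a x) ^ ?q) \<le> \<bar>g1\<bar> ^ ?q"
        by (auto simp: a_def Gauss.prob_space power_0_left)
      show "Gauss.expectation (\<lambda>x. norm (b x) ^ ?q) \<le> \<bar>sqrt g2\<bar> ^ ?q * C3"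
        unfolding b_def norm_mult power_mult_distrib using C3[of i j] by (simp add: mult_left_mono)
    qed (auto simp: c_def d_def C1 C2)
    finally show ?thesis .
  qed
  then show ?thesis by blast
qed

section \<open>Expected principal minors\<close>

lemma allmom_dets:
  assumes "\<And>i j. i \<in> S \<Longrightarrow> j \<in> S \<Longrightarrow> allmom (\<lambda>x. A x i j)"
  shows "allmom (\<lambda>x. dets S (A x))"
  unfolding dets_def
  by (intro allmom_sum allmom_mult allmom_const allmom_prod assms) (auto simp: permutes_in_image)

lemma depends_on_entries:
  assumes "\<And>i j. depends_on (\<lambda>x. A x i j) J"
  shows "depends_on (\<lambda>x. g (A x)) J"
proof (rule depends_onI)
  fix x y :: "gidx \<Rightarrow> real" assume "\<And>l. l \<in> J \<Longrightarrow> x l = y l"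
  then have "A x = A y" using depends_onD[OF assms] by blast
  then show "g (A x) = g (A y)" by simp
qed

text \<open>\<open>F\<close> is the signed exponential generating function of the expected principal minors.\<close>
definition detgf :: "((gidx \<Rightarrow> real) \<Rightarrow> hmat) \<Rightarrow> real fps \<Rightarrow> bool" where
  "detgf A F \<longleftrightarrow> (\<forall>S. finite S \<longrightarrow> Gauss.expectation (\<lambda>x. dets S (A x)) =
     of_real ((-1) ^ card S * fact (card S) * fps_nth F (card S)))"

text \<open>A consequence of invariance of the law of \<open>B\<close> under conjugation by diagonal unitaries.\<close>
definition torus_inv :: "((gidx \<Rightarrow> real) \<Rightarrow> hmat) \<Rightarrow> bool" where
  "torus_inv B \<longleftrightarrow> (\<forall>T f. finite T \<and> inj_on f T \<and> f ` T \<noteq> T \<longrightarrow>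
     Gauss.expectation (\<lambda>x. \<Prod>i\<in>T. B x i (f i)) = 0)"

lemma sum_Pow_card:
  fixes g :: "nat \<Rightarrow> 'a :: comm_semiring_1"
  assumes "finite S"
  shows "(\<Sum>T\<in>Pow S. g (card T)) = (\<Sum>j\<le>card S. of_nat (card S choose j) * g j)"
proof -
  have "(\<Sum>T\<in>Pow S. g (card T)) = (\<Sum>j\<in>{..card S}. \<Sum>T | T \<in> Pow S \<and> card T = j. g (card T))"
    using assms card_mono[OF assms] by (intro sum.group[symmetric]) auto
  also have "\<dots> = (\<Sum>j\<le>card S. of_nat (card S choose j) * g j)"
  proof (intro sum.cong refl)
    fix j
    have "(\<Sum>T | T \<in> Pow S \<and> card T = j. g (card T)) = (\<Sum>T | T \<subseteq> S \<and> card T = j. g j)"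
      by (intro sum.cong) auto
    then show "(\<Sum>T | T \<in> Pow S \<and> card T = j. g (card T)) = of_nat (card S choose j) * g j"
      using n_subsets[OF assms, of j] by simp
  qed
  finally show ?thesis .
qed

text \<open>Expand by rows. The property \<open>torus_inv B\<close> removes the permutations that do
  not preserve the rows taken from \<open>B\<close>, the others split into a minor of
  \<open>A\<close> and a minor of \<open>B\<close>, and independence factorises the expectation. As
  n choose j equals n! / (j! (n - j)!), the normalisation by factorials turns the sum over subsets
  into a Cauchy product.\<close>

lemma detgf_add:
  assumes A: "detgf A F" "\<And>i j. allmom (\<lambda>x. A x i j)" "\<And>i j. depends_on (\<lambda>x. A x i j) J"
    and B: "detgf B G" "\<And>i j. allmom (\<lambda>x. B x i j)" "\<And>i j. depends_on (\<lambda>x. B x i j) L" "torus_inv B"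
    and JL: "J \<inter> L = {}"
  shows "detgf (\<lambda>x i j. A x i j + B x i j) (F * G)"
  unfolding detgf_def
proof (intro allI impI)
  fix S :: "nat set" assume S: "finite S"
  let ?P = "\<lambda>T p x. \<Prod>i\<in>T. A x i (p i)"
  let ?Q = "\<lambda>T p x. \<Prod>i\<in>T. B x i (p i)"
  have iP: "allmom (?P T p)" and iQ: "allmom (?Q T p)" for T p by (intro allmom_prod A B)+
  have EPQ: "Gauss.expectation (\<lambda>x. ?P T p x * ?Q T' p x) = Gauss.expectation (?P T p) * Gauss.expectation (?Q T' p)" for T T' p
    by (rule expectation_mult_depends_on[OF allmom_integrable[OF iP] allmom_integrable[OF iQ]
          depends_on_entries[of A J "\<lambda>H. \<Prod>i\<in>T. H i (p i)", OF A(3)]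
          depends_on_entries[of B L "\<lambda>H. \<Prod>i\<in>T'. H i (p i)", OF B(3)] JL])
  have "Gauss.expectation (\<lambda>x. dets S (\<lambda>i j. A x i j + B x i j)) =
     (\<Sum>T\<in>Pow S. \<Sum>p | p permutes S. of_int (sign p) * Gauss.expectation (\<lambda>x. ?P (S - T) p x * ?Q T p x))"
    unfolding dets_add[OF S]
    by (subst Bochner_Integration.integral_sum, (auto intro!: allmom_integrable allmom_sum allmom_mult iP iQ)[],
        rule sum.cong[OF refl], subst Bochner_Integration.integral_sum)
       (auto intro!: allmom_integrable allmom_mult iP iQ)
  also have "\<dots> = (\<Sum>T\<in>Pow S. Gauss.expectation (\<lambda>x. dets (S - T) (A x)) * Gauss.expectation (\<lambda>x. dets T (B x)))"
  proof (intro sum.cong refl)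
    fix T assume "T \<in> Pow S" then have T: "T \<subseteq> S" by simp
    have fT: "finite T" using T S finite_subset by blast
    have "(\<Sum>p | p permutes S. of_int (sign p) * Gauss.expectation (\<lambda>x. ?P (S - T) p x * ?Q T p x)) =
      (\<Sum>p | p permutes S \<and> p ` T = T. of_int (sign p) * Gauss.expectation (\<lambda>x. ?P (S - T) p x * ?Q T p x))"
    proof (rule sum.mono_neutral_right)
      show "\<forall>p\<in>{p. p permutes S} - {p. p permutes S \<and> p ` T = T}.
        of_int (sign p) * Gauss.expectation (\<lambda>x. ?P (S - T) p x * ?Q T p x) = 0"
      proof
        fix p assume "p \<in> {p. p permutes S} - {p. p permutes S \<and> p ` T = T}"
        then have "p permutes S" "p ` T \<noteq> T" by auto
        then have "Gauss.expectation (?Q T p) = 0"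
          using B(4) fT unfolding torus_inv_def by (metis inj_on_subset permutes_inj subset_UNIV)
        then show "of_int (sign p) * Gauss.expectation (\<lambda>x. ?P (S - T) p x * ?Q T p x) = 0"
          unfolding EPQ by simp
      qed
    qed (use S in \<open>auto simp: finite_permutations\<close>)
    also have "\<dots> = Gauss.expectation (\<lambda>x. \<Sum>p | p permutes S \<and> p ` T = T. of_int (sign p) * (?P (S - T) p x * ?Q T p x))"
      by (subst Bochner_Integration.integral_sum) (auto intro!: allmom_integrable allmom_mult iP iQ)
    also have "\<dots> = Gauss.expectation (\<lambda>x. dets (S - T) (A x) * dets T (B x))"
      unfolding dets_mult_dets[OF S T] ..
    also have "\<dots> = Gauss.expectation (\<lambda>x. dets (S - T) (A x)) * Gauss.expectation (\<lambda>x. dets T (B x))"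
      by (rule expectation_mult_depends_on[OF _ _ depends_on_entries[OF A(3)] depends_on_entries[OF B(3)] JL])
         (auto intro!: allmom_integrable allmom_dets A B)
    finally show "(\<Sum>p | p permutes S. of_int (sign p) * Gauss.expectation (\<lambda>x. ?P (S - T) p x * ?Q T p x)) =
       Gauss.expectation (\<lambda>x. dets (S - T) (A x)) * Gauss.expectation (\<lambda>x. dets T (B x))" .
  qed
  also have "\<dots> = (\<Sum>T\<in>Pow S. of_real ((\<lambda>j. ((-1) ^ (card S - j) * fact (card S - j) * fps_nth F (card S - j)) *
      ((-1) ^ j * fact j * fps_nth G j)) (card T)))"
  proof (intro sum.cong refl)
    fix T assume "T \<in> Pow S" then have T: "T \<subseteq> S" by simp
    have fT: "finite T" using T S finite_subset by blast
    have "Gauss.expectation (\<lambda>x. dets (S - T) (A x)) =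
        of_real ((-1) ^ (card S - card T) * fact (card S - card T) * fps_nth F (card S - card T))"
      using A(1) S card_Diff_subset[OF fT T] unfolding detgf_def by simp
    moreover have "Gauss.expectation (\<lambda>x. dets T (B x)) = of_real ((-1) ^ card T * fact (card T) * fps_nth G (card T))"
      using B(1) fT unfolding detgf_def by simp
    ultimately show "Gauss.expectation (\<lambda>x. dets (S - T) (A x)) * Gauss.expectation (\<lambda>x. dets T (B x)) =
       of_real ((\<lambda>j. ((-1) ^ (card S - j) * fact (card S - j) * fps_nth F (card S - j)) *
      ((-1) ^ j * fact j * fps_nth G j)) (card T))" by (simp only: of_real_mult)
  qed
  also have "\<dots> = of_real (\<Sum>j\<le>card S. of_nat (card S choose j) * (((-1) ^ (card S - j) * fact (card S - j) * fps_nth F (card S - j)) *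
      ((-1) ^ j * fact j * fps_nth G j)))"
    unfolding sum_Pow_card[OF S, symmetric] by simp
  also have "(\<Sum>j\<le>card S. of_nat (card S choose j) * (((-1) ^ (card S - j) * fact (card S - j) * fps_nth F (card S - j)) *
      ((-1) ^ j * fact j * fps_nth G j))) = (-1) ^ card S * fact (card S) * fps_nth (F * G) (card S)"
  proof -
    have "real (card S choose j) * (((-1) ^ (card S - j) * fact (card S - j) * fps_nth F (card S - j)) *
      ((-1) ^ j * fact j * fps_nth G j)) = (-1) ^ card S * fact (card S) * (fps_nth F (card S - j) * fps_nth G j)"
      if "j \<le> card S" for j
    proof -
      have "real (card S choose j) * (fact j * fact (card S - j)) = fact (card S)"
        using binomial_fact_lemma[OF that] by (metis (no_types, lifting) mult.commute of_nat_fact of_nat_mult)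
      moreover have "(-1) ^ (card S - j) * (-1) ^ j = ((-1) ^ card S :: real)"
        using that by (simp add: power_add[symmetric])
      moreover have "real (card S choose j) * (((-1) ^ (card S - j) * fact (card S - j) * fps_nth F (card S - j)) *
        ((-1) ^ j * fact j * fps_nth G j)) = (real (card S choose j) * (fact j * fact (card S - j))) *
        ((-1) ^ (card S - j) * (-1) ^ j) * (fps_nth F (card S - j) * fps_nth G j)" by (simp only: mult_ac)
      ultimately show ?thesis by (simp only: mult.commute[of "fact (card S)"])
    qed
    then have "(\<Sum>j\<le>card S. of_nat (card S choose j) * (((-1) ^ (card S - j) * fact (card S - j) * fps_nth F (card S - j)) *
      ((-1) ^ j * fact j * fps_nth G j))) = (-1) ^ card S * fact (card S) * (\<Sum>j\<le>card S. fps_nth G j * fps_nth F (card S - j))"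
      unfolding sum_distrib_left by (intro sum.cong) (auto simp: mult.commute)
    also have "(\<Sum>j\<le>card S. fps_nth G j * fps_nth F (card S - j)) = fps_nth (F * G) (card S)"
      by (simp add: fps_mult_nth mult.commute[of F] atLeast0AtMost)
    finally show ?thesis .
  qed
  finally show "Gauss.expectation (\<lambda>x. dets S (\<lambda>i j. A x i j + B x i j)) =
     of_real ((-1) ^ card S * fact (card S) * fps_nth (F * G) (card S))" .
qed

text \<open>The series is exp (- c z), and the principal minors of size k of a scalar matrix are
  c^k.\<close>

lemma detgf_scalar:
  "detgf (\<lambda>x i j. if i = j then of_real c else 0) (Abs_fps (newton (\<lambda>j. if j = 1 then c else 0)))"
proof -
  have "newton (\<lambda>j. if j = 1 then c else 0) k = (- c) ^ k / fact k" for k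
  proof (induction k)
    case (Suc k)
    have "(\<Sum>j\<le>k. (if Suc j = 1 then c else 0) * newton (\<lambda>j. if j = 1 then c else 0) (k - j)) =
      (\<Sum>j\<in>{0}. (if Suc j = 1 then c else 0) * newton (\<lambda>j. if j = 1 then c else 0) (k - j))"
      by (rule sum.mono_neutral_right) auto
    then have r: "newton (\<lambda>j. if j = 1 then c else 0) (Suc k) =
        - (c * newton (\<lambda>j. if j = 1 then c else 0) k) / real (Suc k)"
      unfolding newton.simps(2) by simp
    show ?case unfolding r Suc by simp
  qed simp
  then have "(-1) ^ k * fact k * newton (\<lambda>j. if j = 1 then c else 0) k = c ^ k" for k
    by (simp add: power_mult_distrib[symmetric])
  then show ?thesis unfolding detgf_def by (simp add: dets_diagonal)
qed

section \<open>Rank one matrices\<close>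

definition rank1 :: "bool \<Rightarrow> nat \<Rightarrow> real \<Rightarrow> (gidx \<Rightarrow> real) \<Rightarrow> hmat" where
  "rank1 s k a x i j = of_real a * (xi x s k i * cnj (xi x s k j))"

lemma allmom_rank1: "allmom (\<lambda>x. rank1 s k a x i j)"
  unfolding rank1_def by (intro allmom_mult allmom_xi allmom_cnj allmom_const)

lemma depends_on_rank1: "depends_on (\<lambda>x. rank1 s k a x i j) {XI s k l b | l b. True}"
proof (rule depends_onI)
  fix x y :: "gidx \<Rightarrow> real" assume h: "\<And>l. l \<in> {XI s k l b | l b. True} \<Longrightarrow> x l = y l"
  have "xi x s k i = xi y s k i" for i by (rule depends_onD[OF depends_on_xi]) (use h in blast)
  then show "rank1 s k a x i j = rank1 s k a y i j" by (simp add: rank1_def)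
qed

text \<open>Regroup the product by index: an index in both \<open>T\<close> and its image
  contributes |xi|^2 with mean 1, an index in only one of them a single centred factor, and
  different indices are independent. By injectivity the two sets are equally large, so if they
  differ some index of \<open>T\<close> is missing from the image.\<close>

lemma expectation_prod_xi:
  assumes T: "finite T" and f: "inj_on f T"
  shows "Gauss.expectation (\<lambda>x. \<Prod>i\<in>T. xi x s k i * cnj (xi x s k (f i))) = (if f ` T = T then 1 else 0)"
proof -
  define U where "U = T \<union> f ` T"
  have fU: "finite U" using T by (simp add: U_def)
  define g where "g i x = (if i \<in> T then xi x s k i else 1) * (if i \<in> f ` T then cnj (xi x s k i) else 1)" for i x
  have e: "(\<Prod>i\<in>T. xi x s k i * cnj (xi x s k (f i))) = (\<Prod>i\<in>U. g i x)" for x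
  proof -
    have "(\<Prod>i\<in>U. if i \<in> T then xi x s k i else 1) = (\<Prod>i\<in>T. xi x s k i)"
      by (rule prod.mono_neutral_cong_right[OF fU]) (auto simp: U_def)
    moreover have "(\<Prod>i\<in>U. if i \<in> f ` T then cnj (xi x s k i) else 1) = (\<Prod>i\<in>f ` T. cnj (xi x s k i))"
      by (rule prod.mono_neutral_cong_right[OF fU]) (auto simp: U_def)
    moreover have "(\<Prod>i\<in>f ` T. cnj (xi x s k i)) = (\<Prod>i\<in>T. cnj (xi x s k (f i)))"
      by (simp add: prod.reindex[OF f])
    ultimately show ?thesis by (simp add: g_def prod.distrib)
  qed
  have ga: "allmom (g i)" for i unfolding g_def[abs_def]
    by (cases "i \<in> T"; cases "i \<in> f ` T") (auto intro!: allmom_mult allmom_xi allmom_cnj)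
  have iv: "Gauss.indep_vars (\<lambda>_. borel) g U"
  proof (rule indep_vars_depends_on[where L = "\<lambda>i. range (XI s k i)"])
    show "depends_on (g i) (range (XI s k i))" for i
    proof (rule depends_onI)
      fix x y :: "gidx \<Rightarrow> real" assume "\<And>l. l \<in> range (XI s k i) \<Longrightarrow> x l = y l"
      then have "xi x s k i = xi y s k i" by (rule depends_onD[OF depends_on_xi])
      then show "g i x = g i y" by (simp add: g_def)
    qed
  qed (auto simp: disjoint_family_on_def intro: allmom_measurable[OF ga])
  have E: "Gauss.expectation (\<lambda>x. \<Prod>i\<in>T. xi x s k i * cnj (xi x s k (f i))) = (\<Prod>i\<in>U. Gauss.expectation (g i))"
    unfolding e by (rule Gauss.indep_vars_lebesgue_integral[OF fU iv]) (rule allmom_integrable[OF ga])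
  show ?thesis
  proof (cases "f ` T = T")
    case True
    then have "Gauss.expectation (g i) = 1" if "i \<in> U" for i
      using that expectation_xi_cnj[of s k i] by (simp add: g_def[abs_def] U_def)
    then show ?thesis unfolding E using True by simp
  next
    case False
    have "\<not> T \<subseteq> f ` T"
    proof
      assume "T \<subseteq> f ` T"
      then have "T = f ` T" using T card_image[OF f] by (intro card_seteq) auto
      then show False using False by simp
    qed
    then obtain i where i: "i \<in> T" "i \<notin> f ` T" by auto
    then have "Gauss.expectation (g i) = 0" by (simp add: g_def[abs_def] expectation_xi)
    then have "(\<Prod>i\<in>U. Gauss.expectation (g i)) = 0" using fU i by (intro prod_zero) (auto simp: U_def intro!: bexI[of _ i])
    then show ?thesis unfolding E using False by simp
  qed
qed

lemma torus_inv_rank1: "torus_inv (rank1 s k a)"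
  unfolding torus_inv_def
proof (intro allI impI)
  fix T :: "nat set" and f assume h: "finite T \<and> inj_on f T \<and> f ` T \<noteq> T"
  have "(\<lambda>x. \<Prod>i\<in>T. rank1 s k a x i (f i)) = (\<lambda>x. of_real a ^ card T * (\<Prod>i\<in>T. xi x s k i * cnj (xi x s k (f i))))"
    unfolding rank1_def prod.distrib[of "\<lambda>i. complex_of_real a"] by simp
  then show "Gauss.expectation (\<lambda>x. \<Prod>i\<in>T. rank1 s k a x i (f i)) = 0"
    using h expectation_prod_xi[of T f s k] by simp
qed

text \<open>Composition with a fixed transposition is an involution of the permutations that
  reverses the sign.\<close>

lemma sum_sign_permutes:
  assumes T: "finite T" "card T \<ge> 2"
  shows "(\<Sum>p | p permutes T. complex_of_int (sign p)) = 0"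
proof -
  obtain a b where ab: "a \<in> T" "b \<in> T" "a \<noteq> b"
    using T by (metis card_le_Suc0_iff_eq not_less_eq_eq numeral_2_eq_2)
  let ?t = "Transposition.transpose a b"
  have pt: "?t permutes T" using ab by (simp add: permutes_swap_id)
  have "(\<Sum>p | p permutes T. complex_of_int (sign p)) = (\<Sum>p | p permutes T. - complex_of_int (sign p))"
  proof (rule sum.reindex_bij_witness[where i = "\<lambda>p. ?t \<circ> p" and j = "\<lambda>p. ?t \<circ> p"])
    fix p assume "p \<in> {p. p permutes T}"
    then have p: "p permutes T" by simp
    show "?t \<circ> (?t \<circ> p) = p" by (simp add: o_assoc)
    show "?t \<circ> p \<in> {p. p permutes T}" using permutes_compose[OF p pt] by simp
    have "sign (?t \<circ> p) = - sign p"
      using sign_compose[OF permutation_swap_id[of a b] permutes_imp_permutation[OF T(1) p]] ab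
      by (simp add: sign_swap_id)
    then show "- complex_of_int (sign (?t \<circ> p)) = complex_of_int (sign p)" by simp
  qed (auto simp: o_assoc intro: permutes_compose[OF _ pt])
  then show ?thesis by (simp add: sum_negf)
qed

text \<open>Every permutation contributes the same expectation, so the signs cancel as soon as the
  minor has size at least 2; this is the trace of the rank being one. The sizes 0 and 1 give the two
  coefficients 1 and -a.\<close>

lemma detgf_rank1: "detgf (rank1 s k a) (1 - fps_const a * fps_X)"
  unfolding detgf_def
proof (intro allI impI)
  fix S :: "nat set" assume S: "finite S"
  have "Gauss.expectation (\<lambda>x. dets S (rank1 s k a x)) =
     (\<Sum>p | p permutes S. of_int (sign p) * Gauss.expectation (\<lambda>x. \<Prod>i\<in>S. rank1 s k a x i (p i)))"
    unfolding dets_def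
    by (subst Bochner_Integration.integral_sum) (auto intro!: allmom_integrable allmom_mult allmom_prod allmom_rank1)
  also have "\<dots> = (\<Sum>p | p permutes S. of_int (sign p) * of_real a ^ card S)"
  proof (intro sum.cong refl arg_cong2[where f = "(*)"])
    fix p assume "p \<in> {p. p permutes S}"
    then have p: "p permutes S" by simp
    have "(\<lambda>x. \<Prod>i\<in>S. rank1 s k a x i (p i)) = (\<lambda>x. of_real a ^ card S * (\<Prod>i\<in>S. xi x s k i * cnj (xi x s k (p i))))"
      unfolding rank1_def prod.distrib[of "\<lambda>i. complex_of_real a"] by simp
    then show "Gauss.expectation (\<lambda>x. \<Prod>i\<in>S. rank1 s k a x i (p i)) = of_real a ^ card S"
      using expectation_prod_xi[OF S permutes_inj_on[OF p], of s k] permutes_image[OF p] by simp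
  qed
  also have "\<dots> = (\<Sum>p | p permutes S. of_int (sign p)) * of_real a ^ card S" by (simp add: sum_distrib_right)
  also have "\<dots> = of_real ((-1) ^ card S * fact (card S) * fps_nth (1 - fps_const a * fps_X) (card S))"
  proof (cases "card S \<ge> 2")
    case True
    then show ?thesis using sum_sign_permutes[OF S True] by (auto simp: fps_X_def)
  next
    case False
    then consider "card S = 0" | "card S = 1" by linarith
    then show ?thesis
    proof cases
      case 1 then show ?thesis using S by simp
    next
      case 2
      then obtain l where "S = {l}" by (auto simp: card_1_singleton_iff)
      then show ?thesis by simp
    qed
  qed
  finally show "Gauss.expectation (\<lambda>x. dets S (rank1 s k a x)) =
     of_real ((-1) ^ card S * fact (card S) * fps_nth (1 - fps_const a * fps_X) (card S))" .
qed

section \<open>The Gaussian unitary ensemble\<close>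

text \<open>The coordinates of the entry at (i, f i) occur in another factor only if that factor is
  the transposed entry, that is, if i and f i form a 2-cycle inside \<open>T\<close>. Otherwise a
  centred independent factor splits off.\<close>

lemma expectation_prod_GUE_zero:
  assumes T: "finite T" and f: "inj_on f T" and i: "i \<in> T" "\<not> (f i \<noteq> i \<and> f i \<in> T \<and> f (f i) = i)"
  shows "Gauss.expectation (\<lambda>x. \<Prod>l\<in>T. GUE x l (f l)) = 0"
proof -
  have "Gauss.expectation (\<lambda>x. \<Prod>l\<in>T. GUE x l (f l)) = Gauss.expectation (\<lambda>x. GUE x i (f i) * (\<Prod>l\<in>T - {i}. GUE x l (f l)))"
    unfolding prod.remove[OF T i(1), of "\<lambda>l. GUE x l (f l)" for x] ..
  also have "\<dots> = Gauss.expectation (\<lambda>x. GUE x i (f i)) * Gauss.expectation (\<lambda>x. \<Prod>l\<in>T - {i}. GUE x l (f l))"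
  proof (rule expectation_mult_depends_on[OF _ _ depends_on_GUE])
    show "depends_on (\<lambda>x. \<Prod>l\<in>T - {i}. GUE x l (f l)) (\<Union>l\<in>T - {i}. gue_idx l (f l))"
      by (rule depends_onI, rule prod.cong[OF refl], rule depends_onD[OF depends_on_GUE]) blast
    have "gue_idx i (f i) \<inter> gue_idx l (f l) = {}" if l: "l \<in> T" "l \<noteq> i" for l
    proof (rule ccontr)
      assume "gue_idx i (f i) \<inter> gue_idx l (f l) \<noteq> {}"
      then have "f i \<noteq> i \<and> min i (f i) = min l (f l) \<and> max i (f i) = max l (f l)"
        using l by (auto simp: gue_idx_def split: if_splits)
      then have "f i \<noteq> i" "l = f i" "f l = i" using l by (auto simp: min_def max_def split: if_splits)
      then show False using i l by auto
    qed
    then show "gue_idx i (f i) \<inter> (\<Union>l\<in>T - {i}. gue_idx l (f l)) = {}" by blast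
  qed (auto intro!: allmom_integrable allmom_GUE allmom_prod)
  finally show ?thesis by (simp add: expectation_GUE)
qed

lemma torus_inv_GUE: "torus_inv (\<lambda>x i j. of_real c * GUE x i j)"
  unfolding torus_inv_def
proof (intro allI impI)
  fix T :: "nat set" and f assume h: "finite T \<and> inj_on f T \<and> f ` T \<noteq> T"
  have "\<not> T \<subseteq> f ` T"
  proof
    assume "T \<subseteq> f ` T"
    then have "T = f ` T" using h card_image[of f T] by (intro card_seteq) auto
    then show False using h by simp
  qed
  then obtain i where i: "i \<in> T" "i \<notin> f ` T" by auto
  then have "\<not> (f i \<noteq> i \<and> f i \<in> T \<and> f (f i) = i)" by force
  then have "Gauss.expectation (\<lambda>x. \<Prod>l\<in>T. GUE x l (f l)) = 0"
    using h i expectation_prod_GUE_zero[of T f i] by blast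
  then show "Gauss.expectation (\<lambda>x. \<Prod>i\<in>T. of_real c * GUE x i (f i)) = 0" by (simp add: prod.distrib)
qed

lemma dets_pair:
  assumes "a \<noteq> b"
  shows "dets {a, b} H = H a a * H b b - H a b * H b a"
proof -
  have "dets {a, b} H = (\<Sum>c\<in>{a, b}. of_int (sign (Transposition.transpose a c)) * (\<Prod>i\<in>{a, b}. H i (Transposition.transpose a c i)))"
    unfolding dets_def using assms by (subst sum_over_permutations_insert) auto
  then show ?thesis using assms by (simp add: sign_swap_id)
qed

text \<open>In every surviving permutation \<open>a\<close> lies in a 2-cycle with some
  \<open>b\<close>. Summing over \<open>b\<close> leaves the complementary minor times the expected
  minor on \<open>{a, b}\<close>, which is 0 - 1.\<close>

lemma expectation_dets_GUE_recursion:
  assumes S: "finite S" and a: "a \<in> S"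
  shows "Gauss.expectation (\<lambda>x. dets S (GUE x)) = - (\<Sum>b\<in>S - {a}. Gauss.expectation (\<lambda>x. dets (S - {a, b}) (GUE x)))"
proof -
  define e where "e p = Gauss.expectation (\<lambda>x. \<Prod>i\<in>S. GUE x i (p i))" for p
  have "Gauss.expectation (\<lambda>x. dets S (GUE x)) = (\<Sum>p | p permutes S. of_int (sign p) * e p)"
    unfolding dets_def e_def
    by (subst Bochner_Integration.integral_sum) (auto intro!: allmom_integrable allmom_mult allmom_prod allmom_GUE)
  \<comment> \<open>The condition is stated as invariance of the pair, which also admits
    permutations fixing \<open>a\<close>; their contribution is 0. In this form the product formula
    for minors applies directly.\<close>
  also have "\<dots> = (\<Sum>p | p permutes S. \<Sum>b\<in>S - {a}. if p ` {a, b} = {a, b} then of_int (sign p) * e p else 0)"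
  proof (intro sum.cong refl)
    fix p assume "p \<in> {p. p permutes S}"
    then have p: "p permutes S" by simp
    show "of_int (sign p) * e p = (\<Sum>b\<in>S - {a}. if p ` {a, b} = {a, b} then of_int (sign p) * e p else 0)"
    proof (cases "p a \<noteq> a \<and> p (p a) = a")
      case True
      have "(p ` {a, b} = {a, b}) \<longleftrightarrow> b = p a" if "b \<in> S - {a}" for b
        using True that by (auto simp: doubleton_eq_iff)
      then have "(\<Sum>b\<in>S - {a}. if p ` {a, b} = {a, b} then of_int (sign p) * e p else 0) =
         (\<Sum>b\<in>S - {a}. if b = p a then of_int (sign p) * e p else 0)" by (intro sum.cong) auto
      also have "\<dots> = of_int (sign p) * e p" using True S a permutes_in_image[OF p, of a] by (simp add: sum.delta)
      finally show ?thesis by simp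
    next
      case False
      then have "e p = 0" unfolding e_def
        using expectation_prod_GUE_zero[OF S permutes_inj_on[OF p] a] by blast
      then show ?thesis by (simp cong: if_cong)
    qed
  qed
  also have "\<dots> = (\<Sum>b\<in>S - {a}. \<Sum>p | p permutes S. if p ` {a, b} = {a, b} then of_int (sign p) * e p else 0)"
    by (rule sum.swap)
  also have "\<dots> = (\<Sum>b\<in>S - {a}. - Gauss.expectation (\<lambda>x. dets (S - {a, b}) (GUE x)))"
  proof (intro sum.cong refl)
    fix b assume b: "b \<in> S - {a}"
    have ab: "{a, b} \<subseteq> S" "a \<noteq> b" using a b by auto
    have sp: "(\<Prod>i\<in>S. GUE x i (p i)) = (\<Prod>i\<in>S - {a, b}. GUE x i (p i)) * (\<Prod>i\<in>{a, b}. GUE x i (p i))" for x p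
      by (rule prod.subset_diff[OF ab(1) S])
    have "(\<Sum>p | p permutes S. if p ` {a, b} = {a, b} then of_int (sign p) * e p else 0) =
      (\<Sum>p | p permutes S \<and> p ` {a, b} = {a, b}. of_int (sign p) * e p)"
      using S by (simp add: sum.inter_filter[symmetric] finite_permutations)
    also have "\<dots> = Gauss.expectation (\<lambda>x. \<Sum>p | p permutes S \<and> p ` {a, b} = {a, b}. of_int (sign p) *
        ((\<Prod>i\<in>S - {a, b}. GUE x i (p i)) * (\<Prod>i\<in>{a, b}. GUE x i (p i))))"
      unfolding e_def sp
      by (subst Bochner_Integration.integral_sum) (auto intro!: allmom_integrable allmom_mult allmom_prod allmom_GUE)
    also have "\<dots> = Gauss.expectation (\<lambda>x. dets (S - {a, b}) (GUE x) * dets {a, b} (GUE x))"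
      unfolding dets_mult_dets[OF S ab(1)] ..
    also have "\<dots> = Gauss.expectation (\<lambda>x. dets (S - {a, b}) (GUE x)) * Gauss.expectation (\<lambda>x. dets {a, b} (GUE x))"
    proof (rule expectation_mult_depends_on)
      have *: "depends_on (\<lambda>x. dets T (GUE x)) (\<Union>i\<in>T. \<Union>j\<in>T. gue_idx i j)" for T
      proof (rule depends_onI)
        fix x y :: "gidx \<Rightarrow> real" assume h: "\<And>l. l \<in> (\<Union>i\<in>T. \<Union>j\<in>T. gue_idx i j) \<Longrightarrow> x l = y l"
        have "GUE x i j = GUE y i j" if "i \<in> T" "j \<in> T" for i j
          by (rule depends_onD[OF depends_on_GUE]) (use h that in blast)
        then show "dets T (GUE x) = dets T (GUE y)" unfolding dets_def
          by (intro sum.cong refl arg_cong2[where f = "(*)"] prod.cong) (auto simp: permutes_in_image)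
      qed
      show "depends_on (\<lambda>x. dets (S - {a, b}) (GUE x)) (\<Union>i\<in>S - {a, b}. \<Union>j\<in>S - {a, b}. gue_idx i j)" by (rule *)
      show "depends_on (\<lambda>x. dets {a, b} (GUE x)) (\<Union>i\<in>{a, b}. \<Union>j\<in>{a, b}. gue_idx i j)" by (rule *)
      show "(\<Union>i\<in>S - {a, b}. \<Union>j\<in>S - {a, b}. gue_idx i j) \<inter> (\<Union>i\<in>{a, b}. \<Union>j\<in>{a, b}. gue_idx i j) = {}"
        by (auto simp: gue_idx_def min_def max_def split: if_splits)
    qed (auto intro!: allmom_integrable allmom_dets allmom_GUE)
    also have "Gauss.expectation (\<lambda>x. dets {a, b} (GUE x)) = - 1"
    proof -
      have "Gauss.expectation (\<lambda>x. GUE x a a * GUE x b b) = Gauss.expectation (\<lambda>x. GUE x a a) * Gauss.expectation (\<lambda>x. GUE x b b)"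
        by (rule expectation_mult_depends_on[OF _ _ depends_on_GUE depends_on_GUE])
           (use ab in \<open>auto simp: gue_idx_def intro!: allmom_integrable allmom_GUE\<close>)
      moreover have "integrable Gauss (\<lambda>x. GUE x i j * GUE x k l)" for i j k l
        by (intro allmom_integrable allmom_mult allmom_GUE)
      ultimately show ?thesis unfolding dets_pair[OF ab(2)]
        using expectation_GUE_GUE[OF ab(2)] by (simp add: expectation_GUE)
    qed
    finally show "(\<Sum>p | p permutes S. if p ` {a, b} = {a, b} then of_int (sign p) * e p else 0) =
       - Gauss.expectation (\<lambda>x. dets (S - {a, b}) (GUE x))" by simp
  qed
  finally show ?thesis by (simp add: sum_negf)
qed

text \<open>With n = |S| the recursion reads E_n = -(n - 1) E_(n-2), as for the values of Hermite
  polynomials at 0; after scaling and division by n! it becomes the recursion \<open>N2\<close> for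
  the coefficients of exp (- g z^2 / 2).\<close>

lemma detgf_GUE:
  assumes g: "g \<ge> 0"
  shows "detgf (\<lambda>x i j. of_real (sqrt g) * GUE x i j) (Abs_fps (newton (\<lambda>j. if j = 2 then g else 0)))"
proof -
  let ?N = "newton (\<lambda>j. if j = 2 then g else 0)"
  have N1: "?N (Suc 0) = 0" by (simp add: newton.simps(2))
  have N2: "?N (Suc (Suc m)) = - (g * ?N m) / (real m + 2)" for m
  proof -
    have "(\<Sum>j\<le>Suc m. (if Suc j = 2 then g else 0) * ?N (Suc m - j)) =
      (\<Sum>j\<in>{1}. (if Suc j = 2 then g else 0) * ?N (Suc m - j))"
      by (rule sum.mono_neutral_right) auto
    then show ?thesis unfolding newton.simps(2)[of _ "Suc m"] by simp
  qed
  have main: "of_real (sqrt g) ^ card S * Gauss.expectation (\<lambda>x. dets S (GUE x)) =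
      of_real ((-1) ^ card S * fact (card S) * ?N (card S))" if "finite S" for S
    using that
  proof (induction "card S" arbitrary: S rule: less_induct)
    case less
    show ?case
    proof (cases "S = {}")
      case True then show ?thesis by (simp add: dets_def)
    next
      case False
      then obtain a where a: "a \<in> S" by auto
      note rec = expectation_dets_GUE_recursion[OF less.prems a]
      show ?thesis
      proof (cases "card S = 1")
        case True
        then have "S = {a}" using a by (auto simp: card_1_singleton_iff)
        then show ?thesis using rec N1 by simp
      next
        case F: False
        have "card S \<noteq> 0" using less.prems False by simp
        then obtain m where m: "card S = Suc (Suc m)" using F by (metis One_nat_def not0_implies_Suc)
        have IH: "of_real (sqrt g) ^ m * Gauss.expectation (\<lambda>x. dets (S - {a, b}) (GUE x)) = of_real ((-1) ^ m * fact m * ?N m)"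
          if b: "b \<in> S - {a}" for b
        proof -
          have "card (S - {a, b}) = m" using a b m less.prems by (subst card_Diff_subset) auto
          then show ?thesis using less.hyps[of "S - {a, b}"] less.prems m by simp
        qed
        have "complex_of_real (sqrt g) ^ card S * Gauss.expectation (\<lambda>x. dets S (GUE x)) =
          - of_real g * (\<Sum>b\<in>S - {a}. of_real (sqrt g) ^ m * Gauss.expectation (\<lambda>x. dets (S - {a, b}) (GUE x)))"
        proof -
          have "complex_of_real (sqrt g) * complex_of_real (sqrt g) = of_real g" using g by (simp flip: of_real_mult)
          then have "complex_of_real (sqrt g) ^ card S = of_real g * of_real (sqrt g) ^ m"
            unfolding m by (simp add: mult.assoc[symmetric])
          then show ?thesis unfolding rec by (simp add: sum_distrib_left mult.assoc sum_negf)
        qed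
        also have "\<dots> = - of_real g * (\<Sum>b\<in>S - {a}. of_real ((-1) ^ m * fact m * ?N m))"
          using IH by simp
        also have "\<dots> = of_real (- g * (real (Suc m) * ((-1) ^ m * fact m * ?N m)))"
          using a m less.prems by simp
        also have "- g * (real (Suc m) * ((-1) ^ m * fact m * ?N m)) = (-1) ^ card S * fact (card S) * ?N (card S)"
          unfolding m N2 by (simp add: field_simps)
        finally show ?thesis .
      qed
    qed
  qed
  then show ?thesis unfolding detgf_def by (simp add: dets_scale)
qed

section \<open>The truncated model\<close>

lemma detgf_add_rank1s:
  assumes A: "detgf A F" "\<And>i j. allmom (\<lambda>x. A x i j)" "\<And>i j. depends_on (\<lambda>x. A x i j) J"
    and J: "J \<inter> {XI s k l b | k l b. True} = {}"
  shows "detgf (\<lambda>x i j. A x i j + (\<Sum>k<n. rank1 s k (a k) x i j)) (F * (\<Prod>k<n. 1 - fps_const (a k) * fps_X))"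
proof (induction n)
  case 0 then show ?case using A by simp
next
  case (Suc n)
  have "detgf (\<lambda>x i j. (A x i j + (\<Sum>k<n. rank1 s k (a k) x i j)) + rank1 s n (a n) x i j)
     (F * (\<Prod>k<n. 1 - fps_const (a k) * fps_X) * (1 - fps_const (a n) * fps_X))"
  proof (rule detgf_add[OF Suc _ _ detgf_rank1 allmom_rank1 depends_on_rank1 torus_inv_rank1])
    show "allmom (\<lambda>x. A x i j + (\<Sum>k<n. rank1 s k (a k) x i j))" for i j
      by (intro allmom_add allmom_sum allmom_rank1 A)
    show "depends_on (\<lambda>x. A x i j + (\<Sum>k<n. rank1 s k (a k) x i j)) (J \<union> {XI s k l b | k l b. k < n})" for i j
    proof (rule depends_onI)
      fix x y :: "gidx \<Rightarrow> real" assume h: "\<And>l. l \<in> J \<union> {XI s k l b | k l b. k < n} \<Longrightarrow> x l = y l"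
      have "A x i j = A y i j" by (rule depends_onD[OF A(3)]) (use h in blast)
      moreover have "rank1 s k (a k) x i j = rank1 s k (a k) y i j" if "k < n" for k
        by (rule depends_onD[OF depends_on_rank1]) (use h that in blast)
      ultimately show "A x i j + (\<Sum>k<n. rank1 s k (a k) x i j) = A y i j + (\<Sum>k<n. rank1 s k (a k) y i j)" by simp
    qed
    show "(J \<union> {XI s k l b | k l b. k < n}) \<inter> {XI s n l b | l b. True} = {}" using J by blast
  qed
  then show ?case by (simp add: add.assoc mult.assoc)
qed

lemma detgf_Htr:
  assumes w: "w \<in> Omega"
  shows "detgf (Htr w n) (Abs_fps (newton (psum_trunc w n)))"
proof -
  obtain ap am g1 g2 where w4: "w = (ap, am, g1, g2)" by (cases w) auto
  have g2: "g2 \<ge> 0" using w unfolding w4 Omega_def by auto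
  \<comment> \<open>The centrings of the rank one terms are scalar matrices and are collected here;
    what remains are uncentred rank one terms, each on its own coordinates.\<close>
  define c where "c = g1 - (\<Sum>k<n. ap k) + (\<Sum>k<n. am k)"
  let ?S = "\<lambda>x::gidx \<Rightarrow> real. \<lambda>i j::nat. if i = j then complex_of_real c else 0"
  let ?B = "\<lambda>x i j. ?S x i j + of_real (sqrt g2) * GUE x i j"
  let ?C = "\<lambda>x i j. ?B x i j + (\<Sum>k<n. rank1 True k (ap k) x i j)"
  let ?D = "\<lambda>x i j. ?C x i j + (\<Sum>k<n. rank1 False k (- am k) x i j)"
  let ?J = "range GD \<union> {GO i j b | i j b. True}"
  have sub: "gue_idx i j \<subseteq> ?J" for i j by (auto simp: gue_idx_def)
  have dG: "depends_on (\<lambda>x. of_real (sqrt g2) * GUE x i j) ?J" for i j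
    by (rule depends_onI, rule arg_cong2[where f = "(*)", OF refl], rule depends_onD[OF depends_on_GUE]) (use sub in blast)
  have B: "detgf ?B (Abs_fps (newton (\<lambda>j. if j = 1 then c else 0)) * Abs_fps (newton (\<lambda>j. if j = 2 then g2 else 0)))"
    by (rule detgf_add[OF detgf_scalar _ _ detgf_GUE[OF g2] _ dG torus_inv_GUE, where J = "{}"])
       (auto intro!: allmom_mult allmom_GUE simp: depends_on_def)
  have aB: "allmom (\<lambda>x. ?B x i j)" for i j by (auto intro!: allmom_add allmom_mult allmom_GUE)
  have dB: "depends_on (\<lambda>x. ?B x i j) ?J" for i j
    by (rule depends_onI, rule arg_cong2[where f = "(+)", OF refl], rule depends_onD[OF dG]) blast
  have C: "detgf ?C (Abs_fps (newton (\<lambda>j. if j = 1 then c else 0)) * Abs_fps (newton (\<lambda>j. if j = 2 then g2 else 0)) *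
      (\<Prod>k<n. 1 - fps_const (ap k) * fps_X))"
    by (rule detgf_add_rank1s[OF B aB dB]) auto
  have aC: "allmom (\<lambda>x. ?C x i j)" for i j by (intro allmom_add[OF aB] allmom_sum allmom_rank1)
  have dC: "depends_on (\<lambda>x. ?C x i j) (?J \<union> {XI True k l b | k l b. True})" for i j
  proof (rule depends_onI)
    fix x y :: "gidx \<Rightarrow> real" assume h: "\<And>l. l \<in> ?J \<union> {XI True k l b | k l b. True} \<Longrightarrow> x l = y l"
    have "?B x i j = ?B y i j" by (rule depends_onD[OF dB[of i j]], rule h, erule UnI1)
    moreover have "rank1 True k (ap k) x i j = rank1 True k (ap k) y i j" for k
      by (rule depends_onD[OF depends_on_rank1], rule h) blast
    ultimately show "?C x i j = ?C y i j" by simp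
  qed
  have D: "detgf ?D (Abs_fps (newton (\<lambda>j. if j = 1 then c else 0)) * Abs_fps (newton (\<lambda>j. if j = 2 then g2 else 0)) *
      (\<Prod>k<n. 1 - fps_const (ap k) * fps_X) * (\<Prod>k<n. 1 - fps_const (- am k) * fps_X))"
    by (rule detgf_add_rank1s[OF C aC dC]) auto
  have "?D = Htr w n"
    unfolding Htr_def w4 eta_def rank1_def c_def
    by (auto simp: fun_eq_iff algebra_simps sum_subtractf sum.distrib sum_negf)
  moreover have "Abs_fps (newton (\<lambda>j. if j = 1 then c else 0)) * Abs_fps (newton (\<lambda>j. if j = 2 then g2 else 0)) *
      (\<Prod>k<n. 1 - fps_const (ap k) * fps_X) * (\<Prod>k<n. 1 - fps_const (- am k) * fps_X) = Abs_fps (newton (psum_trunc w n))"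
  proof -
    have "psum_trunc w n = (\<lambda>j. (if j = 1 then c else 0) + (if j = 2 then g2 else 0) + (\<Sum>k<n. ap k ^ j) + (\<Sum>k<n. (- am k) ^ j))"
      by (simp add: fun_eq_iff psum_trunc_def w4 c_def)
    then show ?thesis
      by (simp only: newton_add newton_sum[OF finite_lessThan] newton_power)
  qed
  ultimately show ?thesis using D by simp
qed

section \<open>Measurability\<close>

lemma measurable_ssum:
  assumes [measurable]: "\<And>k. f k \<in> borel_measurable M"
  shows "(\<lambda>x. ssum (\<lambda>k. f k x)) \<in> borel_measurable M"
proof -
  have "Measurable.pred M (\<lambda>x. Cauchy (\<lambda>n. \<Sum>k<n. f k x))"
    unfolding pred_def by (rule sets_Collect_Cauchy) measurable
  then have [measurable]: "Measurable.pred M (\<lambda>x. summable (\<lambda>k. f k x))"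
    unfolding summable_iff_convergent Cauchy_convergent_iff .
  show ?thesis unfolding ssum_def by measurable
qed

lemma ssum_cnj: "ssum (\<lambda>k. cnj (f k)) = cnj (ssum f)"
proof -
  have "summable (\<lambda>k. cnj (f k)) \<longleftrightarrow> summable f" unfolding summable_def by (metis complex_cnj_cnj sums_cnj)
  moreover have "summable f \<Longrightarrow> suminf (\<lambda>k. cnj (f k)) = cnj (suminf f)"
    by (metis sums_cnj sums_unique summable_sums)
  ultimately show ?thesis by (auto simp: ssum_def)
qed

lemma Hom_Herm: "Hom w x \<in> Herm"
proof -
  obtain ap am g1 g2 where w4: "w = (ap, am, g1, g2)" by (cases w) auto
  have e: "ssum (\<lambda>k. of_real (a k) * (xi x s k i * cnj (xi x s k j) - (if i = j then 1 else 0))) =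
    cnj (ssum (\<lambda>k. of_real (a k) * (xi x s k j * cnj (xi x s k i) - (if j = i then 1 else 0))))" for a s i j
    unfolding ssum_cnj[symmetric] by (intro arg_cong[where f = ssum]) (auto simp: fun_eq_iff mult.commute)
  have "Hom w x i j = cnj (Hom w x j i)" for i j
    unfolding Hom_def w4 prod.case e[of _ _ i j] GUE_hermitian[of x i j] by auto
  then show ?thesis unfolding Herm_def by blast
qed

lemma measurable_cnj [measurable]: "cnj \<in> borel_measurable borel"
  by (intro borel_measurable_continuous_onI continuous_intros)

text \<open>Parameter and Gaussian coordinates may both vary with \<open>m\<close>: a constant
  parameter gives the single model, while mixtures need joint measurability on the product of
  \<open>\<nu>\<close> with \<open>Gauss\<close>.\<close>

lemma measurable_Hom_entry:
  assumes X: "X \<in> measurable M Gauss"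
    and [measurable]: "\<And>k. (\<lambda>m. fst (W m) k) \<in> borel_measurable M" "\<And>k. (\<lambda>m. fst (snd (W m)) k) \<in> borel_measurable M"
      "(\<lambda>m. fst (snd (snd (W m)))) \<in> borel_measurable M" "(\<lambda>m. snd (snd (snd (W m)))) \<in> borel_measurable M"
  shows "(\<lambda>m. Hom (W m) (X m) i j) \<in> borel_measurable M"
proof -
  have [measurable]: "(\<lambda>m. xi (X m) s k i) \<in> borel_measurable M" "(\<lambda>m. GUE (X m) i j) \<in> borel_measurable M" for s k i j
    using measurable_compose[OF X measurable_xi] measurable_compose[OF X measurable_GUE] by auto
  have "(\<lambda>m. ssum (\<lambda>k. of_real (fst (W m) k) * (xi (X m) True k i * cnj (xi (X m) True k j) - (if i = j then 1 else 0)))) \<in> borel_measurable M"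
    by (rule measurable_ssum) measurable
  moreover have "(\<lambda>m. ssum (\<lambda>k. of_real (fst (snd (W m)) k) * (xi (X m) False k i * cnj (xi (X m) False k j) - (if i = j then 1 else 0)))) \<in> borel_measurable M"
    by (rule measurable_ssum) measurable
  ultimately show ?thesis unfolding Hom_def split_beta by measurable
qed

lemma measurable_HM_of_entries:
  assumes "\<And>i j. (\<lambda>m. f m i j) \<in> borel_measurable M" "\<And>m. m \<in> space M \<Longrightarrow> f m \<in> Herm"
  shows "f \<in> measurable M HM"
  unfolding HM_def
  by (intro measurable_restrict_space2 measurable_coordinatewise_then_product assms) (use assms in auto)

lemma measurable_Hom [measurable]: "Hom w \<in> measurable Gauss HM"
  by (intro measurable_HM_of_entries measurable_Hom_entry[where W = "\<lambda>_. w"] Hom_Herm) auto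

lemma measurable_entry_HM [measurable]: "(\<lambda>H. H i j) \<in> borel_measurable HM"
proof -
  have "(\<lambda>H::hmat. H i j) \<in> borel_measurable borel"
    by (rule measurable_compose[OF measurable_product_coordinates measurable_product_coordinates])
  then show ?thesis unfolding HM_def by (rule measurable_restrict_space1)
qed

lemma space_HM [simp]: "space HM = Herm"
  by (simp add: HM_def space_restrict_space)

lemma measurable_dets_HM [measurable]: "dets S \<in> borel_measurable HM"
  unfolding dets_def[abs_def] by measurable

lemma measurable_scoef_HM [measurable]: "(\<lambda>H. scoef H N k) \<in> borel_measurable HM"
  unfolding scoef_def by measurable

section \<open>Second moments of principal minors\<close>

text \<open>The product is at most a power of its largest factor; the 1 covers the empty
  set.\<close>

lemma prod_le_one_plus_sum_power:
  fixes a :: "'a \<Rightarrow> real"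
  assumes S: "finite S" and a: "\<And>i. i \<in> S \<Longrightarrow> a i \<ge> 0"
  shows "(\<Prod>i\<in>S. a i) \<le> 1 + (\<Sum>i\<in>S. a i ^ card S)"
proof (cases "S = {}")
  case False
  define m where "m = Max (a ` S)"
  have "m \<in> a ` S" unfolding m_def using S False by (intro Max_in) auto
  then obtain l where l: "l \<in> S" "m = a l" by blast
  have "(\<Prod>i\<in>S. a i) \<le> (\<Prod>i\<in>S. m)" by (intro prod_mono) (use a S in \<open>auto simp: m_def\<close>)
  also have "\<dots> = a l ^ card S" using l by simp
  also have "\<dots> \<le> (\<Sum>i\<in>S. a i ^ card S)" by (rule member_le_sum[OF l(1) _ S]) (use a in auto)
  finally show ?thesis by simp
qed simp

text \<open>The Cauchy-Schwarz inequality over the |S|! permutations, then separation of the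
  factors, so that moments of single entries suffice although the entries are dependent.\<close>

lemma norm_dets_square_le:
  assumes S: "finite S"
  shows "(norm (dets S H))\<^sup>2 \<le> fact (card S) * (\<Sum>p | p permutes S. 1 + (\<Sum>i\<in>S. norm (H i (p i)) ^ (2 * card S)))"
proof -
  have f: "finite {p. p permutes S}" using S by (rule finite_permutations)
  have "norm (dets S H) \<le> (\<Sum>p | p permutes S. norm (of_int (sign p) * (\<Prod>i\<in>S. H i (p i))))"
    unfolding dets_def by (rule norm_sum)
  also have "\<dots> = (\<Sum>p | p permutes S. (\<Prod>i\<in>S. norm (H i (p i))))"
    by (intro sum.cong refl) (auto simp: norm_mult prod_norm sign_def)
  finally have "(norm (dets S H))\<^sup>2 \<le> (\<Sum>p | p permutes S. (\<Prod>i\<in>S. norm (H i (p i))))\<^sup>2"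
    by (intro power_mono) auto
  also have "\<dots> \<le> (\<Sum>p | p permutes S. (\<Prod>i\<in>S. norm (H i (p i)))\<^sup>2) * card {p. p permutes S}"
    by (rule sum_squared_le_sum_of_squares)
  also have "\<dots> = fact (card S) * (\<Sum>p | p permutes S. (\<Prod>i\<in>S. (norm (H i (p i)))\<^sup>2))"
    using card_permutations[OF refl S] by (simp add: mult.commute prod_power_distrib)
  also have "\<dots> \<le> fact (card S) * (\<Sum>p | p permutes S. 1 + (\<Sum>i\<in>S. ((norm (H i (p i)))\<^sup>2) ^ card S))"
    by (intro mult_left_mono sum_mono prod_le_one_plus_sum_power S) auto
  finally show ?thesis by (simp add: power_mult)
qed

lemma dets_Htr_second_moment:
  assumes w: "w \<in> Omega"
  shows "\<exists>V. \<forall>S n. finite S \<and> card S = k \<longrightarrow> Gauss.expectation (\<lambda>x. (norm (dets S (Htr w n x)))\<^sup>2) \<le> V"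
proof -
  obtain C where C: "\<And>i j n. Gauss.expectation (\<lambda>x. norm (Htr w n x i j) ^ (2 * k)) \<le> C"
    using Htr_moment[OF w, of k] by blast
  have "Gauss.expectation (\<lambda>x. (norm (dets S (Htr w n x)))\<^sup>2) \<le> fact k * (fact k * (1 + k * C))"
    if S: "finite S" "card S = k" for S n
  proof -
    note ip = allmom_power[OF allmom_Htr]
    have "Gauss.expectation (\<lambda>x. (norm (dets S (Htr w n x)))\<^sup>2) \<le>
      Gauss.expectation (\<lambda>x. fact k * (\<Sum>p | p permutes S. 1 + (\<Sum>i\<in>S. norm (Htr w n x i (p i)) ^ (2 * k))))"
    proof (rule integral_mono)
      show "integrable Gauss (\<lambda>x. (norm (dets S (Htr w n x)))\<^sup>2)"
        by (intro allmom_power allmom_dets allmom_Htr)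
      show "integrable Gauss (\<lambda>x. fact k * (\<Sum>p | p permutes S. 1 + (\<Sum>i\<in>S. norm (Htr w n x i (p i)) ^ (2 * k))))"
        by (intro integrable_mult_right Bochner_Integration.integrable_sum Bochner_Integration.integrable_add ip) simp
    qed (use norm_dets_square_le[OF S(1)] S(2) in auto)
    also have "\<dots> = fact k * (\<Sum>p | p permutes S. 1 + (\<Sum>i\<in>S. Gauss.expectation (\<lambda>x. norm (Htr w n x i (p i)) ^ (2 * k))))"
    proof -
      have 1: "integrable Gauss (\<lambda>x. \<Sum>i\<in>S. norm (Htr w n x i (p i)) ^ (2 * k))" for p
        by (intro Bochner_Integration.integrable_sum ip)
      then have 2: "integrable Gauss (\<lambda>x. 1 + (\<Sum>i\<in>S. norm (Htr w n x i (p i)) ^ (2 * k)))" for p by simp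
      have "Gauss.expectation (\<lambda>x. 1 + (\<Sum>i\<in>S. norm (Htr w n x i (p i)) ^ (2 * k))) =
          1 + (\<Sum>i\<in>S. Gauss.expectation (\<lambda>x. norm (Htr w n x i (p i)) ^ (2 * k)))" for p
        using 1[of p] ip by (simp add: Bochner_Integration.integral_sum)
      then show ?thesis using 2 by (simp add: Bochner_Integration.integral_sum)
    qed
    also have "\<dots> \<le> fact k * (\<Sum>p | p permutes S. 1 + (\<Sum>i\<in>S. C))"
      by (intro mult_left_mono sum_mono add_left_mono C) auto
    also have "\<dots> = fact k * (fact k * (1 + k * C))"
      using card_permutations[OF S(2,1)] S by simp
    finally show ?thesis .
  qed
  then show ?thesis by blast
qed

text \<open>The entries converge almost surely, hence so do the minors, and their second moments are
  bounded in the truncation level; the expectations known for \<open>Htr\<close> therefore pass to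
  the limit.\<close>

lemma dets_Hom:
  assumes w: "w \<in> Omega" and S: "finite S"
    and V: "\<And>n. Gauss.expectation (\<lambda>x. (norm (dets S (Htr w n x)))\<^sup>2) \<le> V"
  shows "integrable Gauss (\<lambda>x. (norm (dets S (Hom w x)))\<^sup>2)" "Gauss.expectation (\<lambda>x. (norm (dets S (Hom w x)))\<^sup>2) \<le> V"
    "Gauss.expectation (\<lambda>x. dets S (Hom w x)) = of_real ((-1) ^ card S * fact (card S) * lpc w (card S))"
proof -
  have am: "allmom (\<lambda>x. dets S (Htr w n x))" for n by (intro allmom_dets allmom_Htr)
  have [measurable]: "(\<lambda>x. dets S (Hom w x)) \<in> borel_measurable Gauss"
    using measurable_compose[OF measurable_Hom measurable_dets_HM] .
  have lim: "AE x in Gauss. (\<lambda>n. dets S (Htr w n x)) \<longlonglongrightarrow> dets S (Hom w x)"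
    using AE_Htr_tendsto[OF w] by eventually_elim (auto simp: dets_def intro!: tendsto_intros)
  note * = Gauss.expectation_tendsto_of_square_bounded[OF allmom_measurable[OF am] _ allmom_power[OF am] V lim]
  show "integrable Gauss (\<lambda>x. (norm (dets S (Hom w x)))\<^sup>2)" "Gauss.expectation (\<lambda>x. (norm (dets S (Hom w x)))\<^sup>2) \<le> V"
    using * by auto
  have "(\<lambda>n. Gauss.expectation (\<lambda>x. dets S (Htr w n x))) \<longlonglongrightarrow> Gauss.expectation (\<lambda>x. dets S (Hom w x))"
    using * by auto
  then have L: "(\<lambda>n. of_real ((-1) ^ card S * fact (card S) * newton (psum_trunc w n) (card S)))
      \<longlonglongrightarrow> Gauss.expectation (\<lambda>x. dets S (Hom w x))"
    using detgf_Htr[OF w] S unfolding detgf_def by simp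
  have "(\<lambda>n. of_real ((-1) ^ card S * fact (card S) * newton (psum_trunc w n) (card S))) \<longlonglongrightarrow>
      complex_of_real ((-1) ^ card S * fact (card S) * lpc w (card S))"
    by (intro tendsto_of_real tendsto_mult tendsto_const newton_psum_trunc_tendsto w)
  then show "Gauss.expectation (\<lambda>x. dets S (Hom w x)) = of_real ((-1) ^ card S * fact (card S) * lpc w (card S))"
    by (rule LIMSEQ_unique[OF L])
qed

section \<open>Convergence of the coefficients\<close>

text \<open>An index owns its coordinates at all levels \<open>k\<close> of the series, so minors on
  disjoint index sets read disjoint coordinates. This is the dissociation of the array of
  minors.\<close>

definition sites :: "nat set \<Rightarrow> gidx set" where
  "sites S = GD ` S \<union> {GO i j b | i j b. i \<in> S \<and> j \<in> S} \<union> {XI s k i b | s k i b. i \<in> S}"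

lemma sites_disjoint: "S \<inter> T = {} \<Longrightarrow> sites S \<inter> sites T = {}"
  by (auto simp: sites_def)

lemma depends_on_dets_Hom: "depends_on (\<lambda>x. dets S (Hom w x)) (sites S)"
proof (rule depends_onI)
  fix x y :: "gidx \<Rightarrow> real" assume h: "\<And>l. l \<in> sites S \<Longrightarrow> x l = y l"
  have "xi x s k i = xi y s k i" if "i \<in> S" for s k i
    by (rule depends_onD[OF depends_on_xi], rule h) (use that in \<open>auto simp: sites_def\<close>)
  moreover have "GUE x i j = GUE y i j" if "i \<in> S" "j \<in> S" for i j
    by (rule depends_onD[OF depends_on_GUE], rule h)
       (use that in \<open>auto simp: sites_def gue_idx_def min_def max_def split: if_splits\<close>)
  ultimately have "Hom w x i j = Hom w y i j" if "i \<in> S" "j \<in> S" for i j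
    using that by (simp add: Hom_def)
  then show "dets S (Hom w x) = dets S (Hom w y)"
    unfolding dets_def by (intro sum.cong refl arg_cong2[where f = "(*)"] prod.cong) (auto simp: permutes_in_image)
qed

lemma binomial_over_power_tendsto: "(\<lambda>N. real (N choose k) / real N ^ k) \<longlonglongrightarrow> 1 / fact k"
proof -
  have "(\<lambda>N. (\<Prod>i<k. (real N - real i) / real N) / fact k) \<longlonglongrightarrow> (\<Prod>i<k. 1) / fact k"
  proof (intro tendsto_intros)
    fix i
    have "(\<lambda>N. 1 - real i / real N) \<longlonglongrightarrow> 1 - 0" by (intro tendsto_intros lim_const_over_n)
    then have "(\<lambda>N. 1 - real i / real N) \<longlonglongrightarrow> 1" by simp
    then show "(\<lambda>N. (real N - real i) / real N) \<longlonglongrightarrow> 1"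
      by (rule Lim_transform_eventually)
         (auto simp: eventually_sequentially diff_divide_distrib intro!: exI[of _ 1])
  qed auto
  then show ?thesis
    by (simp add: binomial_gbinomial gbinomial_prod_rev prod_dividef atLeast0LessThan mult.commute)
qed

text \<open>All minors of size k have the same mean \<open>c\<close>, so the centred sums fall under
  the law of large numbers, applied to real and imaginary parts. Adding the mean back contributes c
  (N choose k) / N^k, which tends to c / k!.\<close>

lemma AE_scoef_Hom_tendsto:
  assumes w: "w \<in> Omega"
  shows "AE x in Gauss. \<forall>k. (\<lambda>N. scoef (Hom w x) N k) \<longlonglongrightarrow> of_real (lpc w k)"
  unfolding AE_all_countable
proof
  fix k
  define c where "c = (-1) ^ k * fact k * lpc w k"
  obtain V where V: "\<And>S n. finite S \<Longrightarrow> card S = k \<Longrightarrow> Gauss.expectation (\<lambda>x. (norm (dets S (Htr w n x)))\<^sup>2) \<le> V"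
    using dets_Htr_second_moment[OF w, of k] by blast
  note D = dets_Hom[OF w _ V]
  have Dm [measurable]: "(\<lambda>x. dets S (Hom w x)) \<in> borel_measurable Gauss" for S
    using measurable_compose[OF measurable_Hom measurable_dets_HM] .
  have Di: "integrable Gauss (\<lambda>x. dets S (Hom w x))" if "finite S" "card S = k" for S
    by (rule Gauss.integrable_of_square_integrable[OF Dm]) (use D(1) that in auto)
  have Xlim: "AE x in Gauss. (\<lambda>N. (\<Sum>S\<in>ksub k N. P (dets S (Hom w x) - of_real c)) / real N ^ k) \<longlonglongrightarrow> 0"
    if P: "P = Re \<or> P = Im" for P
  \<comment> \<open>The law of large numbers assumes k >= 1; for k = 0 the only minor is the empty
    one, equal to its mean 1.\<close>
  proof (cases "k = 0")
    case True
    have "dets S (Hom w x) - of_real c = 0" if "S \<in> ksub k N" for S N x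
    proof -
      have "S = {}" using that True by (auto simp: ksub_def finite_subset)
      then show ?thesis using True by (simp add: dets_def c_def lpc_def)
    qed
    then show ?thesis using P by auto
  next
    case False
    have Pm [measurable]: "P \<in> borel_measurable borel"
      using P by (auto intro!: borel_measurable_continuous_onI continuous_intros)
    have Ple: "(P z)\<^sup>2 \<le> (norm z)\<^sup>2" for z
      using P abs_Re_le_cmod[of z] abs_Im_le_cmod[of z] by (auto simp: abs_le_square_iff[symmetric])
    have nle: "(norm (z - of_real c))\<^sup>2 \<le> 2 * (norm z)\<^sup>2 + 2 * c\<^sup>2" for z :: complex
    proof -
      have "(norm (z - of_real c))\<^sup>2 \<le> (norm z + \<bar>c\<bar>)\<^sup>2"
        using norm_triangle_ineq4[of z "of_real c"] by (intro power_mono) auto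
      also have "\<dots> \<le> 2 * (norm z)\<^sup>2 + 2 * c\<^sup>2"
        using zero_le_power2[of "norm z - \<bar>c\<bar>"] by (simp add: power2_eq_square algebra_simps)
      finally show ?thesis .
    qed
    let ?X = "\<lambda>S x. P (dets S (Hom w x) - of_real c)"
    have b: "(?X S x)\<^sup>2 \<le> 2 * (norm (dets S (Hom w x)))\<^sup>2 + 2 * c\<^sup>2" for S x
      by (rule order_trans[OF Ple nle])
    have sq: "integrable Gauss (\<lambda>x. (?X S x)\<^sup>2)" if "finite S" "card S = k" for S
      by (rule Bochner_Integration.integrable_bound[where f = "\<lambda>x. 2 * (norm (dets S (Hom w x)))\<^sup>2 + 2 * c\<^sup>2"])
         (use D(1)[OF that(1)] that b in auto)
    show ?thesis
    proof (rule Gauss.ustatistic_tendsto_zero[where V = "2 * V + 2 * c\<^sup>2"])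
      show "1 \<le> k" using False by simp
      show "?X S \<in> borel_measurable Gauss" for S by measurable
      fix S :: "nat set" assume S: "finite S" "card S = k"
      show "integrable Gauss (\<lambda>x. (?X S x)\<^sup>2)" by (rule sq[OF S])
      have "Gauss.expectation (\<lambda>x. (?X S x)\<^sup>2) \<le> Gauss.expectation (\<lambda>x. 2 * (norm (dets S (Hom w x)))\<^sup>2 + 2 * c\<^sup>2)"
        by (rule integral_mono[OF sq[OF S]]) (use D(1)[OF S(1)] S b in auto)
      also have "\<dots> = 2 * Gauss.expectation (\<lambda>x. (norm (dets S (Hom w x)))\<^sup>2) + 2 * c\<^sup>2" using D(1)[OF S(1)] S by simp
      also have "\<dots> \<le> 2 * V + 2 * c\<^sup>2" using D(2)[OF S(1)] S by simp
      finally show "Gauss.expectation (\<lambda>x. (?X S x)\<^sup>2) \<le> 2 * V + 2 * c\<^sup>2" .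
      fix T :: "nat set" assume T: "finite T" "card T = k" and ST: "S \<inter> T = {}"
      have dX: "depends_on (?X S) (sites S)" for S
        by (rule depends_onI, rule arg_cong[where f = "\<lambda>z. P (z - of_real c)"], rule depends_onD[OF depends_on_dets_Hom])
      have iX: "integrable Gauss (?X S)" if "finite S" "card S = k" for S
        by (rule Gauss.integrable_of_square_integrable) (use sq[OF that] in auto)
      have zero: "Gauss.expectation (?X S) = 0"
      proof -
        have "Gauss.expectation (\<lambda>x. dets S (Hom w x) - of_real c) = 0"
          using D(3)[OF S(1)] S Di[OF S] by (simp add: c_def)
        moreover have "integrable Gauss (\<lambda>x. dets S (Hom w x) - of_real c)" using Di[OF S] by simp
        ultimately show ?thesis using P integral_Re integral_Im by fastforce
      qed
      show "Gauss.expectation (\<lambda>x. ?X S x * ?X T x) = 0"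
        using expectation_mult_depends_on[OF iX[OF S] iX[OF T] dX dX sites_disjoint[OF ST]] zero by simp
    qed
  qed
  from Xlim[OF disjI1[OF refl]] Xlim[OF disjI2[OF refl]] show "AE x in Gauss. (\<lambda>N. scoef (Hom w x) N k) \<longlonglongrightarrow> of_real (lpc w k)"
  proof eventually_elim
    case (elim x)
    let ?Z = "\<lambda>N. (\<Sum>S\<in>ksub k N. dets S (Hom w x) - of_real c) / of_real (real N ^ k)"
    have "?Z \<longlonglongrightarrow> 0"
      using elim by (simp add: tendsto_complex_iff Re_divide_of_real Im_divide_of_real del: of_real_power)
    moreover have "(\<lambda>N. complex_of_real (c * (real (N choose k) / real N ^ k))) \<longlonglongrightarrow> of_real (c * (1 / fact k))"
      by (intro tendsto_intros binomial_over_power_tendsto)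
    ultimately have "(\<lambda>N. (-1) ^ k * (?Z N + of_real (c * (real (N choose k) / real N ^ k)))) \<longlonglongrightarrow> (-1) ^ k * (0 + of_real (c * (1 / fact k)))"
      by (rule tendsto_mult[OF tendsto_const tendsto_add])
    moreover have "(-1) ^ k * (?Z N + of_real (c * (real (N choose k) / real N ^ k))) = scoef (Hom w x) N k" for N
    proof -
      have "(\<Sum>S\<in>ksub k N. dets S (Hom w x) - of_real c) = (\<Sum>S\<in>ksub k N. dets S (Hom w x)) - of_nat (N choose k) * of_real c"
        using n_subsets[of "{..<N}" k] by (simp add: sum_subtractf ksub_def)
      then show ?thesis unfolding scoef_def ksub_def[symmetric] by (simp add: diff_divide_distrib ksub_def[symmetric] mult.commute)
    qed
    moreover have "(-1) ^ k * (0 + of_real (c * (1 / fact k))) = complex_of_real (lpc w k)"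
      by (simp add: c_def power_mult_distrib[symmetric] mult.assoc[symmetric])
    ultimately show ?case by simp
  qed
qed

lemma scoef_eq_0: "k > N \<Longrightarrow> scoef H N k = 0"
proof -
  assume "k > N"
  then have "\<not> (T \<subseteq> {..<N} \<and> card T = k)" for T using card_mono[of "{..<N}" T] by auto
  then have e: "{T. T \<subseteq> {..<N} \<and> card T = k} = {}" by blast
  show ?thesis unfolding scoef_def e by simp
qed

lemma scaled_det_uniform_limit:
  assumes H: "H \<in> Herm" and w: "w \<in> Omega" and lim: "\<And>k. (\<lambda>N. scoef H N k) \<longlonglongrightarrow> of_real (lpc w k)"
    and K: "compact K"
  shows "uniform_limit K (\<lambda>N. scaled_det H N) (E_LP w) sequentially"
proof (rule uniform_limit_E_LP_of_real_rooted[OF _ scaled_det_eq_sum scoef_eq_0 w lim K])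
  fix N
  have "\<exists>ls :: real list. \<forall>z. det (1\<^sub>m N - z \<cdot>\<^sub>m principal N H) = (\<Prod>l\<leftarrow>ls. 1 - z * of_real l)"
  proof (rule hermitian_det_factorization)
    show "principal N H \<in> carrier_mat N N" by (simp add: principal_def)
    show "principal N H $$ (i, j) = cnj (principal N H $$ (j, i))" if "i < N" "j < N" for i j
    proof -
      have "H i j = cnj (H j i)" using H unfolding Herm_def by blast
      then show ?thesis using that by (simp add: principal_def)
    qed
  qed
  then obtain ls :: "real list" where ls: "\<And>z. det (1\<^sub>m N - z \<cdot>\<^sub>m principal N H) = (\<Prod>l\<leftarrow>ls. 1 - z * of_real l)" by blast
  have "scaled_det H N z = (\<Prod>l\<leftarrow>map (\<lambda>l. l / real N) ls. 1 - z * of_real l)" for z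
    unfolding scaled_det_def ls by (simp add: o_def)
  then show "\<exists>ls :: real list. \<forall>z. scaled_det H N z = (\<Prod>l\<leftarrow>ls. 1 - z * of_real l)" by blast
qed

section \<open>Recovering the parameters from the coefficients\<close>

text \<open>Newton's identities solved for the last power sum; the term j = k has been separated,
  with 1 as the constant coefficient.\<close>

fun npow :: "(nat \<Rightarrow> real) \<Rightarrow> nat \<Rightarrow> real" where
  "npow a 0 = 0"
| "npow a (Suc k) = - real (Suc k) * a (Suc k) - (\<Sum>j<k. npow a (Suc j) * a (k - j))"

declare npow.simps(2) [simp del]

lemma npow_newton: "j \<ge> 1 \<Longrightarrow> npow (newton p) j = p j"
proof (induction j rule: less_induct)
  case (less j)
  obtain k where k: "j = Suc k" using less.prems by (cases j) auto
  have A: "(\<Sum>i<k. npow (newton p) (Suc i) * newton p (k - i)) = (\<Sum>i<k. p (Suc i) * newton p (k - i))"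
    using less.IH k by (intro sum.cong) auto
  have B: "real (Suc k) * newton p (Suc k) = - (\<Sum>i\<le>k. p (Suc i) * newton p (k - i))"
    unfolding newton.simps(2) by (simp add: field_simps del: of_nat_Suc)
  have C: "(\<Sum>i\<le>k. p (Suc i) * newton p (k - i)) = (\<Sum>i<k. p (Suc i) * newton p (k - i)) + p (Suc k)"
    by (simp add: lessThan_Suc_atMost[symmetric])
  show ?case unfolding k npow.simps(2)[of "newton p" k] A mult_minus_left B C by simp
qed

text \<open>If q (j + 2) is the j-th moment of a measure on the half-line t >= -c, the binomial sum
  is the integral of (t + c)^(Suc m), whose root of order Suc m tends to the right end of the
  translated support. The maximum with \<open>c\<close> makes the result 0 when there is no mass to
  the right of 0, and \<open>Suc m\<close> avoids the root of order 0.\<close>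

definition extr :: "real \<Rightarrow> (nat \<Rightarrow> real) \<Rightarrow> real" where
  "extr c q = lim (\<lambda>m. max c (root (Suc m) (\<Sum>j\<le>Suc m. real (Suc m choose j) * c ^ (Suc m - j) * q (j + 2)))) - c"

text \<open>The numbers \<open>q (j + 2)\<close> are the moments of a finite measure on the line with rightmost atom \<open>b 0\<close>;
  after a translation by \<open>c\<close> it lives on the positive half-line and the rightmost atom dominates the
  growth of the moments.\<close>
lemma extr_eq:
  fixes b d :: "nat \<Rightarrow> real"
  assumes q: "\<And>j. q (j + 2) = (if j = 0 then g else 0) + (\<Sum>i. b i ^ (j + 2)) + (\<Sum>i. (- d i) ^ (j + 2))"
    and b: "decseq b" "\<And>i. b i \<ge> 0" "summable (\<lambda>i. (b i)\<^sup>2)"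
    and d: "\<And>i. d i \<ge> 0" "\<And>i. d i \<le> c" "summable (\<lambda>i. (d i)\<^sup>2)" and g: "g \<ge> 0" and c: "c \<ge> 0"
  shows "extr c q = b 0"
proof -
  \<comment> \<open>A bound for the total mass; the summand 1 makes it positive, so that its roots
    tend to 1.\<close>
  define D where "D = g + (\<Sum>i. (b i)\<^sup>2) + (\<Sum>i. (d i)\<^sup>2) + 1"
  define Q where "Q m = (\<Sum>j\<le>m. real (m choose j) * c ^ (m - j) * q (j + 2))" for m
  have b0: "b i \<le> b 0" for i using b(1) by (simp add: decseq_def)
  have D1: "D > 0" unfolding D_def using g b d by (intro add_nonneg_pos add_nonneg_nonneg suminf_nonneg) auto
  have sb: "summable (\<lambda>i. b i ^ (j + 2))" for j by (rule summable_power_ge_2[OF b(3)]) simp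
  have sd: "summable (\<lambda>i. (- d i) ^ (j + 2))" for j by (rule summable_power_ge_2) (use d in auto)
  have bin: "(\<Sum>j\<le>m. real (m choose j) * c ^ (m - j) * t ^ (j + 2)) = t\<^sup>2 * (t + c) ^ m" for t m
    unfolding binomial_ring sum_distrib_left by (intro sum.cong) (simp_all add: power_add power2_eq_square mult_ac)
  have sbm: "summable (\<lambda>i. (b i)\<^sup>2 * (b i + c) ^ m)" and sdm: "summable (\<lambda>i. (d i)\<^sup>2 * (c - d i) ^ m)" for m
  proof -
    have "summable (\<lambda>i. \<Sum>j\<le>m. real (m choose j) * c ^ (m - j) * b i ^ (j + 2))"
      by (intro summable_sum summable_mult sb)
    then show "summable (\<lambda>i. (b i)\<^sup>2 * (b i + c) ^ m)" unfolding bin .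
    have "summable (\<lambda>i. \<Sum>j\<le>m. real (m choose j) * c ^ (m - j) * (- d i) ^ (j + 2))"
      by (intro summable_sum summable_mult sd)
    then show "summable (\<lambda>i. (d i)\<^sup>2 * (c - d i) ^ m)" unfolding bin by simp
  qed
  have Qe: "Q m = g * c ^ m + (\<Sum>i. (b i)\<^sup>2 * (b i + c) ^ m) + (\<Sum>i. (d i)\<^sup>2 * (c - d i) ^ m)" for m
  proof -
    have "Q m = (\<Sum>j\<le>m. real (m choose j) * c ^ (m - j) * (if j = 0 then g else 0)) +
       (\<Sum>j\<le>m. \<Sum>i. real (m choose j) * c ^ (m - j) * b i ^ (j + 2)) +
       (\<Sum>j\<le>m. \<Sum>i. real (m choose j) * c ^ (m - j) * (- d i) ^ (j + 2))"
      unfolding Q_def q suminf_mult[OF sb] suminf_mult[OF sd] sum.distrib[symmetric]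
      by (simp add: distrib_left)
    also have "(\<Sum>j\<le>m. real (m choose j) * c ^ (m - j) * (if j = 0 then g else 0)) =
       (\<Sum>j\<in>{0}. real (m choose j) * c ^ (m - j) * (if j = 0 then g else 0))"
      by (rule sum.mono_neutral_right) auto
    also have "(\<Sum>j\<le>m. \<Sum>i. real (m choose j) * c ^ (m - j) * b i ^ (j + 2)) = (\<Sum>i. (b i)\<^sup>2 * (b i + c) ^ m)"
    proof -
      have "(\<Sum>i. \<Sum>j\<le>m. real (m choose j) * c ^ (m - j) * b i ^ (j + 2)) = (\<Sum>j\<le>m. \<Sum>i. real (m choose j) * c ^ (m - j) * b i ^ (j + 2))"
        by (rule suminf_sum) (rule summable_mult[OF sb])
      then show ?thesis unfolding bin by (rule sym)
    qed
    also have "(\<Sum>j\<le>m. \<Sum>i. real (m choose j) * c ^ (m - j) * (- d i) ^ (j + 2)) = (\<Sum>i. (d i)\<^sup>2 * (c - d i) ^ m)"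
    proof -
      have "(\<Sum>i. \<Sum>j\<le>m. real (m choose j) * c ^ (m - j) * (- d i) ^ (j + 2)) = (\<Sum>j\<le>m. \<Sum>i. real (m choose j) * c ^ (m - j) * (- d i) ^ (j + 2))"
        by (rule suminf_sum) (rule summable_mult[OF sd])
      then show ?thesis unfolding bin power2_minus uminus_add_conv_diff by (rule sym)
    qed
    finally show ?thesis by simp
  qed
  have up: "Q m \<le> D * (b 0 + c) ^ m" for m
  proof -
    have "(\<Sum>i. (b i)\<^sup>2 * (b i + c) ^ m) \<le> (\<Sum>i. (b i)\<^sup>2 * (b 0 + c) ^ m)"
      by (intro suminf_le sbm summable_mult2 b(3) mult_left_mono power_mono) (use b0 b c in \<open>auto intro: add_nonneg_nonneg\<close>)
    moreover have "(\<Sum>i. (d i)\<^sup>2 * (c - d i) ^ m) \<le> (\<Sum>i. (d i)\<^sup>2 * (b 0 + c) ^ m)"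
      by (intro suminf_le sdm summable_mult2 d(3) mult_left_mono power_mono)
         (use d b(2)[of 0] in \<open>auto simp: add_increasing\<close>)
    moreover have "g * c ^ m \<le> g * (b 0 + c) ^ m" using g c b(2)[of 0] by (intro mult_left_mono power_mono) auto
    moreover have "0 \<le> (b 0 + c) ^ m" using b(2)[of 0] c by simp
    ultimately have "Q m \<le> (g + (\<Sum>i. (b i)\<^sup>2) + (\<Sum>i. (d i)\<^sup>2) + 1) * (b 0 + c) ^ m"
      unfolding Qe distrib_right suminf_mult2[OF b(3)] suminf_mult2[OF d(3)] by linarith
    then show ?thesis by (simp add: D_def)
  qed
  \<comment> \<open>The first atom at b 0 alone, of weight (b 0)^2; the other contributions are
    nonnegative because d i <= c.\<close>
  have low: "(b 0)\<^sup>2 * (b 0 + c) ^ m \<le> Q m" for m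
  proof -
    have "(\<Sum>i\<in>{0}. (b i)\<^sup>2 * (b i + c) ^ m) \<le> (\<Sum>i. (b i)\<^sup>2 * (b i + c) ^ m)"
      by (rule sum_le_suminf[OF sbm]) (use b c in auto)
    moreover have "0 \<le> (\<Sum>i. (d i)\<^sup>2 * (c - d i) ^ m)" by (rule suminf_nonneg[OF sdm]) (use d in auto)
    moreover have "0 \<le> g * c ^ m" using g c by simp
    ultimately show ?thesis unfolding Qe by simp
  qed
  have bc: "b 0 + c \<ge> 0" using b(2)[of 0] c by simp
  have rl: "(\<lambda>m. root (Suc m) t) \<longlonglongrightarrow> 1" if "t > 0" for t
    using LIMSEQ_Suc[OF LIMSEQ_root_const[OF that]] .
  have rp: "root (Suc m) (t * (b 0 + c) ^ Suc m) = root (Suc m) t * (b 0 + c)" for t m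
    using bc by (simp add: real_root_mult real_root_power_cancel del: power_Suc)
  have "(\<lambda>m. max c (root (Suc m) (Q (Suc m)))) \<longlonglongrightarrow> b 0 + c"
  proof (rule tendsto_sandwich)
    show "\<forall>\<^sub>F m in sequentially. max c (root (Suc m) ((b 0)\<^sup>2) * (b 0 + c)) \<le> max c (root (Suc m) (Q (Suc m)))"
      using low by (intro always_eventually allI max.mono order_refl) (simp add: rp[symmetric] del: power_Suc)
    show "\<forall>\<^sub>F m in sequentially. max c (root (Suc m) (Q (Suc m))) \<le> max c (root (Suc m) D * (b 0 + c))"
      using up by (intro always_eventually allI max.mono order_refl) (simp add: rp[symmetric] del: power_Suc)
    show "(\<lambda>m. max c (root (Suc m) ((b 0)\<^sup>2) * (b 0 + c))) \<longlonglongrightarrow> b 0 + c"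
    \<comment> \<open>For b 0 = 0 the lower bound is the constant \<open>c\<close>, which is then
      the limit; otherwise the roots of the weight of the rightmost atom tend to 1.\<close>
    proof (cases "b 0 = 0")
      case True then show ?thesis using c by simp
    next
      case False
      then have "(\<lambda>m. max c (root (Suc m) ((b 0)\<^sup>2) * (b 0 + c))) \<longlonglongrightarrow> max c (1 * (b 0 + c))"
        by (intro tendsto_intros rl) simp
      then show ?thesis using b(2)[of 0] by simp
    qed
    have U: "(\<lambda>m. max c (root (Suc m) D * (b 0 + c))) \<longlonglongrightarrow> max c (1 * (b 0 + c))"
      by (intro tendsto_intros rl D1)
    then show "(\<lambda>m. max c (root (Suc m) D * (b 0 + c))) \<longlonglongrightarrow> b 0 + c"
      using b(2)[of 0] by simp
  qed
  then have "lim (\<lambda>m. max c (root (Suc m) (Q (Suc m)))) = b 0 + c" by (rule limI)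
  then show ?thesis unfolding extr_def Q_def by simp
qed

fun peel :: "real \<Rightarrow> (nat \<Rightarrow> real) \<Rightarrow> nat \<Rightarrow> real" where
  "peel c p k = extr c (\<lambda>j. p j - (\<Sum>i<k. peel c p i ^ j))"

declare peel.simps [simp del]

text \<open>Subtracting the powers of the first \<open>k\<close> values from the power sums leaves
  those of the sequence shifted by \<open>k\<close>, with the same \<open>d\<close>,
  \<open>g\<close> and \<open>c\<close>. One term is subtracted per step, so repeated values are
  returned with their multiplicity.\<close>

lemma peel_eq:
  fixes b d :: "nat \<Rightarrow> real"
  assumes q: "\<And>j. p (j + 2) = (if j = 0 then g else 0) + (\<Sum>i. b i ^ (j + 2)) + (\<Sum>i. (- d i) ^ (j + 2))"
    and b: "decseq b" "\<And>i. b i \<ge> 0" "summable (\<lambda>i. (b i)\<^sup>2)"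
    and d: "\<And>i. d i \<ge> 0" "\<And>i. d i \<le> c" "summable (\<lambda>i. (d i)\<^sup>2)" and g: "g \<ge> 0" and c: "c \<ge> 0"
  shows "peel c p k = b k"
proof (induction k rule: less_induct)
  case (less k)
  have "extr c (\<lambda>j. p j - (\<Sum>i<k. peel c p i ^ j)) = (\<lambda>i. b (i + k)) 0"
  proof (rule extr_eq[OF _ _ _ _ d g c])
    fix j
    have "(\<Sum>i<k. peel c p i ^ (j + 2)) = (\<Sum>i<k. b i ^ (j + 2))" using less by (intro sum.cong) auto
    moreover have "(\<Sum>i. b (i + k) ^ (j + 2)) = (\<Sum>i. b i ^ (j + 2)) - (\<Sum>i<k. b i ^ (j + 2))"
      by (rule suminf_minus_initial_segment) (rule summable_power_ge_2[OF b(3)], simp)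
    ultimately show "p (j + 2) - (\<Sum>i<k. peel c p i ^ (j + 2)) =
      (if j = 0 then g else 0) + (\<Sum>i. b (i + k) ^ (j + 2)) + (\<Sum>i. (- d i) ^ (j + 2))"
      unfolding q by simp
  next
    show "decseq (\<lambda>i. b (i + k))" using b(1) by (simp add: decseq_def)
    show "summable (\<lambda>i. (b (i + k))\<^sup>2)" using b(3) by (rule summable_ignore_initial_segment)
  qed (use b in auto)
  then show ?case by (subst peel.simps) simp
qed

text \<open>The square root of \<delta> = p 2 bounds every \<alpha>, so it serves as the
  translation. Replacing p j by (-1)^j p j reflects the line and exchanges the two sequences; g2 is
  what the squares leave of \<delta>.\<close>

definition omega_of :: "(nat \<Rightarrow> real) \<Rightarrow> omega" where
  "omega_of a = (let p = npow a; c = sqrt (p 2); ap = peel c p; am = peel c (\<lambda>j. (-1) ^ j * p j) in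
     (ap, am, p 1, p 2 - (\<Sum>i. (ap i)\<^sup>2) - (\<Sum>i. (am i)\<^sup>2)))"

lemma omega_of_lpc:
  assumes w: "w \<in> Omega"
  shows "omega_of (lpc w) = w"
proof -
  obtain ap am g1 g2 where w4: "w = (ap, am, g1, g2)" by (cases w) auto
  have s: "summable (\<lambda>i. (ap i)\<^sup>2)" "summable (\<lambda>i. (am i)\<^sup>2)" and g2: "g2 \<ge> 0"
    and dec: "decseq ap" "decseq am" and nn: "\<And>i. ap i \<ge> 0" "\<And>i. am i \<ge> 0"
    using w unfolding w4 Omega_def by auto
  define p where "p = npow (lpc w)"
  have pj: "p j = psum w j" if "j \<ge> 1" for j
    unfolding p_def lpc_def[abs_def] by (rule npow_newton[OF that])
  have p1: "p 1 = g1" using pj[of 1] by (simp add: psum_def w4)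
  have p2: "p 2 = g2 + (\<Sum>i. (ap i)\<^sup>2) + (\<Sum>i. (am i)\<^sup>2)" using pj[of 2] by (simp add: psum_def w4 omega_delta_def)
  have pq: "p (j + 2) = (if j = 0 then g2 else 0) + (\<Sum>i. ap i ^ (j + 2)) + (\<Sum>i. (- am i) ^ (j + 2))" for j
  proof (cases "j = 0")
    case True show ?thesis unfolding True add_0 p2 by simp
  next
    case False then show ?thesis using pj[of "j + 2"] by (simp add: psum_def w4)
  qed
  define c where "c = sqrt (p 2)"
  have pos: "0 \<le> (\<Sum>i. (ap i)\<^sup>2)" "0 \<le> (\<Sum>i. (am i)\<^sup>2)" using s by (auto intro: suminf_nonneg)
  have c0: "c \<ge> 0" unfolding c_def p2 using pos g2 by simp
  have le: "x i \<le> c" if "summable (\<lambda>i. (x i)\<^sup>2)" "(\<Sum>i. (x i)\<^sup>2) \<le> p 2" for x :: "nat \<Rightarrow> real" and i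
    unfolding c_def by (rule real_le_rsqrt) (use sum_le_suminf[OF that(1), of "{i}"] that(2) in auto)
  have A: "peel c p = ap"
    by (rule ext, rule peel_eq[OF pq dec(1) nn(1) s(1) nn(2) _ s(2) g2 c0]) (use le[OF s(2)] p2 pos g2 in auto)
  have B: "peel c (\<lambda>j. (-1) ^ j * p j) = am"
  proof (rule ext, rule peel_eq[OF _ dec(2) nn(2) s(2) nn(1) _ s(1) g2 c0])
    fix j
    have e: "(\<Sum>i. (- x i) ^ (j + 2)) = (-1) ^ (j + 2) * (\<Sum>i. x i ^ (j + 2))"
      if "summable (\<lambda>i. (x i)\<^sup>2)" for x :: "nat \<Rightarrow> real"
    proof -
      have sx: "summable (\<lambda>i. x i ^ (j + 2))" by (rule summable_power_ge_2[OF that]) simp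
      have "(- x i) ^ (j + 2) = (-1) ^ (j + 2) * x i ^ (j + 2)" for i by (rule power_minus)
      then show ?thesis by (simp only: suminf_mult[OF sx])
    qed
    have m: "(-1) ^ (j + 2) * ((-1) ^ (j + 2) * t) = t" for t :: real by (simp add: mult.assoc[symmetric] power_mult_distrib[symmetric])
    show "(-1) ^ (j + 2) * p (j + 2) = (if j = 0 then g2 else 0) + (\<Sum>i. am i ^ (j + 2)) + (\<Sum>i. (- ap i) ^ (j + 2))"
      unfolding pq e[OF s(1)] e[OF s(2)] distrib_left m by simp
  qed (use le[OF s(1)] p2 pos g2 in auto)
  show ?thesis unfolding omega_of_def Let_def p_def[symmetric] c_def[symmetric] A B using p1 p2 by (simp add: w4)
qed

section \<open>Measurability of the parameters\<close>

lemma measurable_npow: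
  assumes [measurable]: "\<And>k. (\<lambda>x. a x k) \<in> borel_measurable M"
  shows "(\<lambda>x. npow (a x) k) \<in> borel_measurable M"
proof (induction k rule: less_induct)
  case (less k)
  show ?case
  proof (cases k)
    case (Suc m)
    have [measurable]: "(\<lambda>x. npow (a x) (Suc j)) \<in> borel_measurable M" if "j \<in> {..<m}" for j using less Suc that by auto
    show ?thesis unfolding Suc npow.simps(2)[of "a x" m for x] by measurable
  qed simp
qed

lemma measurable_newton:
  assumes "\<And>k. k \<ge> 1 \<Longrightarrow> (\<lambda>x. p x k) \<in> borel_measurable M"
  shows "(\<lambda>x. newton (p x) k :: real) \<in> borel_measurable M"
proof (induction k rule: less_induct)
  case (less k)
  show ?case
  proof (cases k)
    case (Suc m)
    show ?thesis unfolding Suc newton.simps(2) using less Suc assms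
      by (intro borel_measurable_divide borel_measurable_uminus borel_measurable_sum borel_measurable_times) auto
  qed simp
qed

lemma measurable_extr:
  assumes [measurable]: "\<And>k. (\<lambda>x. q x k) \<in> borel_measurable M" "c \<in> borel_measurable M"
  shows "(\<lambda>x. extr (c x) (q x)) \<in> borel_measurable M"
proof -
  have [measurable]: "root n \<in> borel_measurable borel" for n
    by (intro borel_measurable_continuous_onI continuous_on_real_root continuous_on_id)
  show ?thesis unfolding extr_def by measurable
qed

lemma measurable_peel:
  assumes [measurable]: "\<And>k. (\<lambda>x. p x k) \<in> borel_measurable M" "c \<in> borel_measurable M"
  shows "(\<lambda>x. peel (c x) (p x) k) \<in> borel_measurable M"
proof (induction k rule: less_induct)
  case (less k)
  have [measurable]: "(\<lambda>x. peel (c x) (p x) j) \<in> borel_measurable M" if "j \<in> {..<k}" for j using less that by auto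
  have "(\<lambda>x. extr (c x) (\<lambda>j. p x j - (\<Sum>i<k. peel (c x) (p x) i ^ j))) \<in> borel_measurable M"
    by (rule measurable_extr) measurable
  then show ?case by (subst peel.simps)
qed

lemma measurable_omega_of:
  assumes a: "\<And>k. (\<lambda>x. a x k) \<in> borel_measurable M"
  shows "(\<lambda>x. fst (omega_of (a x)) k) \<in> borel_measurable M"
    "(\<lambda>x. fst (snd (omega_of (a x))) k) \<in> borel_measurable M"
    "(\<lambda>x. fst (snd (snd (omega_of (a x))))) \<in> borel_measurable M"
    "(\<lambda>x. snd (snd (snd (omega_of (a x))))) \<in> borel_measurable M"
proof -
  note [measurable] = measurable_npow[OF a]
  have [measurable]: "(\<lambda>x. peel (sqrt (npow (a x) 2)) (npow (a x)) k) \<in> borel_measurable M" for k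
    by (rule measurable_peel) measurable
  have [measurable]: "(\<lambda>x. peel (sqrt (npow (a x) 2)) (\<lambda>j. (-1) ^ j * npow (a x) j) k) \<in> borel_measurable M" for k
    by (rule measurable_peel) measurable
  show "(\<lambda>x. fst (omega_of (a x)) k) \<in> borel_measurable M"
    "(\<lambda>x. fst (snd (omega_of (a x))) k) \<in> borel_measurable M"
    "(\<lambda>x. fst (snd (snd (omega_of (a x))))) \<in> borel_measurable M"
    "(\<lambda>x. snd (snd (snd (omega_of (a x))))) \<in> borel_measurable M"
    unfolding omega_of_def Let_def fst_conv snd_conv by measurable
qed

section \<open>The Borel structure of \<open>Omega\<close>\<close>

lemma space_OmegaM [simp]: "space OmegaM = Omega"
  by (simp add: OmegaM_def)

text \<open>The topology of \<open>Omega\<close> has \<delta> rather than g2 among its coordinates;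
  g2 is recovered as \<delta> minus two series of squares, which is measurable though not
  continuous.\<close>

lemma measurable_OmegaM_coords:
  "(\<lambda>w. fst w k) \<in> borel_measurable OmegaM" "(\<lambda>w. fst (snd w) k) \<in> borel_measurable OmegaM"
  "(\<lambda>w. fst (snd (snd w))) \<in> borel_measurable OmegaM" "(\<lambda>w. snd (snd (snd w))) \<in> borel_measurable OmegaM"
proof -
  have C: "omega_coords \<in> measurable OmegaM borel"
    unfolding OmegaM_def by (rule measurable_vimage_algebra1) simp

  have a: "fst (omega_coords w) = fst w" "fst (snd (omega_coords w)) = fst (snd w)"
    "fst (snd (snd (omega_coords w))) = fst (snd (snd w))" "snd (snd (snd (omega_coords w))) = omega_delta w" for w
    by (auto simp: omega_coords_def split: prod.splits)
  have c1: "(\<lambda>w. fst (omega_coords w)) \<in> borel_measurable OmegaM"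
    and c2: "(\<lambda>w. snd (omega_coords w)) \<in> borel_measurable OmegaM"
    by (auto intro!: measurable_compose[OF C] borel_measurable_continuous_onI continuous_on_fst continuous_on_snd continuous_on_id)
  have c3: "(\<lambda>w. fst (snd (omega_coords w))) \<in> borel_measurable OmegaM"
    and c4: "(\<lambda>w. snd (snd (omega_coords w))) \<in> borel_measurable OmegaM"
    by (auto intro!: measurable_compose[OF c2] borel_measurable_continuous_onI continuous_on_fst continuous_on_snd continuous_on_id)
  have c5: "(\<lambda>w. fst (snd (snd (omega_coords w)))) \<in> borel_measurable OmegaM"
    and c6: "(\<lambda>w. snd (snd (snd (omega_coords w)))) \<in> borel_measurable OmegaM"
    by (auto intro!: measurable_compose[OF c4] borel_measurable_continuous_onI continuous_on_fst continuous_on_snd continuous_on_id)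
  show m1: "(\<lambda>w. fst w k) \<in> borel_measurable OmegaM" for k
    using measurable_compose[OF c1 measurable_product_coordinates[of k]] unfolding a .
  show m2: "(\<lambda>w. fst (snd w) k) \<in> borel_measurable OmegaM" for k
    using measurable_compose[OF c3 measurable_product_coordinates[of k]] unfolding a .
  show m3: "(\<lambda>w. fst (snd (snd w))) \<in> borel_measurable OmegaM" using c5 unfolding a .
  note [measurable] = m1 m2 c6[unfolded a]
  have "(\<lambda>w. omega_delta w - (\<Sum>i. (fst w i)\<^sup>2) - (\<Sum>i. (fst (snd w) i)\<^sup>2)) \<in> borel_measurable OmegaM" by measurable
  also have "(\<lambda>w. omega_delta w - (\<Sum>i. (fst w i)\<^sup>2) - (\<Sum>i. (fst (snd w) i)\<^sup>2)) = (\<lambda>w. snd (snd (snd w)))"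
    by (auto simp: fun_eq_iff omega_delta_def split: prod.splits)
  finally show "(\<lambda>w. snd (snd (snd w))) \<in> borel_measurable OmegaM" .
qed

lemma measurable_into_OmegaM:
  assumes [measurable]: "\<And>k. (\<lambda>m. fst (W m) k) \<in> borel_measurable M" "\<And>k. (\<lambda>m. fst (snd (W m)) k) \<in> borel_measurable M"
      "(\<lambda>m. fst (snd (snd (W m)))) \<in> borel_measurable M" "(\<lambda>m. snd (snd (snd (W m)))) \<in> borel_measurable M"
    and W: "\<And>m. m \<in> space M \<Longrightarrow> W m \<in> Omega"
  shows "W \<in> measurable M OmegaM"
  unfolding OmegaM_def
proof (rule measurable_vimage_algebra2)
  show "W \<in> space M \<rightarrow> Omega" using W by auto
  have "(\<lambda>m. (fst (W m), fst (snd (W m)), fst (snd (snd (W m))),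
      snd (snd (snd (W m))) + (\<Sum>i. (fst (W m) i)\<^sup>2) + (\<Sum>i. (fst (snd (W m)) i)\<^sup>2))) \<in> borel_measurable M"
    by (intro borel_measurable_Pair measurable_coordinatewise_then_product) measurable
  also have "(\<lambda>m. (fst (W m), fst (snd (W m)), fst (snd (snd (W m))),
      snd (snd (snd (W m))) + (\<Sum>i. (fst (W m) i)\<^sup>2) + (\<Sum>i. (fst (snd (W m)) i)\<^sup>2))) = (\<lambda>m. omega_coords (W m))"
    by (auto simp: fun_eq_iff omega_coords_def omega_delta_def split: prod.splits)
  finally show "(\<lambda>m. omega_coords (W m)) \<in> borel_measurable M" .
qed

lemma measurable_pred_Omega:
  assumes [measurable]: "\<And>k. (\<lambda>m. fst (W m) k) \<in> borel_measurable M" "\<And>k. (\<lambda>m. fst (snd (W m)) k) \<in> borel_measurable M"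
      "(\<lambda>m. fst (snd (snd (W m)))) \<in> borel_measurable M" "(\<lambda>m. snd (snd (snd (W m)))) \<in> borel_measurable M"
  shows "Measurable.pred M (\<lambda>m. W m \<in> Omega)"
proof -
  have S: "Measurable.pred M (\<lambda>m. summable (\<lambda>i. f m i))" if [measurable]: "\<And>k. (\<lambda>m. f m k) \<in> borel_measurable M"
    for f :: "_ \<Rightarrow> nat \<Rightarrow> real"
  proof -
    have "Measurable.pred M (\<lambda>m. Cauchy (\<lambda>n. \<Sum>k<n. f m k))"
      unfolding pred_def by (rule sets_Collect_Cauchy) measurable
    then show ?thesis unfolding summable_iff_convergent Cauchy_convergent_iff .
  qed
  have [measurable]: "Measurable.pred M (\<lambda>m. summable (\<lambda>i. (fst (W m) i)\<^sup>2))"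
    "Measurable.pred M (\<lambda>m. summable (\<lambda>i. (fst (snd (W m)) i)\<^sup>2))"
    by (rule S, measurable)+
  have e: "W m \<in> Omega \<longleftrightarrow> (\<forall>n. fst (W m) (Suc n) \<le> fst (W m) n) \<and> (\<forall>i. fst (W m) i \<ge> 0) \<and>
     (\<forall>n. fst (snd (W m)) (Suc n) \<le> fst (snd (W m)) n) \<and> (\<forall>i. fst (snd (W m)) i \<ge> 0) \<and>
     summable (\<lambda>i. (fst (W m) i)\<^sup>2) \<and> summable (\<lambda>i. (fst (snd (W m)) i)\<^sup>2) \<and> snd (snd (snd (W m))) \<ge> 0" for m
    by (auto simp: Omega_def decseq_Suc_iff split: prod.splits)
  show ?thesis unfolding e by measurable
qed

lemma measurable_lpc: 
  assumes [measurable]: "\<And>k. (\<lambda>m. fst (W m) k) \<in> borel_measurable M" "\<And>k. (\<lambda>m. fst (snd (W m)) k) \<in> borel_measurable M"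
      "(\<lambda>m. fst (snd (snd (W m)))) \<in> borel_measurable M" "(\<lambda>m. snd (snd (snd (W m)))) \<in> borel_measurable M"
  shows "(\<lambda>m. lpc (W m) k) \<in> borel_measurable M"
  unfolding lpc_def
proof (rule measurable_newton)
  fix j
  show "(\<lambda>m. psum (W m) j) \<in> borel_measurable M"
    unfolding psum_def omega_delta_def split_beta by measurable
qed

section \<open>Joint characteristic functions of standard Gaussians\<close>

lemma real_distribution_stdn: "real_distribution stdn"
  by (simp add: real_distribution_def real_distribution_axioms_def prob_space_stdn)

context prob_space
begin

text \<open>The signed weight \<open>g\<close> is replaced by the positive weight 2 + g and
  normalised to a probability density. Under it \<open>Z\<close> still has the Gaussian
  characteristic function, so Levy's uniqueness theorem gives its law; the constant part 2 is then
  subtracted, by the same argument with weight 2 + 0.\<close>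

lemma expectation_indicator_of_char:
  fixes Z g :: "'a \<Rightarrow> real"
  assumes [measurable]: "Z \<in> borel_measurable M" "g \<in> borel_measurable M" and g1: "\<And>x. \<bar>g x\<bar> \<le> 1"
    and Z: "\<And>s. expectation (\<lambda>x. iexp (s * Z x)) = of_real (exp (- s\<^sup>2 / 2))"
    and gZ: "\<And>s. expectation (\<lambda>x. of_real (g x) * iexp (s * Z x)) = of_real (c * exp (- s\<^sup>2 / 2))"
    and B [measurable]: "B \<in> sets borel"
  shows "expectation (\<lambda>x. g x * indicator B (Z x)) = c * measure stdn B"
proof -
  have key: "expectation (\<lambda>x. (2 + h x) * indicator B (Z x)) = (2 + d) * measure stdn B"
    if [measurable]: "h \<in> borel_measurable M" and h1: "\<And>x. \<bar>h x\<bar> \<le> 1"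
      and hZ: "\<And>s. expectation (\<lambda>x. of_real (h x) * iexp (s * Z x)) = of_real (d * exp (- s\<^sup>2 / 2))" for h d
  proof -
    have ih: "integrable M h" by (rule integrable_const_bound[where B = 1]) (use h1 in auto)
    have "complex_of_real (expectation h) = of_real d"
      using hZ[of 0] by simp
    then have d: "expectation h = d" by (simp only: of_real_eq_iff)
    have "- 1 \<le> expectation h"
      using integral_mono[of M "\<lambda>x. - 1" h] ih h1 by (simp add: abs_le_iff prob_space minus_le_iff)
    then have d2: "2 + d > 0" using d by simp
    define f where "f x = (2 + h x) / (2 + d)" for x
    have [measurable]: "f \<in> borel_measurable M" unfolding f_def by measurable
    have f0: "f x \<ge> 0" for x unfolding f_def using h1[of x] d2 by (simp add: abs_le_iff)
    have if': "integrable M f" unfolding f_def using ih by simp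
    define D where "D = density M f"
    have D1: "prob_space D"
    proof
      have "emeasure D (space D) = (\<integral>\<^sup>+x. ennreal (f x) \<partial>M)"
        by (auto simp: D_def emeasure_density intro!: nn_integral_cong)
      also have "\<dots> = ennreal (expectation f)" by (rule nn_integral_eq_integral[OF if']) (use f0 in auto)
      also have "expectation f = 1" unfolding f_def using ih d d2 by (simp add: prob_space)
      finally show "emeasure D (space D) = 1" by simp
    qed
    have Zm: "Z \<in> borel_measurable D" unfolding D_def by simp
    have rd: "real_distribution (distr D borel Z)"
      unfolding real_distribution_def real_distribution_axioms_def
      using prob_space.prob_space_distr[OF D1 Zm] by simp
    have ie [measurable]: "iexp \<in> borel_measurable borel"
      by (intro borel_measurable_continuous_onI continuous_intros)
    have "char (distr D borel Z) s = of_real (exp (- s\<^sup>2 / 2))" for s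
    proof -
      have "char (distr D borel Z) s = (\<integral>x. iexp (s * Z x) \<partial>D)"
        unfolding char_def by (rule integral_distr[OF Zm]) simp
      also have "\<dots> = expectation (\<lambda>x. f x *\<^sub>R iexp (s * Z x))"
        unfolding D_def by (rule integral_density) (use f0 in auto)
      also have "\<dots> = expectation (\<lambda>x. (2 * iexp (s * Z x) + of_real (h x) * iexp (s * Z x)) / of_real (2 + d))"
        by (rule Bochner_Integration.integral_cong) (auto simp: f_def scaleR_conv_of_real field_simps)
      also have "\<dots> = (2 * expectation (\<lambda>x. iexp (s * Z x)) + expectation (\<lambda>x. of_real (h x) * iexp (s * Z x))) / of_real (2 + d)"
      proof -
        have i1: "integrable M (\<lambda>x. iexp (s * Z x))" by (rule integrable_const_bound[where B = 1]) auto
        have i2: "integrable M (\<lambda>x. of_real (h x) * iexp (s * Z x))"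
          by (rule integrable_const_bound[where B = 1]) (use h1 in \<open>auto simp: norm_mult\<close>)
        show ?thesis using i1 i2 by simp
      qed
      also have "\<dots> = of_real (exp (- s\<^sup>2 / 2))"
      proof -
        have "complex_of_real (2 + d) \<noteq> 0" using d2 by (simp only: of_real_eq_0_iff)
        then show ?thesis unfolding Z hZ by (simp add: field_simps)
      qed
      finally show ?thesis .
    qed
    then have "char (distr D borel Z) = char stdn" unfolding char_std_normal_distribution by auto
    then have e: "distr D borel Z = stdn" by (rule Levy_uniqueness[OF rd real_distribution_stdn])
    have "measure stdn B = measure D (Z -` B \<inter> space D)" unfolding e[symmetric] by (rule measure_distr[OF Zm B])
    also have "\<dots> = (\<integral>x. indicator B (Z x) \<partial>D)"
    proof -
      have "(\<integral>x. (indicator B (Z x) :: real) \<partial>D) = (\<integral>x. indicator (Z -` B \<inter> space D) x \<partial>D)"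
        by (rule Bochner_Integration.integral_cong) (auto simp: indicator_def)
      then show ?thesis by simp
    qed
    also have "\<dots> = expectation (\<lambda>x. f x *\<^sub>R indicator B (Z x))"
      unfolding D_def by (rule integral_density) (use f0 in auto)
    also have "\<dots> = expectation (\<lambda>x. (2 + h x) * indicator B (Z x)) / (2 + d)"
      unfolding f_def by simp
    finally show ?thesis using d2 by (simp add: field_simps)
  qed
  have "expectation (\<lambda>x. (2 + g x) * indicator B (Z x)) = (2 + c) * measure stdn B"
    by (rule key) (use g1 gZ in auto)
  moreover have "expectation (\<lambda>x. (2 + 0) * indicator B (Z x)) = (2 + 0) * measure stdn B"
    by (rule key) auto
  moreover have "expectation (\<lambda>x. (2 + g x) * indicator B (Z x)) =
     expectation (\<lambda>x. (2 + 0) * indicator B (Z x)) + expectation (\<lambda>x. g x * indicator B (Z x))"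
  proof -
    have i1: "integrable M (\<lambda>x. indicator B (Z x) :: real)"
      by (rule integrable_const_bound[where B = 1]) (auto simp: indicator_def)
    have i2: "integrable M (\<lambda>x. g x * indicator B (Z x))"
      by (rule integrable_const_bound[where B = 1]) (use g1 in \<open>auto simp: indicator_def\<close>)
    have "(2 + g x) * indicator B (Z x) = (2 + 0) * indicator B (Z x) + g x * indicator B (Z x)" for x
      by (simp add: distrib_right)
    then show ?thesis using i1 i2 by simp
  qed
  ultimately show ?thesis by (simp add: algebra_simps)
qed

text \<open>The coordinates are moved one at a time from the Fourier side (\<open>J\<close>) to the event side (\<open>K\<close>).\<close>
lemma prod_indicator_char:
  fixes Z :: "'i \<Rightarrow> 'a \<Rightarrow> real"
  assumes m [measurable]: "\<And>a. Z a \<in> borel_measurable M"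
    and char: "\<And>J t. finite J \<Longrightarrow> expectation (\<lambda>x. iexp (\<Sum>a\<in>J. t a * Z a x)) = of_real (exp (- (\<Sum>a\<in>J. (t a)\<^sup>2) / 2))"
    and A [measurable]: "\<And>a. A a \<in> sets borel" and K: "finite K"
  shows "finite J \<Longrightarrow> J \<inter> K = {} \<Longrightarrow>
    expectation (\<lambda>x. of_real (\<Prod>a\<in>K. indicator (A a) (Z a x)) * iexp (\<Sum>a\<in>J. t a * Z a x)) =
    of_real ((\<Prod>a\<in>K. measure stdn (A a)) * exp (- (\<Sum>a\<in>J. (t a)\<^sup>2) / 2))"
  using K
proof (induction K arbitrary: J t rule: finite_induct)
  case empty
  then show ?case using char[of J t] by simp
next
  case (insert b K)
  define Y where "Y x = (\<Prod>a\<in>K. indicator (A a) (Z a x) :: real)" for x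
  define th where "th x = (\<Sum>a\<in>J. t a * Z a x)" for x
  define C where "C = (\<Prod>a\<in>K. measure stdn (A a)) * exp (- (\<Sum>a\<in>J. (t a)\<^sup>2) / 2)"
  have [measurable]: "Y \<in> borel_measurable M" "th \<in> borel_measurable M" unfolding Y_def th_def by measurable
  have Y01: "0 \<le> Y x" "Y x \<le> 1" for x unfolding Y_def by (auto intro!: prod_nonneg prod_le_1 simp: indicator_def)
  have bJ: "b \<notin> J" "J \<inter> K = {}" "b \<notin> K" using insert by auto
  have Zb: "expectation (\<lambda>x. iexp (s * Z b x)) = of_real (exp (- s\<^sup>2 / 2))" for s
    using char[of "{b}" "\<lambda>_. s"] by simp
  have ie [measurable]: "iexp \<in> borel_measurable borel"
    by (intro borel_measurable_continuous_onI continuous_intros)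
  \<comment> \<open>The frequencies on \<open>J\<close> are taken with both signs \<open>r\<close>,
    because the sum and the difference of the two exponentials recover the real weights Y cos th and
    Y sin th, to which the one-variable lemma applies.\<close>
  have P: "expectation (\<lambda>x. of_real (Y x) * iexp (r * th x + s * Z b x)) = of_real (C * exp (- s\<^sup>2 / 2))"
    if r: "r\<^sup>2 = 1" for r s
  proof -
    define t' where "t' a = (if a = b then s else r * t a)" for a
    have S1: "(\<Sum>a\<in>insert b J. t' a * Z a x) = r * th x + s * Z b x" for x
    proof -
      have "(\<Sum>a\<in>J. t' a * Z a x) = (\<Sum>a\<in>J. r * (t a * Z a x))"
        using bJ by (intro sum.cong) (auto simp: t'_def)
      then show ?thesis using bJ insert.prems by (simp add: t'_def th_def sum_distrib_left)
    qed
    have S2: "(\<Sum>a\<in>insert b J. (t' a)\<^sup>2) = (\<Sum>a\<in>J. (t a)\<^sup>2) + s\<^sup>2"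
    proof -
      have "(\<Sum>a\<in>J. (t' a)\<^sup>2) = (\<Sum>a\<in>J. (t a)\<^sup>2)"
        using bJ r by (intro sum.cong) (auto simp: t'_def power_mult_distrib)
      then show ?thesis using bJ insert.prems by (simp add: t'_def)
    qed
    have S3: "expectation (\<lambda>x. of_real (Y x) * iexp (\<Sum>a\<in>insert b J. t' a * Z a x)) =
        of_real ((\<Prod>a\<in>K. measure stdn (A a)) * exp (- (\<Sum>a\<in>insert b J. (t' a)\<^sup>2) / 2))"
      unfolding Y_def by (rule insert.IH) (use insert.prems bJ in auto)
    have S4: "exp (- ((\<Sum>a\<in>J. (t a)\<^sup>2) + s\<^sup>2) / 2) = exp (- (\<Sum>a\<in>J. (t a)\<^sup>2) / 2) * exp (- s\<^sup>2 / 2)"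
      by (subst exp_add[symmetric]) (simp add: diff_divide_distrib)
    show ?thesis using S3 unfolding S1 S2 S4 C_def by (simp only: mult.assoc)
  qed
  have iY: "integrable M (\<lambda>x. complex_of_real (Y x) * iexp (r * th x + s * Z b x))" for r s
    by (rule integrable_const_bound[where B = 1]) (use Y01 in \<open>auto simp: norm_mult\<close>)
  have cs: "complex_of_real (Y x * cos (th x)) * iexp (s * Z b x) =
      (of_real (Y x) * iexp (1 * th x + s * Z b x) + of_real (Y x) * iexp ((- 1) * th x + s * Z b x)) / 2"
    and sn: "complex_of_real (Y x * sin (th x)) * iexp (s * Z b x) =
      (of_real (Y x) * iexp (1 * th x + s * Z b x) - of_real (Y x) * iexp ((- 1) * th x + s * Z b x)) / (2 * \<i>)" for s x
  proof -
    have e: "iexp (r * th x + s * Z b x) = iexp (r * th x) * iexp (s * Z b x)" for r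
      by (simp add: exp_add[symmetric] distrib_left)
    have p: "iexp (1 * th x) = of_real (cos (th x)) + \<i> * of_real (sin (th x))"
      "iexp ((- 1) * th x) = of_real (cos (th x)) - \<i> * of_real (sin (th x))"
      by (auto simp: complex_eq_iff Re_exp Im_exp)
    show "complex_of_real (Y x * cos (th x)) * iexp (s * Z b x) =
      (of_real (Y x) * iexp (1 * th x + s * Z b x) + of_real (Y x) * iexp ((- 1) * th x + s * Z b x)) / 2"
      unfolding e p by (simp add: algebra_simps)
    show "complex_of_real (Y x * sin (th x)) * iexp (s * Z b x) =
      (of_real (Y x) * iexp (1 * th x + s * Z b x) - of_real (Y x) * iexp ((- 1) * th x + s * Z b x)) / (2 * \<i>)"
      unfolding e p by (simp add: algebra_simps)
  qed
  have ab: "\<bar>Y x * cos (th x)\<bar> \<le> 1" "\<bar>Y x * sin (th x)\<bar> \<le> 1" for x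
    using Y01[of x] mult_le_one[of "\<bar>Y x\<bar>" "\<bar>cos (th x)\<bar>"] mult_le_one[of "\<bar>Y x\<bar>" "\<bar>sin (th x)\<bar>"]
    by (auto simp: abs_mult)
  have E1: "expectation (\<lambda>x. (Y x * cos (th x)) * indicator (A b) (Z b x)) = C * measure stdn (A b)"
  proof (rule expectation_indicator_of_char[OF _ _ ab(1) Zb])
    show "expectation (\<lambda>x. complex_of_real (Y x * cos (th x)) * iexp (s * Z b x)) = of_real (C * exp (- s\<^sup>2 / 2))" for s
      unfolding cs using P[of 1 s] P[of "- 1" s] iY[of 1 s] iY[of "- 1" s] by simp
  qed auto
  have E2: "expectation (\<lambda>x. (Y x * sin (th x)) * indicator (A b) (Z b x)) = 0 * measure stdn (A b)"
  proof (rule expectation_indicator_of_char[OF _ _ ab(2) Zb])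
    show "expectation (\<lambda>x. complex_of_real (Y x * sin (th x)) * iexp (s * Z b x)) = of_real (0 * exp (- s\<^sup>2 / 2))" for s
      unfolding sn using P[of 1 s] P[of "- 1" s] iY[of 1 s] iY[of "- 1" s] by simp
  qed auto
  have sp: "complex_of_real (\<Prod>a\<in>insert b K. indicator (A a) (Z a x)) * iexp (\<Sum>a\<in>J. t a * Z a x) =
     of_real (Y x * cos (th x) * indicator (A b) (Z b x)) + \<i> * of_real (Y x * sin (th x) * indicator (A b) (Z b x))" for x
  proof -
    have "(\<Prod>a\<in>insert b K. indicator (A a) (Z a x) :: real) = indicator (A b) (Z b x) * Y x"
      unfolding Y_def using insert.hyps by simp
    moreover have "iexp (th x) = of_real (cos (th x)) + \<i> * of_real (sin (th x))"
      by (auto simp: complex_eq_iff Re_exp Im_exp)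
    ultimately show ?thesis unfolding th_def[symmetric] by (simp add: algebra_simps)
  qed
  have i: "integrable M (\<lambda>x. Y x * cos (th x) * indicator (A b) (Z b x))" "integrable M (\<lambda>x. Y x * sin (th x) * indicator (A b) (Z b x))"
    by (rule integrable_const_bound[where B = 1], use ab in \<open>auto simp: indicator_def\<close>)+
  have "expectation (\<lambda>x. complex_of_real (\<Prod>a\<in>insert b K. indicator (A a) (Z a x)) * iexp (\<Sum>a\<in>J. t a * Z a x)) =
     of_real (expectation (\<lambda>x. Y x * cos (th x) * indicator (A b) (Z b x))) + \<i> * of_real (expectation (\<lambda>x. Y x * sin (th x) * indicator (A b) (Z b x)))"
    unfolding sp using i by (simp del: of_real_mult)
  also have "\<dots> = of_real (C * measure stdn (A b))" unfolding E1 E2 by simp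
  also have "C * measure stdn (A b) = (\<Prod>a\<in>insert b K. measure stdn (A a)) * exp (- (\<Sum>a\<in>J. (t a)\<^sup>2) / 2)"
    unfolding C_def using insert.hyps by simp
  finally show ?case .
qed

text \<open>With no frequencies left, the preceding lemma gives the probabilities of
  finite-dimensional boxes, which determine the product measure.\<close>

lemma distr_eq_Gauss_of_char:
  fixes Z :: "gidx \<Rightarrow> 'a \<Rightarrow> real"
  assumes m [measurable]: "\<And>a. Z a \<in> borel_measurable M"
    and char: "\<And>J t. finite J \<Longrightarrow> expectation (\<lambda>x. iexp (\<Sum>a\<in>J. t a * Z a x)) = of_real (exp (- (\<Sum>a\<in>J. (t a)\<^sup>2) / 2))"
  shows "distr M Gauss (\<lambda>x a. Z a x) = Gauss"
proof -
  interpret G: product_prob_space "\<lambda>_::gidx. stdn" UNIV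
    by (simp add: product_prob_space_def product_sigma_finite_def product_prob_space_axioms_def
        prob_space_stdn prob_space_imp_sigma_finite)
  have Zm: "(\<lambda>x a. Z a x) \<in> measurable M (PiM UNIV (\<lambda>_. stdn))"
    by (rule measurable_PiM_single') auto
  have "distr M (PiM UNIV (\<lambda>_. stdn)) (\<lambda>x a. Z a x) = PiM UNIV (\<lambda>_. stdn)"
  proof (rule G.PiM_eq)
    fix J :: "gidx set" and F assume J: "finite J" and F: "\<And>j. j \<in> J \<Longrightarrow> F j \<in> sets stdn"
    define A where "A a = (if a \<in> J then F a else {})" for a
    have A: "A a \<in> sets borel" for a using F by (auto simp: A_def)
    have "expectation (\<lambda>x. of_real (\<Prod>a\<in>J. indicator (A a) (Z a x)) * iexp (\<Sum>a\<in>{}. 0 * Z a x)) =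
      complex_of_real ((\<Prod>a\<in>J. measure stdn (A a)) * exp (- (\<Sum>a\<in>({}::gidx set). (0::real)\<^sup>2) / 2))"
      by (rule prod_indicator_char[OF m char A J]) auto
    then have "complex_of_real (expectation (\<lambda>x. \<Prod>a\<in>J. indicator (A a) (Z a x))) = of_real (\<Prod>a\<in>J. measure stdn (A a))"
      by (simp del: of_real_prod)
    then have E: "expectation (\<lambda>x. \<Prod>a\<in>J. indicator (A a) (Z a x)) = (\<Prod>a\<in>J. measure stdn (A a))"
      by (simp only: of_real_eq_iff)
    let ?S = "{x \<in> space M. \<forall>a\<in>J. Z a x \<in> A a}"
    have Sm: "?S \<in> events" using J A by measurable
    have "(\<Prod>a\<in>J. indicator (A a) (Z a x)) = (indicator ?S x :: real)" if "x \<in> space M" for x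
    proof (cases "\<forall>a\<in>J. Z a x \<in> A a")
      case False
      then obtain a where "a \<in> J" "Z a x \<notin> A a" by blast
      then have "(\<Prod>a\<in>J. indicator (A a) (Z a x)) = (0::real)" using J by (intro prod_zero) (auto intro!: bexI[of _ a])
      then show ?thesis using False by auto
    qed (use that in simp)
    then have "expectation (\<lambda>x. (\<Prod>a\<in>J. indicator (A a) (Z a x)) :: real) = expectation (indicator ?S)"
      by (intro Bochner_Integration.integral_cong refl)
    then have P: "prob ?S = (\<Prod>a\<in>J. measure stdn (A a))" using E Sm by simp
    have "emeasure (distr M (PiM UNIV (\<lambda>_. stdn)) (\<lambda>x a. Z a x)) (prod_emb UNIV (\<lambda>_. stdn) J (Pi\<^sub>E J F)) =
      emeasure M ((\<lambda>x a. Z a x) -` prod_emb UNIV (\<lambda>_. stdn) J (Pi\<^sub>E J F) \<inter> space M)"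
      by (rule emeasure_distr[OF Zm]) (use J F in \<open>auto intro!: sets_PiM_I\<close>)
    also have "(\<lambda>x a. Z a x) -` prod_emb UNIV (\<lambda>_. stdn) J (Pi\<^sub>E J F) \<inter> space M = ?S"
      by (auto simp: prod_emb_iff A_def PiE_iff)
    also have "emeasure M ?S = ennreal (\<Prod>a\<in>J. measure stdn (A a))" by (simp add: emeasure_eq_measure P)
    also have "\<dots> = (\<Prod>a\<in>J. ennreal (measure stdn (A a)))" by (simp add: prod_ennreal)
    also have "\<dots> = (\<Prod>a\<in>J. emeasure stdn (F a))"
      by (intro prod.cong refl) (simp add: A_def finite_measure.emeasure_eq_measure prob_space.finite_measure prob_space_stdn)
    finally show "emeasure (distr M (PiM UNIV (\<lambda>_. stdn)) (\<lambda>x a. Z a x)) (prod_emb UNIV (\<lambda>_. stdn) J (Pi\<^sub>E J F)) =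
       (\<Prod>a\<in>J. emeasure stdn (F a))" .
  qed simp
  then show ?thesis by (simp add: Gauss_def)
qed

end

lemma Gauss_char_linear:
  assumes F: "finite F"
  shows "Gauss.expectation (\<lambda>x. iexp (\<Sum>b\<in>F. s b * x b)) = of_real (exp (- (\<Sum>b\<in>F. (s b)\<^sup>2) / 2))"
proof -
  have ie [measurable]: "iexp \<in> borel_measurable borel"
    by (intro borel_measurable_continuous_onI continuous_intros)
  have "Gauss.expectation (\<lambda>x. iexp (\<Sum>b\<in>F. s b * x b)) = Gauss.expectation (\<lambda>x. \<Prod>b\<in>F. iexp (s b * x b))"
    using F by (simp add: exp_sum sum_distrib_left)
  also have "\<dots> = (\<Prod>b\<in>F. Gauss.expectation (\<lambda>x. iexp (s b * x b)))"
  proof (rule Gauss.indep_vars_lebesgue_integral[OF F])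
    show "Gauss.indep_vars (\<lambda>_. borel) (\<lambda>b x. iexp (s b * x b)) F"
    proof (rule indep_vars_depends_on[where L = "\<lambda>b. {b}"])
      show "depends_on (\<lambda>x. iexp (s b * x b)) {b}" for b by (rule depends_onI) simp
    qed (auto simp: disjoint_family_on_def)
    show "integrable Gauss (\<lambda>x. iexp (s b * x b))" for b
      by (rule Gauss.integrable_const_bound[where B = 1]) auto
  qed
  also have "\<dots> = (\<Prod>b\<in>F. of_real (exp (- (s b)\<^sup>2 / 2)))"
  proof (intro prod.cong refl)
    fix b
    have "Gauss.expectation (\<lambda>x. iexp (s b * x b)) = (\<integral>t. iexp (s b * t) \<partial>distr Gauss stdn (\<lambda>x. x b))"
      by (rule integral_distr[symmetric, OF Gauss_coord_measurable_stdn]) simp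
    also have "\<dots> = char stdn (s b)" unfolding distr_Gauss_coord char_def ..
    finally show "Gauss.expectation (\<lambda>x. iexp (s b * x b)) = of_real (exp (- (s b)\<^sup>2 / 2))"
      unfolding char_std_normal_distribution .
  qed
  also have "\<dots> = of_real (exp (- (\<Sum>b\<in>F. (s b)\<^sup>2) / 2))"
    using F by (simp add: exp_sum[symmetric] sum_negf sum_divide_distrib[symmetric] flip: of_real_prod)
  finally show ?thesis .
qed

section \<open>The action of the unitary group on the Gaussian coordinates\<close>

definition conj_sum :: "nat \<Rightarrow> hmat \<Rightarrow> hmat \<Rightarrow> hmat" where
  "conj_sum M V X i j = (\<Sum>k<M. \<Sum>l<M. V i k * X k l * cnj (V j l))"

definition vec_sum :: "nat \<Rightarrow> hmat \<Rightarrow> (nat \<Rightarrow> complex) \<Rightarrow> nat \<Rightarrow> complex" where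
  "vec_sum M V v i = (\<Sum>k<M. V i k * v k)"

definition part :: "bool \<Rightarrow> complex \<Rightarrow> real" where
  "part b z = (if b then Re z else Im z)"

text \<open>The coordinates \<open>GO i j b\<close> with \<open>j \<le> i\<close> do not enter the model and are left untouched.\<close>
definition act :: "nat \<Rightarrow> hmat \<Rightarrow> (gidx \<Rightarrow> real) \<Rightarrow> gidx \<Rightarrow> real" where
  "act M V x a = (case a of
     GD i \<Rightarrow> Re (conj_sum M V (GUE x) i i)
   | GO i j b \<Rightarrow> if i < j then sqrt 2 * part b (conj_sum M V (GUE x) i j) else x (GO i j b)
   | XI s k i b \<Rightarrow> sqrt 2 * part b (vec_sum M V (xi x s k) i))"

lemma conj_sum_hermitian:
  assumes "\<And>i j. X j i = cnj (X i j)"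
  shows "conj_sum M V X j i = cnj (conj_sum M V X i j)"
proof -
  have "cnj (conj_sum M V X i j) = (\<Sum>k<M. \<Sum>l<M. V j l * X l k * cnj (V i k))"
    unfolding conj_sum_def by (simp add: assms[symmetric] mult_ac)
  also have "\<dots> = conj_sum M V X j i" unfolding conj_sum_def by (rule sum.swap)
  finally show ?thesis by simp
qed

lemma Complex_part: "Complex (sqrt 2 * part True z) (sqrt 2 * part False z) / complex_of_real (sqrt 2) = z"
  by (simp add: part_def complex_eq_iff Re_divide_of_real Im_divide_of_real)

lemma xi_act: "xi (act M V x) s k i = vec_sum M V (xi x s k) i"
  unfolding xi_def[of "act M V x"] act_def gidx.case Complex_part ..

lemma GUE_act: "GUE (act M V x) i j = conj_sum M V (GUE x) i j"
proof -
  have h: "conj_sum M V (GUE x) j i = cnj (conj_sum M V (GUE x) i j)" for i j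
    by (rule conj_sum_hermitian) (rule GUE_hermitian)
  consider "i = j" | "i < j" | "j < i" by linarith
  then show ?thesis
  proof cases
    case 1
    have "Im (conj_sum M V (GUE x) i i) = 0" using arg_cong[OF h[of i i], of Im] by simp
    then show ?thesis using 1 by (simp add: GUE_def[of "act M V x"] act_def complex_eq_iff)
  next
    case 2
    then have "GUE (act M V x) i j = Complex (act M V x (GO i j True)) (act M V x (GO i j False)) / complex_of_real (sqrt 2)"
      by (simp add: GUE_def)
    then show ?thesis using 2 unfolding act_def gidx.case by (simp only: if_True Complex_part)
  next
    case 3
    then have "GUE (act M V x) i j = cnj (Complex (act M V x (GO j i True)) (act M V x (GO j i False)) / complex_of_real (sqrt 2))"
      by (simp add: GUE_def)
    then show ?thesis using 3 unfolding act_def gidx.case by (simp only: if_True Complex_part h[of i j])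
  qed
qed

text \<open>A finite window of coordinates: the values of \<open>act M V x\<close> on it depend only
  on those of \<open>x\<close> on it, so the action becomes a linear map in finite
  dimension.\<close>

definition blk :: "nat \<Rightarrow> gidx set" where
  "blk M = GD ` {..<M} \<union> (\<lambda>(i, j, b). GO i j b) ` ({..<M} \<times> {..<M} \<times> UNIV) \<union>
     (\<lambda>(s, k, i, b). XI s k i b) ` (UNIV \<times> {..<M} \<times> {..<M} \<times> UNIV)"

lemma mem_blk [simp]: "GD i \<in> blk M \<longleftrightarrow> i < M" "GO i j b \<in> blk M \<longleftrightarrow> i < M \<and> j < M"
  "XI s k i b \<in> blk M \<longleftrightarrow> k < M \<and> i < M"
  by (auto simp: blk_def image_iff)

lemma finite_blk [simp]: "finite (blk M)"
  by (simp add: blk_def)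

lemma sum_blk:
  fixes f :: "gidx \<Rightarrow> real"
  shows "sum f (blk M) = (\<Sum>i<M. f (GD i)) + (\<Sum>i<M. \<Sum>j<M. f (GO i j True) + f (GO i j False)) +
     (\<Sum>s\<in>UNIV. \<Sum>k<M. \<Sum>i<M. f (XI s k i True) + f (XI s k i False))"
proof -
  have "sum f (blk M) = sum f (GD ` {..<M}) + sum f ((\<lambda>(i, j, b). GO i j b) ` ({..<M} \<times> {..<M} \<times> UNIV)) +
     sum f ((\<lambda>(s, k, i, b). XI s k i b) ` (UNIV \<times> {..<M} \<times> {..<M} \<times> UNIV))"
    unfolding blk_def by (subst sum.union_disjoint, auto)+
  also have "sum f (GD ` {..<M}) = (\<Sum>i<M. f (GD i))" by (subst sum.reindex) (auto simp: inj_on_def)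
  also have "sum f ((\<lambda>(i, j, b). GO i j b) ` ({..<M} \<times> {..<M} \<times> UNIV)) = (\<Sum>i<M. \<Sum>j<M. \<Sum>b\<in>UNIV. f (GO i j b))"
    by (subst sum.reindex) (auto simp: inj_on_def sum.cartesian_product split_beta)
  also have "sum f ((\<lambda>(s, k, i, b). XI s k i b) ` (UNIV \<times> {..<M} \<times> {..<M} \<times> UNIV)) =
      (\<Sum>s\<in>UNIV. \<Sum>k<M. \<Sum>i<M. \<Sum>b\<in>UNIV. f (XI s k i b))"
    by (subst sum.reindex) (auto simp: inj_on_def sum.cartesian_product split_beta)
  finally show ?thesis by (simp add: UNIV_bool add.commute)
qed

lemma sum_offdiag_symmetric:
  fixes h :: "nat \<Rightarrow> nat \<Rightarrow> real"
  shows "(\<Sum>i<M. \<Sum>j<M. if i < j then h i j else if j < i then h j i else 0) = 2 * (\<Sum>i<M. \<Sum>j<M. if i < j then h i j else 0)"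
proof -
  have "(\<Sum>i<M. \<Sum>j<M. if i < j then h i j else if j < i then h j i else 0) =
     (\<Sum>i<M. \<Sum>j<M. if i < j then h i j else 0) + (\<Sum>i<M. \<Sum>j<M. if j < i then h j i else 0)"
    unfolding sum.distrib[symmetric] by (intro sum.cong refl) auto
  also have "(\<Sum>i<M. \<Sum>j<M. if j < i then h j i else 0) = (\<Sum>i<M. \<Sum>j<M. if i < j then h i j else 0)"
    by (rule sum.swap)
  finally show ?thesis by simp
qed

text \<open>The Euclidean product of coordinates in terms of the Hilbert-Schmidt product of the
  matrices and the Hermitian products of the vectors. Off-diagonal entries occur twice, which
  offsets their factor 1 / sqrt 2; the vectors need the explicit 2. The middle sum collects the
  coordinates that \<open>act\<close> leaves fixed.\<close>

lemma inner_blk: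
  "(\<Sum>a\<in>blk M. t a * x a) = Re (\<Sum>i<M. \<Sum>j<M. cnj (GUE t i j) * GUE x i j)
     + (\<Sum>i<M. \<Sum>j<M. if i < j then 0 else t (GO i j True) * x (GO i j True) + t (GO i j False) * x (GO i j False))
     + (\<Sum>s\<in>UNIV. \<Sum>k<M. 2 * Re (\<Sum>i<M. cnj (xi t s k i) * xi x s k i))"
proof -
  let ?h = "\<lambda>i j. t (GO i j True) * x (GO i j True) + t (GO i j False) * x (GO i j False)"
  have X: "2 * Re (cnj (xi t s k i) * xi x s k i) = t (XI s k i True) * x (XI s k i True) + t (XI s k i False) * x (XI s k i False)" for s k i
    by (simp add: xi_def Re_divide_of_real Im_divide_of_real)
  have G: "Re (cnj (GUE t i j) * GUE x i j) = (if i = j then t (GD i) * x (GD i) else 0) +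
      (if i < j then ?h i j / 2 else if j < i then ?h j i / 2 else 0)" for i j
    by (auto simp: GUE_def Re_divide_of_real Im_divide_of_real add_divide_distrib)
  have "Re (\<Sum>i<M. \<Sum>j<M. cnj (GUE t i j) * GUE x i j) = (\<Sum>i<M. \<Sum>j<M. if i = j then t (GD i) * x (GD i) else 0) +
     (\<Sum>i<M. \<Sum>j<M. if i < j then ?h i j / 2 else if j < i then ?h j i / 2 else 0)"
    unfolding Re_sum G sum.distrib ..
  also have "(\<Sum>i<M. \<Sum>j<M. if i = j then t (GD i) * x (GD i) else 0) = (\<Sum>i<M. t (GD i) * x (GD i))"
    by (intro sum.cong refl) (simp add: sum.delta)
  also have "(\<Sum>i<M. \<Sum>j<M. if i < j then ?h i j / 2 else if j < i then ?h j i / 2 else 0) =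
     2 * (\<Sum>i<M. \<Sum>j<M. if i < j then ?h i j / 2 else 0)"
    by (rule sum_offdiag_symmetric)
  also have "\<dots> = (\<Sum>i<M. \<Sum>j<M. if i < j then ?h i j else 0)"
    unfolding sum_distrib_left by (intro sum.cong refl) auto
  finally have G': "Re (\<Sum>i<M. \<Sum>j<M. cnj (GUE t i j) * GUE x i j) =
     (\<Sum>i<M. t (GD i) * x (GD i)) + (\<Sum>i<M. \<Sum>j<M. if i < j then ?h i j else 0)" .
  have S: "(\<Sum>i<M. \<Sum>j<M. ?h i j) = (\<Sum>i<M. \<Sum>j<M. if i < j then ?h i j else 0) + (\<Sum>i<M. \<Sum>j<M. if i < j then 0 else ?h i j)"
    unfolding sum.distrib[symmetric] by (intro sum.cong refl) auto
  have X': "2 * Re (\<Sum>i<M. cnj (xi t s k i) * xi x s k i) = (\<Sum>i<M. t (XI s k i True) * x (XI s k i True) + t (XI s k i False) * x (XI s k i False))" for s k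
    unfolding Re_sum sum_distrib_left X ..
  show ?thesis unfolding sum_blk G' X' S by (simp only: add_ac)
qed

lemma sum4_rotate:
  fixes f :: "nat \<Rightarrow> nat \<Rightarrow> nat \<Rightarrow> nat \<Rightarrow> complex"
  shows "(\<Sum>i<M. \<Sum>j<M. \<Sum>k<M. \<Sum>l<M. f i j k l) = (\<Sum>k<M. \<Sum>l<M. \<Sum>i<M. \<Sum>j<M. f i j k l)"
proof -
  have "(\<Sum>i<M. \<Sum>j<M. \<Sum>k<M. \<Sum>l<M. f i j k l) = (\<Sum>i<M. \<Sum>k<M. \<Sum>j<M. \<Sum>l<M. f i j k l)"
    by (rule sum.cong[OF refl], rule sum.swap)
  also have "\<dots> = (\<Sum>k<M. \<Sum>i<M. \<Sum>j<M. \<Sum>l<M. f i j k l)" by (rule sum.swap)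
  also have "\<dots> = (\<Sum>k<M. \<Sum>i<M. \<Sum>l<M. \<Sum>j<M. f i j k l)"
    by (rule sum.cong[OF refl], rule sum.cong[OF refl], rule sum.swap)
  also have "\<dots> = (\<Sum>k<M. \<Sum>l<M. \<Sum>i<M. \<Sum>j<M. f i j k l)"
    by (rule sum.cong[OF refl], rule sum.swap)
  finally show ?thesis .
qed

section \<open>Orthogonality of the action\<close>

lemma inner_conj_sum:
  "(\<Sum>i<M. \<Sum>j<M. cnj (T i j) * conj_sum M V X i j) = (\<Sum>k<M. \<Sum>l<M. cnj (conj_sum M (\<lambda>i k. cnj (V k i)) T k l) * X k l)"
proof -
  have "(\<Sum>i<M. \<Sum>j<M. cnj (T i j) * conj_sum M V X i j) =
    (\<Sum>i<M. \<Sum>j<M. \<Sum>k<M. \<Sum>l<M. V i k * cnj (T i j) * cnj (V j l) * X k l)"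
    unfolding conj_sum_def sum_distrib_left by (intro sum.cong refl) (simp only: mult_ac)
  also have "\<dots> = (\<Sum>k<M. \<Sum>l<M. \<Sum>i<M. \<Sum>j<M. V i k * cnj (T i j) * cnj (V j l) * X k l)" by (rule sum4_rotate)
  also have "\<dots> = (\<Sum>k<M. \<Sum>l<M. cnj (conj_sum M (\<lambda>i k. cnj (V k i)) T k l) * X k l)"
    unfolding conj_sum_def by (simp add: sum_distrib_right)
  finally show ?thesis .
qed

lemma inner_vec_sum:
  "(\<Sum>i<M. cnj (t i) * vec_sum M V v i) = (\<Sum>k<M. cnj (vec_sum M (\<lambda>i k. cnj (V k i)) t k) * v k)"
proof -
  have "(\<Sum>i<M. cnj (t i) * vec_sum M V v i) = (\<Sum>i<M. \<Sum>k<M. V i k * cnj (t i) * v k)"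
    unfolding vec_sum_def sum_distrib_left by (intro sum.cong refl) (simp only: mult_ac)
  also have "\<dots> = (\<Sum>k<M. \<Sum>i<M. V i k * cnj (t i) * v k)" by (rule sum.swap)
  also have "\<dots> = (\<Sum>k<M. cnj (vec_sum M (\<lambda>i k. cnj (V k i)) t k) * v k)"
    unfolding vec_sum_def by (simp add: sum_distrib_right)
  finally show ?thesis .
qed

lemma act_adjoint:
  "(\<Sum>a\<in>blk M. t a * act M V x a) = (\<Sum>a\<in>blk M. act M (\<lambda>i k. cnj (V k i)) t a * x a)"
proof -
  have u: "(if i < j then 0 else t (GO i j True) * act M V x (GO i j True) + t (GO i j False) * act M V x (GO i j False)) =
    (if i < j then 0 else act M (\<lambda>i k. cnj (V k i)) t (GO i j True) * x (GO i j True) + act M (\<lambda>i k. cnj (V k i)) t (GO i j False) * x (GO i j False))" for i j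
    by (simp add: act_def)
  show ?thesis unfolding inner_blk u GUE_act xi_act inner_conj_sum inner_vec_sum ..
qed

context
  fixes M :: nat and V :: hmat
  assumes V: "\<And>i j. i < M \<Longrightarrow> j < M \<Longrightarrow> (\<Sum>k<M. V i k * cnj (V j k)) = (if i = j then 1 else 0)"
begin

lemma vec_sum_inverse: "i < M \<Longrightarrow> vec_sum M V (vec_sum M (\<lambda>i k. cnj (V k i)) t) i = t i"
proof -
  assume i: "i < M"
  have "vec_sum M V (vec_sum M (\<lambda>i k. cnj (V k i)) t) i = (\<Sum>k<M. \<Sum>p<M. V i k * cnj (V p k) * t p)"
    unfolding vec_sum_def by (simp add: sum_distrib_left mult.assoc)
  also have "\<dots> = (\<Sum>p<M. (\<Sum>k<M. V i k * cnj (V p k)) * t p)"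
    by (subst sum.swap) (simp add: sum_distrib_right)
  also have "\<dots> = (\<Sum>p<M. if i = p then t p else 0)" by (intro sum.cong refl) (simp add: V[OF i])
  also have "\<dots> = t i" using i by simp
  finally show ?thesis .
qed

lemma conj_sum_inverse:
  assumes i: "i < M" and j: "j < M"
  shows "conj_sum M V (conj_sum M (\<lambda>i k. cnj (V k i)) T) i j = T i j"
proof -
  have "conj_sum M V (conj_sum M (\<lambda>i k. cnj (V k i)) T) i j =
    (\<Sum>k<M. \<Sum>l<M. \<Sum>p<M. \<Sum>q<M. (V i k * cnj (V p k)) * ((V q l * cnj (V j l)) * T p q))"
    unfolding conj_sum_def sum_distrib_left sum_distrib_right by (intro sum.cong refl) (simp add: mult_ac)
  also have "\<dots> = (\<Sum>p<M. \<Sum>q<M. \<Sum>k<M. \<Sum>l<M. (V i k * cnj (V p k)) * ((V q l * cnj (V j l)) * T p q))"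
    by (rule sum4_rotate)
  also have "\<dots> = (\<Sum>p<M. \<Sum>q<M. (\<Sum>k<M. V i k * cnj (V p k)) * ((\<Sum>l<M. V q l * cnj (V j l)) * T p q))"
  proof -
    have "(\<Sum>k<M. \<Sum>l<M. a k * (b l * c)) = (\<Sum>k<M. a k) * ((\<Sum>l<M. b l) * c)" for a b :: "nat \<Rightarrow> complex" and c
      unfolding sum_distrib_right[of b "{..<M}" c] sum_product ..
    then show ?thesis by simp
  qed
  also have "\<dots> = (\<Sum>p<M. \<Sum>q<M. if i = p then (if q = j then T p q else 0) else 0)"
    by (intro sum.cong refl) (simp add: V[OF i] V[OF _ j])
  also have "\<dots> = (\<Sum>p<M. if i = p then T p j else 0)" using j by (intro sum.cong refl) (simp add: sum.delta')
  also have "\<dots> = T i j" using i by simp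
  finally show ?thesis .
qed

text \<open>Writing V' for the adjoint, the product of V' t with itself is that of t with V V' t,
  and V V' is the identity on the first \<open>M\<close> indices.\<close>

lemma act_adjoint_norm:
  "(\<Sum>a\<in>blk M. (act M (\<lambda>i k. cnj (V k i)) t a)\<^sup>2) = (\<Sum>a\<in>blk M. (t a)\<^sup>2)"
proof -
  let ?t = "act M (\<lambda>i k. cnj (V k i)) t"
  have "(\<Sum>a\<in>blk M. t a * act M V ?t a) = (\<Sum>a\<in>blk M. ?t a * ?t a)" by (rule act_adjoint)
  then have "(\<Sum>a\<in>blk M. (?t a)\<^sup>2) = (\<Sum>a\<in>blk M. t a * act M V ?t a)"
    by (simp add: power2_eq_square)
  also have "\<dots> = (\<Sum>a\<in>blk M. t a * t a)"
  proof -
    have u: "(if i < j then 0 else t (GO i j True) * act M V ?t (GO i j True) + t (GO i j False) * act M V ?t (GO i j False)) =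
      (if i < j then 0 else t (GO i j True) * t (GO i j True) + t (GO i j False) * t (GO i j False))" for i j
      by (simp add: act_def)
    have G: "(\<Sum>i<M. \<Sum>j<M. cnj (GUE t i j) * GUE (act M V ?t) i j) = (\<Sum>i<M. \<Sum>j<M. cnj (GUE t i j) * GUE t i j)"
      unfolding GUE_act using conj_sum_inverse by (intro sum.cong refl) (simp add: GUE_act[abs_def] fun_eq_iff[symmetric])
    have X: "(\<Sum>i<M. cnj (xi t s k i) * xi (act M V ?t) s k i) = (\<Sum>i<M. cnj (xi t s k i) * xi t s k i)" for s k
    proof -
      have "xi ?t s k = vec_sum M (\<lambda>i k. cnj (V k i)) (xi t s k)" by (rule ext) (rule xi_act)
      then show ?thesis unfolding xi_act using vec_sum_inverse by (intro sum.cong refl) simp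
    qed
    show ?thesis unfolding inner_blk u G X ..
  qed
  finally show ?thesis by (simp add: power2_eq_square)
qed

end

section \<open>From finite windows to all coordinates\<close>

lemma blk_exhaust: "finite J \<Longrightarrow> \<exists>M\<ge>N. J \<subseteq> blk M"
proof (induction J rule: finite_induct)
  case (insert a J)
  then obtain M where M: "M \<ge> N" "J \<subseteq> blk M" by blast
  obtain m where m: "a \<in> blk m"
  proof (cases a)
    case (GD i) then show ?thesis using that[of "Suc i"] by simp
  next
    case (GO i j b)
    then show ?thesis using that[of "Suc (i + j)"] by simp
  next
    case (XI s k i b)
    then show ?thesis using that[of "Suc (k + i)"] by simp
  qed
  have mono: "blk m \<subseteq> blk n" if "m \<le> n" for m n
  proof
    show "a \<in> blk n" if "a \<in> blk m" for a using that \<open>m \<le> n\<close> by (cases a) auto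
  qed
  have "insert a J \<subseteq> blk (max m M)" using m M mono[of m "max m M"] mono[of M "max m M"] by auto
  then show ?case using M by (intro exI[of _ "max m M"]) auto
qed auto

lemma ext_unitary_rows:
  assumes u: "unitary_N N u" and M: "N \<le> M" and i: "i < M" and j: "j < M"
  shows "(\<Sum>k<M. ext_unitary N u i k * cnj (ext_unitary N u j k)) = (if i = j then 1 else 0)"
proof (cases "i < N \<and> j < N")
  case True
  have "(\<Sum>k<M. ext_unitary N u i k * cnj (ext_unitary N u j k)) = (\<Sum>k<N. ext_unitary N u i k * cnj (ext_unitary N u j k))"
    using True M by (intro sum.mono_neutral_right) (auto simp: ext_unitary_def)
  also have "\<dots> = (\<Sum>k<N. u i k * cnj (u j k))" using True by (intro sum.cong) (auto simp: ext_unitary_def)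
  finally show ?thesis using u True unfolding unitary_N_def by simp
next
  case False
  have "ext_unitary N u i k * cnj (ext_unitary N u j k) = (if k = i then (if i = j then 1 else 0) else 0)" for k
    using False by (auto simp: ext_unitary_def)
  then show ?thesis using i by (simp add: sum.delta)
qed

lemma ext_unitary_sum_extend:
  assumes "N \<le> M" "i < M" "M \<le> M'"
  shows "(\<Sum>k<M'. ext_unitary N u i k * f k) = (\<Sum>k<M. ext_unitary N u i k * f k)"
  using assms by (intro sum.mono_neutral_right) (auto simp: ext_unitary_def)

lemma vec_sum_extend:
  assumes "N \<le> M" "i < M" "M \<le> M'"
  shows "vec_sum M' (ext_unitary N u) v i = vec_sum M (ext_unitary N u) v i"
  unfolding vec_sum_def by (rule ext_unitary_sum_extend[OF assms])

lemma conj_sum_extend: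
  assumes M: "N \<le> M" "M \<le> M'" and i: "i < M" and j: "j < M"
  shows "conj_sum M' (ext_unitary N u) X i j = conj_sum M (ext_unitary N u) X i j"
proof -
  let ?U = "ext_unitary N u"
  have e: "conj_sum M V X i j = (\<Sum>k<M. V i k * cnj (\<Sum>l<M. V j l * cnj (X k l)))" for M V
    unfolding conj_sum_def by (simp add: sum_distrib_left mult_ac)
  show ?thesis unfolding e
    unfolding ext_unitary_sum_extend[OF M(1) j M(2)] ext_unitary_sum_extend[OF M(1) i M(2)] ..
qed

definition gbound :: "gidx \<Rightarrow> nat" where
  "gbound a = (case a of GD i \<Rightarrow> i | GO i j b \<Rightarrow> max i j | XI s k i b \<Rightarrow> i)"

text \<open>The window grows with the coordinate, so that the map is defined on the whole product
  space; \<open>rot_eq_act\<close> shows that every sufficiently large window gives the same value.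
  Only the matrix indices determine the size, as the rotation does not mix the levels
  \<open>k\<close>.\<close>

definition rot :: "nat \<Rightarrow> hmat \<Rightarrow> (gidx \<Rightarrow> real) \<Rightarrow> gidx \<Rightarrow> real" where
  "rot N u x a = act (Suc (N + gbound a)) (ext_unitary N u) x a"

lemma rot_eq_act: "N \<le> M \<Longrightarrow> gbound a < M \<Longrightarrow> rot N u x a = act M (ext_unitary N u) x a"
proof -
  assume M: "N \<le> M" "gbound a < M"
  have *: "act (Suc (N + gbound a)) (ext_unitary N u) x a = act M' (ext_unitary N u) x a"
    if "Suc (N + gbound a) \<le> M'" for M'
    using that by (cases a) (simp_all add: act_def gbound_def vec_sum_extend[OF _ _ that] conj_sum_extend[OF _ that])
  have **: "act M (ext_unitary N u) x a = act M' (ext_unitary N u) x a" if "M \<le> M'" for M'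
    using that M by (cases a) (simp_all add: act_def gbound_def vec_sum_extend[OF _ _ that] conj_sum_extend[OF _ that])
  show ?thesis unfolding rot_def using *[of "max M (Suc (N + gbound a))"] **[of "max M (Suc (N + gbound a))"] by simp
qed

lemma measurable_act [measurable]: "(\<lambda>x. act M V x a) \<in> borel_measurable Gauss"
proof -
  have [measurable]: "Re \<in> borel_measurable borel" "Im \<in> borel_measurable borel"
    by (auto intro!: borel_measurable_continuous_onI continuous_intros)
  show ?thesis unfolding act_def conj_sum_def vec_sum_def part_def
    by (cases a) (auto simp del: Re_sum Im_sum)
qed

text \<open>A linear form in the rotated coordinates is a linear form in the original ones, whose
  coefficients are transformed by the adjoint and keep their Euclidean norm. The joint
  characteristic function is therefore unchanged.\<close>

theorem distr_rot: 
  assumes u: "unitary_N N u"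
  shows "distr Gauss Gauss (rot N u) = Gauss"
proof -
  have "distr Gauss Gauss (\<lambda>x a. rot N u x a) = Gauss"
  proof (rule Gauss.distr_eq_Gauss_of_char)
    show "(\<lambda>x. rot N u x a) \<in> borel_measurable Gauss" for a unfolding rot_def by measurable
    fix J :: "gidx set" and t :: "gidx \<Rightarrow> real" assume J: "finite J"
    obtain M where M: "M \<ge> N" "J \<subseteq> blk M" using blk_exhaust[OF J] by blast
    define t' where "t' a = (if a \<in> J then t a else 0)" for a
    let ?U = "ext_unitary N u"
    let ?s = "act M (\<lambda>i k. cnj (?U k i)) t'"
    have "(\<Sum>a\<in>J. t a * rot N u x a) = (\<Sum>a\<in>blk M. ?s a * x a)" for x
    proof -
      have "(\<Sum>a\<in>J. t a * rot N u x a) = (\<Sum>a\<in>blk M. t' a * rot N u x a)"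
        using M by (intro sum.mono_neutral_cong_left) (auto simp: t'_def)
      also have "\<dots> = (\<Sum>a\<in>blk M. t' a * act M ?U x a)"
      proof (intro sum.cong refl arg_cong2[where f = "(*)"])
        fix a assume "a \<in> blk M"
        then have "gbound a < M" by (cases a) (auto simp: gbound_def)
        then show "rot N u x a = act M ?U x a" using M by (intro rot_eq_act)
      qed
      also have "\<dots> = (\<Sum>a\<in>blk M. ?s a * x a)" by (rule act_adjoint)
      finally show ?thesis .
    qed
    then have "Gauss.expectation (\<lambda>x. iexp (\<Sum>a\<in>J. t a * rot N u x a)) = of_real (exp (- (\<Sum>a\<in>blk M. (?s a)\<^sup>2) / 2))"
      using Gauss_char_linear[OF finite_blk[of M], of ?s] by simp
    also have "(\<Sum>a\<in>blk M. (?s a)\<^sup>2) = (\<Sum>a\<in>blk M. (t' a)\<^sup>2)"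
      by (rule act_adjoint_norm) (rule ext_unitary_rows[OF u M(1)])
    also have "\<dots> = (\<Sum>a\<in>J. (t a)\<^sup>2)"
      using M by (intro sum.mono_neutral_cong_right) (auto simp: t'_def)
    finally show "Gauss.expectation (\<lambda>x. iexp (\<Sum>a\<in>J. t a * rot N u x a)) = of_real (exp (- (\<Sum>a\<in>J. (t a)\<^sup>2) / 2))" .
  qed
  then show ?thesis by (simp add: fun_eq_iff[symmetric])
qed

section \<open>Unitary invariance of the model\<close>

lemma xi_rot: "N \<le> M \<Longrightarrow> i < M \<Longrightarrow> xi (rot N u x) s k i = vec_sum M (ext_unitary N u) (xi x s k) i"
  unfolding xi_act[symmetric] unfolding xi_def by (simp add: rot_eq_act[of N M] gbound_def)

lemma GUE_rot:
  assumes "N \<le> M" "i < M" "j < M"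
  shows "GUE (rot N u x) i j = conj_sum M (ext_unitary N u) (GUE x) i j"
proof -
  have "rot N u x a = act M (ext_unitary N u) x a" if "gbound a < M" for a
    by (rule rot_eq_act[OF assms(1) that])
  then show ?thesis
    unfolding GUE_act[symmetric] unfolding GUE_def using assms by (simp add: gbound_def)
qed

lemma conj_by_eq_conj_sum: "conj_by N u H i j = conj_sum (Suc (N + i + j)) (ext_unitary N u) H i j"
  by (simp add: conj_by_def conj_sum_def)

text \<open>A pathwise identity: each entry of the conjugate is a finite sum and commutes with the
  convergent series. Convergence at all positions is assumed, since \<open>ssum\<close> is 0
  otherwise and linearity could fail.\<close>

lemma conj_by_Hom:
  assumes u: "unitary_N N u" and w: "w = (ap, am, g1, g2)"
    and sp: "\<And>k l. summable (\<lambda>m. of_real (ap m) * eta True k l m x)"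
    and sm: "\<And>k l. summable (\<lambda>m. of_real (am m) * eta False k l m x)"
  shows "conj_by N u (Hom w x) = Hom w (rot N u x)"
proof (intro ext)
  fix i j
  define M where "M = Suc (N + i + j)"
  have M: "N \<le> M" "i < M" "j < M" by (auto simp: M_def)
  let ?U = "ext_unitary N u"
  have ort: "(\<Sum>k<M. ?U i k * cnj (?U j k)) = (if i = j then 1 else 0)"
    by (rule ext_unitary_rows[OF u M])
  have diag: "conj_sum M ?U (\<lambda>k l. if k = l then c else 0) i j = (if i = j then c else 0)" for c
  proof -
    have "conj_sum M ?U (\<lambda>k l. if k = l then c else 0) i j = (\<Sum>k<M. \<Sum>l<M. if k = l then c * (?U i k * cnj (?U j k)) else 0)"
      unfolding conj_sum_def by (intro sum.cong refl) auto
    also have "\<dots> = (\<Sum>k<M. c * (?U i k * cnj (?U j k)))" by (intro sum.cong refl) (simp add: sum.delta)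
    also have "\<dots> = (if i = j then c else 0)" unfolding sum_distrib_left[symmetric] ort by simp
    finally show ?thesis .
  qed
  \<comment> \<open>The centring transforms correctly because the rows of the extended unitary are
    orthonormal, which is the content of \<open>diag\<close>.\<close>
  have et: "conj_sum M ?U (\<lambda>k l. eta s k l m x) i j = eta s i j m (rot N u x)" for s m
  proof -
    have "conj_sum M ?U (\<lambda>k l. eta s k l m x) i j =
        conj_sum M ?U (\<lambda>k l. xi x s m k * cnj (xi x s m l)) i j - conj_sum M ?U (\<lambda>k l. if k = l then 1 else 0) i j"
      unfolding conj_sum_def eta_def by (simp add: algebra_simps sum_subtractf)
    also have "conj_sum M ?U (\<lambda>k l. xi x s m k * cnj (xi x s m l)) i j = vec_sum M ?U (xi x s m) i * cnj (vec_sum M ?U (xi x s m) j)"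
      unfolding conj_sum_def vec_sum_def by (simp add: sum_product mult_ac)
    finally show ?thesis unfolding diag eta_def by (simp add: xi_rot[OF M(1,2)] xi_rot[OF M(1,3)])
  qed
  have ser: "conj_sum M ?U (\<lambda>k l. ssum (\<lambda>m. of_real (a m) * eta s k l m x)) i j = ssum (\<lambda>m. of_real (a m) * eta s i j m (rot N u x))"
    if sa: "\<And>k l. summable (\<lambda>m. of_real (a m) * eta s k l m x)" for a :: "nat \<Rightarrow> real" and s
  proof -
    have "(\<lambda>m. \<Sum>k<M. \<Sum>l<M. ?U i k * (of_real (a m) * eta s k l m x) * cnj (?U j l)) sums
       (\<Sum>k<M. \<Sum>l<M. ?U i k * ssum (\<lambda>m. of_real (a m) * eta s k l m x) * cnj (?U j l))"
      using sa by (intro sums_sum sums_mult sums_mult2) (simp add: ssum_def summable_sums)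
    also have "(\<lambda>m. \<Sum>k<M. \<Sum>l<M. ?U i k * (of_real (a m) * eta s k l m x) * cnj (?U j l)) =
       (\<lambda>m. of_real (a m) * eta s i j m (rot N u x))"
      unfolding et[symmetric] conj_sum_def sum_distrib_left by (intro ext sum.cong refl) (simp only: mult_ac)
    finally show ?thesis unfolding conj_sum_def ssum_def by (simp add: sums_iff)
  qed
  have "conj_by N u (Hom w x) i j = conj_sum M ?U (Hom w x) i j" unfolding M_def by (rule conj_by_eq_conj_sum)
  also have "\<dots> = conj_sum M ?U (\<lambda>k l. if k = l then of_real g1 else 0) i j + of_real (sqrt g2) * conj_sum M ?U (GUE x) i j
      + conj_sum M ?U (\<lambda>k l. ssum (\<lambda>m. of_real (ap m) * eta True k l m x)) i j
      - conj_sum M ?U (\<lambda>k l. ssum (\<lambda>m. of_real (am m) * eta False k l m x)) i j"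
  proof -
    have h: "Hom w x k l = (if k = l then of_real g1 else 0) + of_real (sqrt g2) * GUE x k l
        + ssum (\<lambda>m. of_real (ap m) * eta True k l m x) - ssum (\<lambda>m. of_real (am m) * eta False k l m x)" for k l
      unfolding Hom_def w prod.case eta_def ..
    have "?U i k * Hom w x k l * cnj (?U j l) = ?U i k * (if k = l then of_real g1 else 0) * cnj (?U j l)
        + of_real (sqrt g2) * (?U i k * GUE x k l * cnj (?U j l))
        + ?U i k * ssum (\<lambda>m. of_real (ap m) * eta True k l m x) * cnj (?U j l)
        - ?U i k * ssum (\<lambda>m. of_real (am m) * eta False k l m x) * cnj (?U j l)" for k l
      unfolding h by (simp only: distrib_left distrib_right left_diff_distrib right_diff_distrib mult_ac)
    then show ?thesis unfolding conj_sum_def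
      by (simp only: sum.distrib sum_subtractf sum_distrib_left)
  qed
  also have "\<dots> = Hom w (rot N u x) i j"
    unfolding diag ser[OF sp] ser[OF sm] GUE_rot[OF M, symmetric]
    by (simp only: Hom_def w prod.case eta_def)
  finally show "conj_by N u (Hom w x) i j = Hom w (rot N u x) i j" .
qed

lemma conj_by_Herm: "H \<in> Herm \<Longrightarrow> conj_by N u H \<in> Herm"
proof -
  assume H: "H \<in> Herm"
  have h: "H j i = cnj (H i j)" for i j using H unfolding Herm_def by blast
  have "conj_by N u H i j = cnj (conj_by N u H j i)" for i j
    unfolding conj_by_eq_conj_sum using conj_sum_hermitian[of H, OF h] by (metis add.assoc add.commute)
  then show ?thesis unfolding Herm_def by blast
qed

lemma measurable_conj_by [measurable]: "conj_by N u \<in> measurable HM HM"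
proof (rule measurable_HM_of_entries)
  show "(\<lambda>H. conj_by N u H i j) \<in> borel_measurable HM" for i j unfolding conj_by_def by measurable
qed (use conj_by_Herm in simp)

lemma measurable_rot: "rot N u \<in> measurable Gauss Gauss"
proof -
  have "(\<lambda>x a. rot N u x a) \<in> measurable Gauss (PiM UNIV (\<lambda>_. stdn))"
  proof (rule measurable_PiM_single')
    fix a :: gidx
    have "(\<lambda>x. rot N u x a) \<in> borel_measurable Gauss" unfolding rot_def by measurable
    then show "(\<lambda>x. rot N u x a) \<in> measurable Gauss stdn" by simp
  qed simp
  then show ?thesis by (simp add: Gauss_def)
qed

lemma emeasure_Nmeas: "A \<in> sets HM \<Longrightarrow> emeasure (Nmeas w) A = emeasure Gauss {x. Hom w x \<in> A}"
  unfolding Nmeas_def by (subst emeasure_distr) (auto simp: vimage_def)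

text \<open>Almost surely, conjugating the model amounts to rotating its Gaussian coordinates, and
  the rotation preserves \<open>Gauss\<close>.\<close>

lemma Nmeas_conj_by:
  assumes u: "unitary_N N u" and w: "w \<in> Omega" and A: "A \<in> sets HM"
  shows "emeasure (Nmeas w) (conj_by N u -` A \<inter> space HM) = emeasure (Nmeas w) A"
proof -
  obtain ap am g1 g2 where w4: "w = (ap, am, g1, g2)" by (cases w) auto
  have s: "summable (\<lambda>i. (ap i)\<^sup>2)" "summable (\<lambda>i. (am i)\<^sup>2)" using w unfolding w4 Omega_def by auto
  have B: "conj_by N u -` A \<inter> space HM \<in> sets HM" by (rule measurable_sets[OF measurable_conj_by A])
  have "AE x in Gauss. \<forall>i j. summable (\<lambda>k. of_real (ap k) * eta True i j k x) \<and> summable (\<lambda>k. of_real (am k) * eta False i j k x)"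
    unfolding AE_all_countable using AE_summable_eta[OF s(1)] AE_summable_eta[OF s(2)] by auto
  then have ae: "AE x in Gauss. conj_by N u (Hom w x) = Hom w (rot N u x)"
    by eventually_elim (rule conj_by_Hom[OF u w4], auto)
  have m1: "{x. Hom w x \<in> A} \<in> sets Gauss" if "A \<in> sets HM" for A
    using measurable_sets[OF measurable_Hom that] by (simp add: vimage_def)
  have m2: "{x. Hom w (rot N u x) \<in> A} \<in> sets Gauss"
    using measurable_sets[OF measurable_compose[OF measurable_rot measurable_Hom] A] by (simp add: vimage_def)
  have "emeasure (Nmeas w) (conj_by N u -` A \<inter> space HM) = emeasure Gauss {x. Hom w x \<in> conj_by N u -` A \<inter> space HM}"
    by (rule emeasure_Nmeas[OF B])
  also have "\<dots> = emeasure Gauss {x. Hom w (rot N u x) \<in> A}"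
    by (rule emeasure_eq_AE[OF _ m1[OF B] m2]) (use ae in eventually_elim, auto simp: Hom_Herm)
  also have "\<dots> = emeasure (distr Gauss Gauss (rot N u)) {x. Hom w x \<in> A}"
    by (subst emeasure_distr[OF measurable_rot m1[OF A]]) (simp add: vimage_def)
  also have "\<dots> = emeasure (Nmeas w) A" unfolding distr_rot[OF u] by (rule emeasure_Nmeas[OF A, symmetric])
  finally show ?thesis .
qed

section \<open>The limiting parameters\<close>

text \<open>Total and with values in \<open>Omega\<close>, as measurability into
  \<open>OmegaM\<close> requires; the zero parameter is a default for matrices whose computed tuple
  lies outside \<open>Omega\<close>.\<close>

definition param :: "hmat \<Rightarrow> omega" where
  "param H = (let t = omega_of (\<lambda>k. lim (\<lambda>N. Re (scoef H N k))) in
     if t \<in> Omega then t else ((\<lambda>_. 0), (\<lambda>_. 0), 0, 0))"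

lemma param_Omega: "param H \<in> Omega"
  by (auto simp: param_def Let_def Omega_def decseq_def)

lemma measurable_param_coords:
  "(\<lambda>H. fst (param H) k) \<in> borel_measurable HM" "(\<lambda>H. fst (snd (param H)) k) \<in> borel_measurable HM"
  "(\<lambda>H. fst (snd (snd (param H)))) \<in> borel_measurable HM" "(\<lambda>H. snd (snd (snd (param H)))) \<in> borel_measurable HM"
proof -
  have [measurable]: "Re \<in> borel_measurable borel"
    by (intro borel_measurable_continuous_onI continuous_intros)
  let ?t = "\<lambda>H. omega_of (\<lambda>k. lim (\<lambda>N. Re (scoef H N k)))"
  have a: "(\<lambda>H. lim (\<lambda>N. Re (scoef H N k))) \<in> borel_measurable HM" for k by measurable
  note t [measurable] = measurable_omega_of[OF a]
  have [measurable]: "Measurable.pred HM (\<lambda>H. ?t H \<in> Omega)" by (rule measurable_pred_Omega) measurable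
  have e: "fst (param H) k = (if ?t H \<in> Omega then fst (?t H) k else 0)"
    "fst (snd (param H)) k = (if ?t H \<in> Omega then fst (snd (?t H)) k else 0)"
    "fst (snd (snd (param H))) = (if ?t H \<in> Omega then fst (snd (snd (?t H))) else 0)"
    "snd (snd (snd (param H))) = (if ?t H \<in> Omega then snd (snd (snd (?t H))) else 0)" for H k
    by (auto simp: param_def Let_def)
  show "(\<lambda>H. fst (param H) k) \<in> borel_measurable HM" "(\<lambda>H. fst (snd (param H)) k) \<in> borel_measurable HM"
    "(\<lambda>H. fst (snd (snd (param H)))) \<in> borel_measurable HM" "(\<lambda>H. snd (snd (snd (param H)))) \<in> borel_measurable HM"
    unfolding e by measurable
qed

lemma measurable_param [measurable]: "param \<in> measurable HM OmegaM"
  by (rule measurable_into_OmegaM) (use measurable_param_coords param_Omega in auto)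

definition good :: "hmat set" where
  "good = {H \<in> space HM. \<forall>k. (\<lambda>N. scoef H N k) \<longlonglongrightarrow> of_real (lpc (param H) k)}"

text \<open>Only countable quantifiers occur on the right, as the measurability of
  \<open>good\<close> requires.\<close>

lemma LIMSEQ_iff_inverse_Suc:
  fixes X :: "nat \<Rightarrow> 'a :: metric_space"
  shows "X \<longlonglongrightarrow> L \<longleftrightarrow> (\<forall>q. \<exists>N. \<forall>n\<ge>N. dist (X n) L < inverse (real (Suc q)))"
proof
  assume "X \<longlonglongrightarrow> L"
  then show "\<forall>q. \<exists>N. \<forall>n\<ge>N. dist (X n) L < inverse (real (Suc q))"
    unfolding lim_sequentially by (metis inverse_positive_iff_positive of_nat_0_less_iff zero_less_Suc)
next
  assume h: "\<forall>q. \<exists>N. \<forall>n\<ge>N. dist (X n) L < inverse (real (Suc q))"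
  show "X \<longlonglongrightarrow> L" unfolding lim_sequentially
  proof (intro allI impI)
    fix r :: real assume "r > 0"
    then obtain q where "inverse (real (Suc q)) < r" using reals_Archimedean by blast
    then show "\<exists>N. \<forall>n\<ge>N. dist (X n) L < r" using h by (meson less_trans)
  qed
qed

lemma good_measurable [measurable]: "good \<in> sets HM"
proof -
  note [measurable] = measurable_lpc[OF measurable_param_coords]
  show ?thesis unfolding good_def LIMSEQ_iff_inverse_Suc by measurable
qed

lemma AE_Hom_good:
  assumes w: "w \<in> Omega"
  shows "AE x in Gauss. Hom w x \<in> good \<and> param (Hom w x) = w"
  using AE_scoef_Hom_tendsto[OF w]
proof eventually_elim
  case (elim x)
  have "(\<lambda>N. Re (scoef (Hom w x) N k)) \<longlonglongrightarrow> lpc w k" for k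
    using tendsto_Re[OF elim[rule_format, of k]] by simp
  then have "(\<lambda>k. lim (\<lambda>N. Re (scoef (Hom w x) N k))) = lpc w" by (auto intro!: ext limI)
  then have "param (Hom w x) = w" unfolding param_def Let_def by (simp add: omega_of_lpc[OF w] w)
  then show ?case using elim by (simp add: good_def Hom_Herm)
qed

text \<open>\<open>Nmeas w\<close> is concentrated on the good matrices with parameter
  \<open>w\<close>, so an event that is decided there has mass 0 or 1.\<close>

lemma Nmeas_zero_one:
  assumes w: "w \<in> Omega" and A: "A \<in> sets HM" and B: "\<And>H. H \<in> good \<Longrightarrow> param H = w \<Longrightarrow> H \<in> A \<longleftrightarrow> P"
  shows "emeasure (Nmeas w) A = (if P then 1 else 0)"
proof -
  have m: "{x. Hom w x \<in> A} \<in> sets Gauss"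
    using measurable_sets[OF measurable_Hom A] by (simp add: vimage_def)
  have "emeasure Gauss {x. Hom w x \<in> A} = emeasure Gauss {x. P}"
  proof (rule emeasure_eq_AE[OF _ m])
    show "AE x in Gauss. (x \<in> {x. Hom w x \<in> A}) = (x \<in> {x. P})"
      using AE_Hom_good[OF w] by eventually_elim (use B in auto)
    show "{x. P} \<in> sets Gauss" by (cases P) (auto simp flip: space_Gauss)
  qed
  also have "\<dots> = (if P then 1 else 0)" using Gauss.emeasure_space_1 by simp
  finally show ?thesis unfolding emeasure_Nmeas[OF A] .
qed

text \<open>Under the integral over \<open>w\<close>, the event that the parameter lies in
  \<open>B\<close> has mass \<open>indicator B w\<close>, which gives the law; the complement of
  \<open>good\<close> has mass 0 for every \<open>w\<close>, which gives the convergence.\<close>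

lemma decomposes_imp_limit:
  assumes M: "borel_prob_H M" and d: "decomposes M \<nu>"
  shows "distr M OmegaM param = \<nu>"
    and "AE H in M. \<forall>K. compact K \<longrightarrow> uniform_limit K (\<lambda>N. scaled_det H N) (E_LP (param H)) sequentially"
proof -
  have sM: "sets M = sets HM" and spM: "space M = Herm"
    using M sets_eq_imp_space_eq[of M HM] by (auto simp: borel_prob_H_def)
  have sn: "sets \<nu> = sets OmegaM" and spn: "space \<nu> = Omega"
    using d sets_eq_imp_space_eq[of \<nu> OmegaM] by (auto simp: decomposes_def)
  have E: "emeasure M A = (\<integral>\<^sup>+ w. emeasure (Nmeas w) A \<partial>\<nu>)" if "A \<in> sets HM" for A
    using d that by (simp add: decomposes_def)
  have pm: "param \<in> measurable M OmegaM" using measurable_param sM by (simp cong: measurable_cong_sets)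
  show "distr M OmegaM param = \<nu>"
  proof (rule measure_eqI)
    fix B assume "B \<in> sets (distr M OmegaM param)"
    then have B: "B \<in> sets OmegaM" by simp
    have B': "param -` B \<inter> space HM \<in> sets HM" by (rule measurable_sets[OF measurable_param B])
    have "emeasure (distr M OmegaM param) B = emeasure M (param -` B \<inter> space HM)"
      by (subst emeasure_distr[OF pm B]) (simp add: spM)
    also have "\<dots> = (\<integral>\<^sup>+ w. emeasure (Nmeas w) (param -` B \<inter> space HM) \<partial>\<nu>)" by (rule E[OF B'])
    also have "\<dots> = (\<integral>\<^sup>+ w. indicator B w \<partial>\<nu>)"
    proof (rule nn_integral_cong)
      fix w assume "w \<in> space \<nu>"
      then have w: "w \<in> Omega" by (simp add: spn)
      show "emeasure (Nmeas w) (param -` B \<inter> space HM) = indicator B w"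
        by (subst Nmeas_zero_one[OF w B', of "w \<in> B"]) (auto simp: good_def)
    qed
    also have "\<dots> = emeasure \<nu> B" using B sn by simp
    finally show "emeasure (distr M OmegaM param) B = emeasure \<nu> B" .
  qed (simp add: sn)
  have b: "space HM - good \<in> sets HM" by (rule sets.Diff[OF sets.top good_measurable])
  have "emeasure M (space HM - good) = (\<integral>\<^sup>+ w. emeasure (Nmeas w) (space HM - good) \<partial>\<nu>)" by (rule E[OF b])
  also have "\<dots> = (\<integral>\<^sup>+ w. 0 \<partial>\<nu>)"
    by (rule nn_integral_cong) (subst Nmeas_zero_one[OF _ b, of _ False], auto simp: spn)
  finally have "AE H in M. H \<notin> space HM - good"
    using b sM by (intro AE_not_in) (auto simp: null_sets_def)
  then show "AE H in M. \<forall>K. compact K \<longrightarrow> uniform_limit K (\<lambda>N. scaled_det H N) (E_LP (param H)) sequentially"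
    using AE_space
  proof eventually_elim
    case (elim H)
    then have H: "H \<in> Herm" "H \<in> good" by (auto simp: spM)
    then show ?case by (auto intro!: scaled_det_uniform_limit param_Omega simp: good_def)
  qed
qed

section \<open>Mixtures\<close>

text \<open>The law of \<open>Hom w x\<close> with \<open>w\<close> drawn from \<open>\<nu>\<close>
  and \<open>x\<close> an independent Gaussian family. Tonelli's theorem yields the decomposition,
  through which invariance passes from the components \<open>Nmeas w\<close> to the mixture.\<close>

lemma mixture_exists:
  assumes nu: "borel_prob_Omega \<nu>"
  shows "\<exists>M. borel_prob_H M \<and> U_invariant M \<and> decomposes M \<nu>"
proof -
  have sn: "sets \<nu> = sets OmegaM" and spn: "space \<nu> = Omega" and pn: "prob_space \<nu>"
    using nu sets_eq_imp_space_eq[of \<nu> OmegaM] by (auto simp: borel_prob_Omega_def)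
  interpret nu: prob_space \<nu> by (rule pn)
  interpret P: pair_prob_space \<nu> Gauss ..
  define M where "M = distr (\<nu> \<Otimes>\<^sub>M Gauss) HM (\<lambda>(w, x). Hom w x)"
  have cm: "f \<in> borel_measurable OmegaM \<Longrightarrow> (\<lambda>p. f (fst p)) \<in> borel_measurable (\<nu> \<Otimes>\<^sub>M Gauss)" for f :: "omega \<Rightarrow> real"
    by (rule measurable_compose[OF measurable_fst]) (simp add: sn cong: measurable_cong_sets)
  have jm: "(\<lambda>(w, x). Hom w x) \<in> measurable (\<nu> \<Otimes>\<^sub>M Gauss) HM"
    unfolding split_beta
    by (intro measurable_HM_of_entries measurable_Hom_entry measurable_snd cm[OF measurable_OmegaM_coords(1)]
        cm[OF measurable_OmegaM_coords(2)] cm[OF measurable_OmegaM_coords(3)] cm[OF measurable_OmegaM_coords(4)] Hom_Herm)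
  have pM: "prob_space M" unfolding M_def by (rule P.prob_space_distr[OF jm])
  have sM: "sets M = sets HM" by (simp add: M_def)
  have spM: "space M = space HM" by (simp add: M_def)
  have E: "emeasure M A = (\<integral>\<^sup>+ w. emeasure (Nmeas w) A \<partial>\<nu>)" if A: "A \<in> sets HM" for A
  proof -
    have "emeasure M A = emeasure (\<nu> \<Otimes>\<^sub>M Gauss) ((\<lambda>(w, x). Hom w x) -` A \<inter> space (\<nu> \<Otimes>\<^sub>M Gauss))"
      unfolding M_def by (rule emeasure_distr[OF jm A])
    also have "\<dots> = (\<integral>\<^sup>+ w. emeasure Gauss (Pair w -` ((\<lambda>(w, x). Hom w x) -` A \<inter> space (\<nu> \<Otimes>\<^sub>M Gauss))) \<partial>\<nu>)"
      by (rule Gauss.emeasure_pair_measure_alt) (rule measurable_sets[OF jm A])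
    also have "\<dots> = (\<integral>\<^sup>+ w. emeasure (Nmeas w) A \<partial>\<nu>)"
    proof (rule nn_integral_cong)
      fix w assume "w \<in> space \<nu>"
      then have "Pair w -` ((\<lambda>(w, x). Hom w x) -` A \<inter> space (\<nu> \<Otimes>\<^sub>M Gauss)) = {x. Hom w x \<in> A}"
        by (auto simp: space_pair_measure)
      then show "emeasure Gauss (Pair w -` ((\<lambda>(w, x). Hom w x) -` A \<inter> space (\<nu> \<Otimes>\<^sub>M Gauss))) = emeasure (Nmeas w) A"
        by (simp add: emeasure_Nmeas[OF A])
    qed
    finally show ?thesis .
  qed
  have "decomposes M \<nu>" using E pn sn by (simp add: decomposes_def)
  moreover have "U_invariant M"
    unfolding U_invariant_def
  proof (intro allI impI)
    fix N u assume u: "unitary_N N u"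
    have cb: "conj_by N u \<in> measurable M HM" using measurable_conj_by sM by (simp cong: measurable_cong_sets)
    show "distr M HM (conj_by N u) = M"
    proof (rule measure_eqI)
      fix A assume "A \<in> sets (distr M HM (conj_by N u))"
      then have A: "A \<in> sets HM" by simp
      have "emeasure (distr M HM (conj_by N u)) A = emeasure M (conj_by N u -` A \<inter> space HM)"
        by (subst emeasure_distr[OF cb A]) (simp add: spM)
      also have "\<dots> = (\<integral>\<^sup>+ w. emeasure (Nmeas w) (conj_by N u -` A \<inter> space HM) \<partial>\<nu>)"
        by (rule E[OF measurable_sets[OF measurable_conj_by A]])
      also have "\<dots> = (\<integral>\<^sup>+ w. emeasure (Nmeas w) A \<partial>\<nu>)"
        by (rule nn_integral_cong) (rule Nmeas_conj_by[OF u _ A], simp add: spn)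
      finally show "emeasure (distr M HM (conj_by N u)) A = emeasure M A" using E[OF A] by simp
    qed (simp add: sM)
  qed
  moreover have "borel_prob_H M" using pM sM by (simp add: borel_prob_H_def)
  ultimately show ?thesis by blast
qed

text \<open>The same function \<open>param\<close> of the matrix serves as \<omega> for every
  \<open>M\<close>, in both parts.\<close>

theorem theorem3p1:
  shows "(\<forall>M \<nu>. borel_prob_H M \<and> U_invariant M \<and> decomposes M \<nu> \<longrightarrow>
            (\<exists>\<omega> \<in> measurable HM OmegaM.
               distr M OmegaM \<omega> = \<nu> \<and>
               (AE H in M. \<forall>K. compact K \<longrightarrow>
                  uniform_limit K (\<lambda>N. scaled_det H N) (E_LP (\<omega> H)) sequentially)))
       \<and> (\<forall>\<nu>. borel_prob_Omega \<nu> \<longrightarrow>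
            (\<exists>M. borel_prob_H M \<and> U_invariant M \<and> decomposes M \<nu> \<and>
               (\<exists>\<omega> \<in> measurable HM OmegaM.
                  distr M OmegaM \<omega> = \<nu> \<and>
                  (AE H in M. \<forall>K. compact K \<longrightarrow>
                     uniform_limit K (\<lambda>N. scaled_det H N) (E_LP (\<omega> H)) sequentially))))"
proof (intro conjI allI impI)
  fix M \<nu> assume "borel_prob_H M \<and> U_invariant M \<and> decomposes M \<nu>"
  then show "\<exists>\<omega> \<in> measurable HM OmegaM. distr M OmegaM \<omega> = \<nu> \<and> (AE H in M. \<forall>K. compact K \<longrightarrow>
      uniform_limit K (\<lambda>N. scaled_det H N) (E_LP (\<omega> H)) sequentially)"
    by (intro bexI[OF _ measurable_param] conjI decomposes_imp_limit) blast+
next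
  fix \<nu> assume "borel_prob_Omega \<nu>"
  then obtain M where M: "borel_prob_H M" "U_invariant M" "decomposes M \<nu>"
    using mixture_exists by blast
  show "\<exists>M. borel_prob_H M \<and> U_invariant M \<and> decomposes M \<nu> \<and>
      (\<exists>\<omega> \<in> measurable HM OmegaM. distr M OmegaM \<omega> = \<nu> \<and> (AE H in M. \<forall>K. compact K \<longrightarrow>
         uniform_limit K (\<lambda>N. scaled_det H N) (E_LP (\<omega> H)) sequentially))"
    by (rule exI[of _ M], intro conjI M bexI[OF _ measurable_param] decomposes_imp_limit[OF M(1,3)])
qed

end
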